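(* Let $H$ be a Hilbert space and let $A:D(A)\to H$ be a positive self-adjoint operator with compact inverse, with eigenvalues $0<\lambda_1\le\lambda_2\le\cdots$ and orthonormal basis of eigenvectors $\{e_n\}$. Assume $L_0:=\sup_{n\in\mathbb N}(\lambda_{n+1}-\lambda_n)<\infty$. Then for every $L>\frac12L_0$ such that in addition $L>\lambda_2$, there exists a smooth nonlinearity $F:H\to H$ satisfying $\|F(u)-F(v)\|_H\le L\|u-v\|_H$ for all $u,v\in H$, such that the equation $\partial_t u+Au=F(u)$ possesses a global attractor $\mathcal A$ which contains at least two (distinct) trajectories $u(t)$ and $v(t)$ satisfying $$\|u(t)-v(t)\|_H\le Ce^{-\kappa t^2},\qquad t\ge0,$$ for some positive constants $C$ and $\kappa$.
   Context: A global attractor of the semigroup $S(t)$ generated by $\partial_t u+Au=F(u)$ in $H$ is a compact, strictly invariant set $\mathcal A\subset H$ attracting the images of all bounded subsets of $H$ as $t\to\infty$. A trajectory on the attractor is a solution $u(t)$, $t\in\mathbb R$, of the equation with $u(t)\in\mathcal A$ for all $t$. *)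

theory Defs
  imports "HOL-Analysis.Analysis"
begin

definition densely_defined :: "'a::real_inner set \<Rightarrow> ('a \<Rightarrow> 'a) \<Rightarrow> bool" where
  "densely_defined D A \<longleftrightarrow> subspace D \<and> closure D = UNIV \<and>
     (\<forall>x\<in>D. \<forall>y\<in>D. A (x + y) = A x + A y) \<and> (\<forall>c. \<forall>x\<in>D. A (c *\<^sub>R x) = c *\<^sub>R A x)"

definition adjoint_domain :: "'a::real_inner set \<Rightarrow> ('a \<Rightarrow> 'a) \<Rightarrow> 'a set" where
  "adjoint_domain D A = {v. \<exists>w. \<forall>u\<in>D. inner (A u) v = inner u w}"

definition self_adjoint :: "'a::real_inner set \<Rightarrow> ('a \<Rightarrow> 'a) \<Rightarrow> bool" where
  "self_adjoint D A \<longleftrightarrow> densely_defined D A \<and> adjoint_domain D A = D \<and>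
     (\<forall>u\<in>D. \<forall>v\<in>D. inner (A u) v = inner u (A v))"

definition positive_op :: "'a::real_inner set \<Rightarrow> ('a \<Rightarrow> 'a) \<Rightarrow> bool" where
  "positive_op D A \<longleftrightarrow> (\<forall>u\<in>D. u \<noteq> 0 \<longrightarrow> inner (A u) u > 0)"

definition compact_inverse :: "'a::real_inner set \<Rightarrow> ('a \<Rightarrow> 'a) \<Rightarrow> bool" where
  "compact_inverse D A \<longleftrightarrow> bij_betw A D UNIV \<and>
     (\<forall>B. bounded B \<longrightarrow> compact (closure (the_inv_into D A ` B)))"

definition orthonormal_basis :: "(nat \<Rightarrow> 'a::real_inner) \<Rightarrow> bool" where
  "orthonormal_basis e \<longleftrightarrow> (\<forall>n m. inner (e n) (e m) = (if n = m then 1 else 0)) \<and>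
     closure (span (range e)) = UNIV"

text \<open>Dk x [h1,...,hk] is the k-th Frechet derivative at x applied to h1..hk; each one is a
  bounded k-linear form and is Frechet differentiable (in operator norm) with derivative
  given by the next one.\<close>
definition smooth_map :: "('a::real_normed_vector \<Rightarrow> 'b::real_normed_vector) \<Rightarrow> bool" where
  "smooth_map F \<longleftrightarrow> (\<exists>Dk :: nat \<Rightarrow> 'a \<Rightarrow> 'a list \<Rightarrow> 'b.
     (\<forall>x. Dk 0 x [] = F x) \<and>
     (\<forall>k x. \<exists>M. \<forall>hs. length hs = k \<longrightarrow> norm (Dk k x hs) \<le> M * prod_list (map norm hs)) \<and>
     (\<forall>k x hs. length hs = k \<longrightarrow> linear (\<lambda>h. Dk (Suc k) x (h # hs))) \<and>
     (\<forall>k x. \<forall>\<epsilon>>0. \<exists>\<delta>>0. \<forall>y. norm (y - x) < \<delta> \<longrightarrow>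
        (\<forall>hs. length hs = k \<longrightarrow>
          norm (Dk k y hs - Dk k x hs - Dk (Suc k) x ((y - x) # hs))
            \<le> \<epsilon> * norm (y - x) * prod_list (map norm hs))))"

definition is_solution :: "'a::real_inner set \<Rightarrow> ('a \<Rightarrow> 'a) \<Rightarrow> ('a \<Rightarrow> 'a) \<Rightarrow> real set
    \<Rightarrow> (real \<Rightarrow> 'a) \<Rightarrow> bool" where
  "is_solution D A F I u \<longleftrightarrow> continuous_on I u \<and>
     (\<forall>\<phi>\<in>D. \<forall>t\<in>I. ((\<lambda>s. inner (u s) \<phi>) has_real_derivative
         (inner (F (u t)) \<phi> - inner (u t) (A \<phi>))) (at t within I))"

definition wellposed :: "'a::real_inner set \<Rightarrow> ('a \<Rightarrow> 'a) \<Rightarrow> ('a \<Rightarrow> 'a) \<Rightarrow> bool" where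
  "wellposed D A F \<longleftrightarrow> (\<forall>u0. \<exists>u. is_solution D A F {0..} u \<and> u 0 = u0 \<and>
     (\<forall>v. is_solution D A F {0..} v \<and> v 0 = u0 \<longrightarrow> (\<forall>t\<ge>0. v t = u t)))"

definition semigroup :: "'a::real_inner set \<Rightarrow> ('a \<Rightarrow> 'a) \<Rightarrow> ('a \<Rightarrow> 'a) \<Rightarrow> real \<Rightarrow> 'a \<Rightarrow> 'a" where
  "semigroup D A F t u0 = (THE x. \<exists>u. is_solution D A F {0..} u \<and> u 0 = u0 \<and> u t = x)"

definition global_attractor :: "(real \<Rightarrow> 'a::real_normed_vector \<Rightarrow> 'a) \<Rightarrow> 'a set \<Rightarrow> bool" where
  "global_attractor S \<A> \<longleftrightarrow> \<A> \<noteq> {} \<and> compact \<A> \<and> (\<forall>t\<ge>0. S t ` \<A> = \<A>) \<and>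
     (\<forall>B. bounded B \<longrightarrow> (\<forall>\<epsilon>>0. \<exists>T. \<forall>t\<ge>T. \<forall>b\<in>B. infdist (S t b) \<A> < \<epsilon>))"

definition trajectory_on :: "'a::real_inner set \<Rightarrow> ('a \<Rightarrow> 'a) \<Rightarrow> ('a \<Rightarrow> 'a) \<Rightarrow> 'a set
    \<Rightarrow> (real \<Rightarrow> 'a) \<Rightarrow> bool" where
  "trajectory_on D A F \<A> u \<longleftrightarrow> is_solution D A F UNIV u \<and> (\<forall>t. u t \<in> \<A>)"

end

theory Submission
  imports Defs
begin

text \<open>Choose a chain of eigenvalues \<open>\<mu> 0 = \<lambda> 2 < \<mu> 1 < \<dots>\<close> whose gaps lie in \<open>[c, L0 + c]\<close> with \<open>L0 + c < 2 L\<close>.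
  The two lowest modes carry a clock: \<open>F\<close> turns them uniformly along the unit circle, and \<open>u\<close> is this
  periodic orbit. Twice per turn, when the angle passes \<open>\<plusminus> \<pi> / 2\<close>, the decay rates of neighbouring modes
  \<open>\<mu> k\<close>, \<open>\<mu> (k + 1)\<close> are made equal, which costs a Lipschitz constant of only half their gap, and meanwhile
  an arbitrarily slow rotation by a right angle moves all energy from mode \<open>k\<close> to mode \<open>k + 1\<close>. A
  solution with its deviation from \<open>u\<close> in mode \<open>k\<close> during the half turn \<open>k\<close> decays there at rate at least
  \<open>\<mu> k \<ge> c k\<close>, whence \<open>exp (- \<kappa> t\<^sup>2)\<close>. The role of mode \<open>0\<close> is played by \<open>\<eta> = (1 / r\<^sup>2 - 1) / 2\<close>, \<open>r\<close> being the
  radius in the clock plane: it satisfies an exactly linear equation and may grow backwards in time without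
  the solution becoming unbounded, so that \<open>v\<close> is a bounded complete trajectory.
  The cutoffs confining the construction to a neighbourhood of the circle vary on a logarithmic scale and
  therefore contribute arbitrarily little to the Lipschitz constant.\<close>

section \<open>Smooth maps\<close>

text \<open>The threshold \<open>max (lam 1) (L0 / 2)\<close> is the norm of an almost diagonal
  derivative. A freely turning clock requires cancelling \<open>A\<close> on the first two modes,
  which costs \<open>lam 1\<close>; equalizing chain neighbours costs half their gap. The delicate
  mode is \<open>e 1\<close>: at the angle \<pi>/2 it is the radial direction, and there equalizing
  \<eta> with the next chain mode demands the rate (\<open>mu 0\<close> + \<open>mu 1\<close>) / 2.
  As the chain starts at \<open>mu 0\<close> = \<open>lam 1\<close>, the multiplier of
  \<open>e 1\<close> stays between -G/2 and \<open>lam 1\<close>, where G bounds the gaps, so the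
  two costs do not add up. This explains why the chain starts at the second eigenvalue and why the
  first transfer happens at the angle \<pi>/2, not -\<pi>/2. Cutoffs are steep, but each one in the
  leading part multiplies a quantity vanishing on the circle at first order, so only slope times
  distance matters. The remaining parts of \<open>F\<close> are fixed maps whose Lipschitz constants
  may be huge. They are tamed by prefactors chosen last: a radial relaxation rate \<epsilon>, then
  an angular velocity \<omega> so small that, backwards in time, \<eta> leaves the support of the
  coupling within half a turn.\<close>

definition list_form_bound :: "nat \<Rightarrow> ('a::real_normed_vector \<Rightarrow> 'a list \<Rightarrow> 'b::real_normed_vector) \<Rightarrow> bool" where
  "list_form_bound k G \<longleftrightarrow> (\<forall>R. \<exists>M\<ge>0. \<forall>x hs. norm x \<le> R \<longrightarrow> length hs = k \<longrightarrow>
     norm (G x hs) \<le> M * prod_list (map norm hs))"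

definition list_form_deriv ::
  "nat \<Rightarrow> ('a::real_normed_vector \<Rightarrow> 'a list \<Rightarrow> 'b::real_normed_vector) \<Rightarrow> ('a \<Rightarrow> 'a list \<Rightarrow> 'b) \<Rightarrow> bool" where
  "list_form_deriv k G G' \<longleftrightarrow>
     (\<forall>x hs. length hs = k \<longrightarrow> linear (\<lambda>h. G' x (h # hs))) \<and>
     (\<forall>x. \<forall>\<epsilon>>0. \<exists>\<delta>>0. \<forall>y. norm (y - x) < \<delta> \<longrightarrow>
        (\<forall>hs. length hs = k \<longrightarrow>
          norm (G y hs - G x hs - G' x ((y - x) # hs)) \<le> \<epsilon> * norm (y - x) * prod_list (map norm hs)))"

text \<open>\<open>n\<close> counts the derivatives still available, \<open>k\<close> the directions
  already inserted. Encoding k-linear forms as functions of lists keeps derivatives of all orders in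
  one type; a new direction is put at the head.\<close>

primrec smooth_form :: "nat \<Rightarrow> nat \<Rightarrow> ('a::real_normed_vector \<Rightarrow> 'a list \<Rightarrow> 'b::real_normed_vector) \<Rightarrow> bool" where
  "smooth_form 0 k G \<longleftrightarrow> list_form_bound k G"
| "smooth_form (Suc n) k G \<longleftrightarrow> list_form_bound k G \<and>
     (\<exists>G'. list_form_deriv k G G' \<and> smooth_form n (Suc k) G')"

text \<open>Derivatives of every order are bounded on balls. Balls are not compact in infinite
  dimension, so this uniformity has to be part of the notion; it later yields Lipschitz constants on
  balls.\<close>

definition smooth_bdd :: "('a::real_normed_vector \<Rightarrow> 'b::real_normed_vector) \<Rightarrow> bool" where
  "smooth_bdd f \<longleftrightarrow> (\<forall>n. smooth_form n 0 (\<lambda>x _. f x))"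

lemma prod_list_norm_nonneg: "0 \<le> prod_list (map norm hs)"
  by (induction hs) auto

lemma smooth_form_bound: "smooth_form n k G \<Longrightarrow> list_form_bound k G"
  by (cases n) auto

lemma list_form_boundE:
  assumes "list_form_bound k G"
  obtains M where "M \<ge> 0"
    "\<And>x hs. norm x \<le> R \<Longrightarrow> length hs = k \<Longrightarrow> norm (G x hs) \<le> M * prod_list (map norm hs)"
  using assms unfolding list_form_bound_def by meson

lemma list_form_derivD:
  assumes "list_form_deriv k G G'" "\<epsilon> > 0"
  obtains \<delta> where "\<delta> > 0" "\<And>y hs. norm (y - x) < \<delta> \<Longrightarrow> length hs = k \<Longrightarrow>
          norm (G y hs - G x hs - G' x ((y - x) # hs)) \<le> \<epsilon> * norm (y - x) * prod_list (map norm hs)"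
  using assms unfolding list_form_deriv_def by meson

lemma smooth_form_mono: "smooth_form n k G \<Longrightarrow> m \<le> n \<Longrightarrow> smooth_form m k G"
proof (induction n arbitrary: k G m)
  case 0
  then show ?case by simp
next
  case (Suc n)
  show ?case
  proof (cases m)
    case 0
    then show ?thesis using Suc.prems smooth_form_bound by auto
  next
    case (Suc m')
    then show ?thesis using Suc.prems Suc.IH by auto
  qed
qed

lemma list_form_bound_add:
  assumes "list_form_bound k G" "list_form_bound k H"
  shows "list_form_bound k (\<lambda>x hs. G x hs + H x hs)"
  unfolding list_form_bound_def
proof (intro allI)
  fix R
  obtain M1 where M1: "M1 \<ge> 0" "\<And>x hs. norm x \<le> R \<Longrightarrow> length hs = k \<Longrightarrow> norm (G x hs) \<le> M1 * prod_list (map norm hs)"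
    by (rule list_form_boundE[OF assms(1), of R]) (rule that)
  obtain M2 where M2: "M2 \<ge> 0" "\<And>x hs. norm x \<le> R \<Longrightarrow> length hs = k \<Longrightarrow> norm (H x hs) \<le> M2 * prod_list (map norm hs)"
    by (rule list_form_boundE[OF assms(2), of R]) (rule that)
  have "norm (G x hs + H x hs) \<le> (M1 + M2) * prod_list (map norm hs)"
    if "norm x \<le> R" "length hs = k" for x hs
    using M1(2)[OF that] M2(2)[OF that] norm_triangle_ineq[of "G x hs" "H x hs"]
    by (simp add: algebra_simps)
  then show "\<exists>M\<ge>0. \<forall>x hs. norm x \<le> R \<longrightarrow> length hs = k \<longrightarrow> norm (G x hs + H x hs) \<le> M * prod_list (map norm hs)"
    using M1(1) M2(1) by (intro exI[of _ "M1+M2"]) auto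
qed

lemma list_form_deriv_add:
  assumes "list_form_deriv k G G'" "list_form_deriv k H H'"
  shows "list_form_deriv k (\<lambda>x hs. G x hs + H x hs) (\<lambda>x hs. G' x hs + H' x hs)"
  unfolding list_form_deriv_def
proof (intro conjI allI impI)
  fix x and hs :: "'a list" assume "length hs = k"
  then show "linear (\<lambda>h. G' x (h # hs) + H' x (h # hs))"
    using assms unfolding list_form_deriv_def by (intro linear_compose_add) auto
next
  fix x and \<epsilon> :: real assume "\<epsilon> > 0"
  then have e: "\<epsilon>/2 > 0" by simp
  obtain d1 where d1: "d1 > 0" "\<And>y hs. norm (y - x) < d1 \<Longrightarrow> length hs = k \<Longrightarrow>
     norm (G y hs - G x hs - G' x ((y - x) # hs)) \<le> \<epsilon>/2 * norm (y - x) * prod_list (map norm hs)"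
    by (rule list_form_derivD[OF assms(1) e, of x]) (rule that)
  obtain d2 where d2: "d2 > 0" "\<And>y hs. norm (y - x) < d2 \<Longrightarrow> length hs = k \<Longrightarrow>
     norm (H y hs - H x hs - H' x ((y - x) # hs)) \<le> \<epsilon>/2 * norm (y - x) * prod_list (map norm hs)"
    by (rule list_form_derivD[OF assms(2) e, of x]) (rule that)
  have "norm (G y hs + H y hs - (G x hs + H x hs) - (G' x ((y - x) # hs) + H' x ((y - x) # hs)))
        \<le> \<epsilon> * norm (y - x) * prod_list (map norm hs)"
    if "norm (y - x) < min d1 d2" "length hs = k" for y hs
  proof -
    have "norm (G y hs + H y hs - (G x hs + H x hs) - (G' x ((y - x) # hs) + H' x ((y - x) # hs)))
      = norm ((G y hs - G x hs - G' x ((y - x) # hs)) + (H y hs - H x hs - H' x ((y - x) # hs)))"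
      by (simp add: algebra_simps)
    also have "\<dots> \<le> \<epsilon>/2 * norm (y - x) * prod_list (map norm hs) + \<epsilon>/2 * norm (y - x) * prod_list (map norm hs)"
      using d1(2)[of y hs] d2(2)[of y hs] that by (intro norm_triangle_mono) auto
    finally show ?thesis by (simp add: algebra_simps)
  qed
  then show "\<exists>\<delta>>0. \<forall>y. norm (y - x) < \<delta> \<longrightarrow> (\<forall>hs. length hs = k \<longrightarrow>
      norm (G y hs + H y hs - (G x hs + H x hs) - (G' x ((y - x) # hs) + H' x ((y - x) # hs)))
        \<le> \<epsilon> * norm (y - x) * prod_list (map norm hs))"
    using d1(1) d2(1) by (intro exI[of _ "min d1 d2"]) auto
qed

lemma smooth_form_add:
  "smooth_form n k G \<Longrightarrow> smooth_form n k H \<Longrightarrow> smooth_form n k (\<lambda>x hs. G x hs + H x hs)"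
proof (induction n arbitrary: k G H)
  case 0
  then show ?case by (simp add: list_form_bound_add)
next
  case (Suc n)
  then obtain G' H' where "list_form_deriv k G G'" "smooth_form n (Suc k) G'"
    "list_form_deriv k H H'" "smooth_form n (Suc k) H'" by auto
  then have "list_form_deriv k (\<lambda>x hs. G x hs + H x hs) (\<lambda>x hs. G' x hs + H' x hs)"
    "smooth_form n (Suc k) (\<lambda>x hs. G' x hs + H' x hs)"
    using list_form_deriv_add Suc.IH by blast+
  with Suc.prems show ?case by (auto simp: list_form_bound_add)
qed

text \<open>Differentiating a product of two forms, each fed with a sublist of the directions, inserts
  the new direction into one of the two sublists.\<close>

lemma nths_Cons_Suc: "nths (h # hs) (Suc ` I) = nths hs I"
  by (simp add: nths_Cons image_iff)

lemma nths_Cons_insert: "nths (h # hs) (insert 0 (Suc ` I)) = h # nths hs I"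
  by (simp add: nths_Cons image_iff)

lemma nths_compl_Suc: "nths (h # hs) (- Suc ` I) = h # nths hs (- I)"
proof -
  have "{j. Suc j \<in> - Suc ` I} = - I" "0 \<notin> Suc ` I" by auto
  then show ?thesis by (simp add: nths_Cons)
qed

lemma nths_compl_insert: "nths (h # hs) (- insert 0 (Suc ` I)) = nths hs (- I)"
proof -
  have "{j. Suc j \<in> - insert 0 (Suc ` I)} = - I" by auto
  then show ?thesis by (simp add: nths_Cons)
qed

lemma prod_list_nths_compl:
  fixes hs :: "'a::real_normed_vector list"
  shows "prod_list (map norm (nths hs I)) * prod_list (map norm (nths hs (- I))) = prod_list (map norm hs)"
proof (induction hs arbitrary: I)
  case Nil
  then show ?case by simp
next
  case (Cons h hs)
  have "{j. Suc j \<in> - I} = - {j. Suc j \<in> I}" by auto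
  with Cons.IH[of "{j. Suc j \<in> I}"] show ?case by (auto simp: nths_Cons algebra_simps)
qed

lemma length_nths_eq: "length hs = k \<Longrightarrow> length (nths hs I) = card {i. i < k \<and> i \<in> I}"
  by (simp add: length_nths)

lemma card_shift_insert: "card {i. i < Suc k \<and> i \<in> insert 0 (Suc ` I)} = Suc (card {i. i < k \<and> i \<in> I})"
proof -
  have "{i. i < Suc k \<and> i \<in> insert 0 (Suc ` I)} = insert 0 (Suc ` {i. i < k \<and> i \<in> I})" by auto
  then show ?thesis by (simp add: card_image)
qed

lemma card_shift_Suc: "card {i. i < Suc k \<and> i \<in> Suc ` I} = card {i. i < k \<and> i \<in> I}"
proof -
  have "{i. i < Suc k \<and> i \<in> Suc ` I} = Suc ` {i. i < k \<and> i \<in> I}" by auto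
  then show ?thesis by (simp add: card_image)
qed

lemma card_shift_compl_insert: "card {i. i < Suc k \<and> i \<in> - insert 0 (Suc ` I)} = card {i. i < k \<and> i \<in> - I}"
proof -
  have "{i. i < Suc k \<and> i \<in> - insert 0 (Suc ` I)} = Suc ` {i. i < k \<and> i \<in> - I}"
  proof (intro set_eqI)
    fix i show "i \<in> {i. i < Suc k \<and> i \<in> - insert 0 (Suc ` I)} \<longleftrightarrow> i \<in> Suc ` {i. i < k \<and> i \<in> - I}"
      by (cases i) auto
  qed
  then show ?thesis by (simp add: card_image)
qed

lemma card_shift_compl_Suc: "card {i. i < Suc k \<and> i \<in> - Suc ` I} = Suc (card {i. i < k \<and> i \<in> - I})"
proof -
  have "{i. i < Suc k \<and> i \<in> - Suc ` I} = insert 0 (Suc ` {i. i < k \<and> i \<in> - I})"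
  proof (intro set_eqI)
    fix i show "i \<in> {i. i < Suc k \<and> i \<in> - Suc ` I} \<longleftrightarrow> i \<in> insert 0 (Suc ` {i. i < k \<and> i \<in> - I})"
      by (cases i) auto
  qed
  then show ?thesis by (simp add: card_image)
qed

lemma list_form_bound_scaleR:
  fixes G :: "'a::real_normed_vector \<Rightarrow> 'a list \<Rightarrow> real" and H :: "'a \<Rightarrow> 'a list \<Rightarrow> 'b::real_normed_vector"
  assumes "list_form_bound (card {i. i < k \<and> i \<in> I}) G" "list_form_bound (card {i. i < k \<and> i \<in> - I}) H"
  shows "list_form_bound k (\<lambda>x hs. G x (nths hs I) *\<^sub>R H x (nths hs (- I)))"
  unfolding list_form_bound_def
proof (intro allI)
  fix R
  obtain M1 where M1: "M1 \<ge> 0" "\<And>x hs. norm x \<le> R \<Longrightarrow> length hs = card {i. i < k \<and> i \<in> I}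
      \<Longrightarrow> norm (G x hs) \<le> M1 * prod_list (map norm hs)"
    by (rule list_form_boundE[OF assms(1), of R]) (rule that)
  obtain M2 where M2: "M2 \<ge> 0" "\<And>x hs. norm x \<le> R \<Longrightarrow> length hs = card {i. i < k \<and> i \<in> - I}
      \<Longrightarrow> norm (H x hs) \<le> M2 * prod_list (map norm hs)"
    by (rule list_form_boundE[OF assms(2), of R]) (rule that)
  have "norm (G x (nths hs I) *\<^sub>R H x (nths hs (- I))) \<le> (M1 * M2) * prod_list (map norm hs)"
    if "norm x \<le> R" "length hs = k" for x hs
  proof -
    have "norm (G x (nths hs I) *\<^sub>R H x (nths hs (- I)))
       \<le> (M1 * prod_list (map norm (nths hs I))) * (M2 * prod_list (map norm (nths hs (- I))))"
      unfolding norm_scaleR real_norm_def[symmetric]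
      using that M1 M2 by (intro mult_mono) (auto simp: length_nths_eq prod_list_norm_nonneg)
    also have "\<dots> = (M1 * M2) * prod_list (map norm hs)"
      by (simp add: prod_list_nths_compl[symmetric, of hs I])
    finally show ?thesis .
  qed
  then show "\<exists>M\<ge>0. \<forall>x hs. norm x \<le> R \<longrightarrow> length hs = k \<longrightarrow>
      norm (G x (nths hs I) *\<^sub>R H x (nths hs (- I))) \<le> M * prod_list (map norm hs)"
    using M1(1) M2(1) by (intro exI[of _ "M1*M2"]) auto
qed

text \<open>The remainder is (b - a - a') w + a (w - v - w') + a' (w - v). The first two parts
  inherit the relative error \<epsilon>1, the last is quadratic in \<open>n\<close>, whence
  \<open>M * M * n\<close>. Here \<open>n\<close> is the size of the increment; \<open>p\<close> and
  \<open>r\<close> are the products of the norms of the directions fed to the two factors.\<close>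

lemma scaleR_remainder_bound:
  fixes a b a' :: real and v w w' :: "'b::real_normed_vector"
  assumes "\<bar>b - a - a'\<bar> \<le> \<epsilon>1 * n * p" "norm (w - v - w') \<le> \<epsilon>1 * n * r"
    "\<bar>a\<bar> \<le> M * p" "\<bar>a'\<bar> \<le> M * n * p" "norm v \<le> M * r" "norm w' \<le> M * n * r"
    "0 \<le> p" "0 \<le> r" "0 \<le> n" "0 \<le> M" "0 < \<epsilon>1" "\<epsilon>1 \<le> 1" "n \<le> 1" 
  shows "norm (b *\<^sub>R w - a *\<^sub>R v - (a' *\<^sub>R v + a *\<^sub>R w')) \<le> (\<epsilon>1 * (4 * M + 1) + M * M * n) * n * (p * r)"
proof -
  have eq: "b *\<^sub>R w - a *\<^sub>R v - (a' *\<^sub>R v + a *\<^sub>R w')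
     = (b - a - a') *\<^sub>R w + a *\<^sub>R (w - v - w') + a' *\<^sub>R (w - v)"
    by (simp add: algebra_simps)
  have wv: "norm (w - v) \<le> (\<epsilon>1 + M) * n * r"
    using norm_triangle_ineq[of "w - v - w'" w'] assms(2,6) by (simp add: algebra_simps)
  have "\<epsilon>1 * n * r \<le> 1 * 1 * r" using assms by (intro mult_mono) auto
  moreover have "M * n * r \<le> M * 1 * r" using assms by (intro mult_mono) auto
  ultimately have w: "norm w \<le> (2 * M + 1) * r"
    using norm_triangle_ineq[of "w - v" v] wv assms(5) by (simp add: algebra_simps)
  have 1: "norm ((b - a - a') *\<^sub>R w) \<le> (\<epsilon>1 * n * p) * ((2*M+1) * r)"
    using assms w by (simp add: mult_mono)
  have 2: "norm (a *\<^sub>R (w - v - w')) \<le> (M * p) * (\<epsilon>1 * n * r)"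
    using assms by (simp add: mult_mono)
  have 3: "norm (a' *\<^sub>R (w - v)) \<le> (M * n * p) * ((\<epsilon>1 + M) * n * r)"
    using assms wv by (simp add: mult_mono)
  have "norm (b *\<^sub>R w - a *\<^sub>R v - (a' *\<^sub>R v + a *\<^sub>R w')) \<le>
      (\<epsilon>1 * n * p) * ((2*M+1) * r) + (M * p) * (\<epsilon>1 * n * r) + (M * n * p) * ((\<epsilon>1 + M) * n * r)"
    unfolding eq using 1 2 3 by (intro norm_triangle_mono norm_triangle_le[OF add_mono]) auto
  also have "\<dots> = (\<epsilon>1 * (3 * M + 1) + M * M * n) * n * (p * r) + (M * \<epsilon>1 * n * (p * r)) * n"
    by (simp add: algebra_simps)
  also have "\<dots> \<le> (\<epsilon>1 * (3 * M + 1) + M * M * n) * n * (p * r) + (M * \<epsilon>1 * n * (p * r)) * 1"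
    using assms by (intro add_left_mono mult_left_mono) auto
  finally show ?thesis by (simp add: algebra_simps)
qed

lemma list_form_deriv_bound:
  assumes "list_form_deriv k G G'" "list_form_bound (Suc k) G'"
  shows "\<And>R. \<exists>M\<ge>0. \<forall>x h hs. norm x \<le> R \<longrightarrow> length hs = k \<longrightarrow> norm (G' x (h # hs)) \<le> M * norm h * prod_list (map norm hs)"
proof -
  fix R
  obtain M where M: "M \<ge> 0" "\<And>x hs. norm x \<le> R \<Longrightarrow> length hs = Suc k \<Longrightarrow> norm (G' x hs) \<le> M * prod_list (map norm hs)"
    by (rule list_form_boundE[OF assms(2), of R]) (rule that)
  have "norm (G' x (h # hs)) \<le> M * norm h * prod_list (map norm hs)" if "norm x \<le> R" "length hs = k" for x h hs
    using M(2)[of x "h # hs"] that by (simp add: mult.assoc)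
  with M(1) show "\<exists>M\<ge>0. \<forall>x h hs. norm x \<le> R \<longrightarrow> length hs = k \<longrightarrow> norm (G' x (h # hs)) \<le> M * norm h * prod_list (map norm hs)"
    by blast
qed

lemma list_form_deriv_scaleR:
  fixes G :: "'a::real_normed_vector \<Rightarrow> 'a list \<Rightarrow> real" and H :: "'a \<Rightarrow> 'a list \<Rightarrow> 'b::real_normed_vector"
  assumes dG: "list_form_deriv (card {i. i < k \<and> i \<in> I}) G G'" and dH: "list_form_deriv (card {i. i < k \<and> i \<in> - I}) H H'"
    and bG: "list_form_bound (card {i. i < k \<and> i \<in> I}) G" and bH: "list_form_bound (card {i. i < k \<and> i \<in> - I}) H"
    and bG': "list_form_bound (Suc (card {i. i < k \<and> i \<in> I})) G'" and bH': "list_form_bound (Suc (card {i. i < k \<and> i \<in> - I})) H'"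
  shows "list_form_deriv k (\<lambda>x hs. G x (nths hs I) *\<^sub>R H x (nths hs (- I)))
     (\<lambda>x hs. G' x (nths hs (insert 0 (Suc ` I))) *\<^sub>R H x (nths hs (- insert 0 (Suc ` I)))
        + G x (nths hs (Suc ` I)) *\<^sub>R H' x (nths hs (- Suc ` I)))"
  unfolding list_form_deriv_def nths_Cons_Suc nths_Cons_insert nths_compl_Suc nths_compl_insert
proof (intro conjI allI impI)
  fix x and hs :: "'a list" assume "length hs = k"
  then have "linear (\<lambda>h. G' x (h # nths hs I))" "linear (\<lambda>h. H' x (h # nths hs (-I)))"
    using dG dH unfolding list_form_deriv_def by (auto simp: length_nths_eq)
  then show "linear (\<lambda>h. G' x (h # nths hs I) *\<^sub>R H x (nths hs (- I)) + G x (nths hs I) *\<^sub>R H' x (h # nths hs (- I)))"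
    by (simp add: linear_iff algebra_simps)
next
  fix x :: 'a and \<epsilon> :: real assume \<epsilon>: "\<epsilon> > 0"
  let ?kG = "card {i. i < k \<and> i \<in> I}" and ?kH = "card {i. i < k \<and> i \<in> - I}"
  let ?R = "norm x"
  obtain M1 where "M1 \<ge> 0" "\<forall>x' hs. norm x' \<le> ?R \<longrightarrow> length hs = ?kG \<longrightarrow> norm (G x' hs) \<le> M1 * prod_list (map norm hs)"
    using bG unfolding list_form_bound_def by (elim allE[of _ ?R] exE conjE) (rule that)
  then have M1: "M1 \<ge> 0" "\<And>hs. length hs = ?kG \<Longrightarrow> norm (G x hs) \<le> M1 * prod_list (map norm hs)"
    by simp_all
  obtain M2 where "M2 \<ge> 0" "\<forall>x' hs. norm x' \<le> ?R \<longrightarrow> length hs = ?kH \<longrightarrow> norm (H x' hs) \<le> M2 * prod_list (map norm hs)"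
    using bH unfolding list_form_bound_def by (elim allE[of _ ?R] exE conjE) (rule that)
  then have M2: "M2 \<ge> 0" "\<And>hs. length hs = ?kH \<Longrightarrow> norm (H x hs) \<le> M2 * prod_list (map norm hs)"
    by simp_all
  obtain M3 where "M3 \<ge> 0" "\<forall>x' h hs. norm x' \<le> ?R \<longrightarrow> length hs = ?kG \<longrightarrow> norm (G' x' (h # hs)) \<le> M3 * norm h * prod_list (map norm hs)"
    using list_form_deriv_bound[OF dG bG', of ?R] by (elim exE conjE) (rule that)
  then have M3: "M3 \<ge> 0" "\<And>h hs. length hs = ?kG \<Longrightarrow> norm (G' x (h # hs)) \<le> M3 * norm h * prod_list (map norm hs)"
    by simp_all
  obtain M4 where "M4 \<ge> 0" "\<forall>x' h hs. norm x' \<le> ?R \<longrightarrow> length hs = ?kH \<longrightarrow> norm (H' x' (h # hs)) \<le> M4 * norm h * prod_list (map norm hs)"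
    using list_form_deriv_bound[OF dH bH', of ?R] by (elim exE conjE) (rule that)
  then have M4: "M4 \<ge> 0" "\<And>h hs. length hs = ?kH \<Longrightarrow> norm (H' x (h # hs)) \<le> M4 * norm h * prod_list (map norm hs)"
    by simp_all
  define M where "M = M1 + M2 + M3 + M4"
  have M: "M \<ge> 0" "M1 \<le> M" "M2 \<le> M" "M3 \<le> M" "M4 \<le> M" using M1 M2 M3 M4 by (auto simp: M_def)
  \<comment> \<open>Half of \<epsilon> is spent on the error \<open>e * (4 * M + 1)\<close> of first
    order, the other half, through the choice of \<open>d\<close>, on the quadratic term.\<close>
  define e where "e = min 1 (\<epsilon> / (2 * (4 * M + 1)))"
  have e: "e > 0" "e \<le> 1" "e * (4 * M + 1) \<le> \<epsilon> / 2"
  proof -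
    show "e > 0" "e \<le> 1" using \<epsilon> M by (auto simp: e_def)
    have "e * (4 * M + 1) \<le> \<epsilon> / (2 * (4 * M + 1)) * (4 * M + 1)"
      using M by (intro mult_right_mono) (auto simp: e_def)
    also have "\<dots> = \<epsilon> / 2" using M by (simp add: field_simps)
    finally show "e * (4 * M + 1) \<le> \<epsilon> / 2" .
  qed
  obtain d1 where d1: "d1 > 0" "\<And>y hs. norm (y - x) < d1 \<Longrightarrow> length hs = ?kG \<Longrightarrow>
     norm (G y hs - G x hs - G' x ((y - x) # hs)) \<le> e * norm (y - x) * prod_list (map norm hs)"
    by (rule list_form_derivD[OF dG e(1), of x]) (rule that)
  obtain d2 where d2: "d2 > 0" "\<And>y hs. norm (y - x) < d2 \<Longrightarrow> length hs = ?kH \<Longrightarrow>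
     norm (H y hs - H x hs - H' x ((y - x) # hs)) \<le> e * norm (y - x) * prod_list (map norm hs)"
    by (rule list_form_derivD[OF dH e(1), of x]) (rule that)
  define d where "d = min (min d1 d2) (min 1 (\<epsilon> / (2 * (M * M + 1))))"
  have MM: "M * M + 1 > 0" using mult_nonneg_nonneg[OF M(1) M(1)] by linarith
  have d: "d > 0" "d \<le> d1" "d \<le> d2" "d \<le> 1" "d \<le> \<epsilon> / (2 * (M * M + 1))"
    using d1 d2 \<epsilon> MM by (auto simp: d_def)
  show "\<exists>\<delta>>0. \<forall>y. norm (y - x) < \<delta> \<longrightarrow> (\<forall>hs. length hs = k \<longrightarrow>
      norm (G y (nths hs I) *\<^sub>R H y (nths hs (- I)) - G x (nths hs I) *\<^sub>R H x (nths hs (- I))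
        - (G' x ((y - x) # nths hs I) *\<^sub>R H x (nths hs (- I)) + G x (nths hs I) *\<^sub>R H' x ((y - x) # nths hs (- I))))
        \<le> \<epsilon> * norm (y - x) * prod_list (map norm hs))"
  proof (intro exI[of _ d] conjI allI impI d(1))
    fix y and hs :: "'a list" assume y: "norm (y - x) < d" and k: "length hs = k"
    let ?p = "prod_list (map norm (nths hs I))" and ?r = "prod_list (map norm (nths hs (- I)))" and ?n = "norm (y - x)"
    have l: "length (nths hs I) = ?kG" "length (nths hs (- I)) = ?kH" using k by (auto simp: length_nths_eq)
    have pr: "0 \<le> ?p" "0 \<le> ?r" by (auto simp: prod_list_norm_nonneg)
    have "norm (G y (nths hs I) *\<^sub>R H y (nths hs (- I)) - G x (nths hs I) *\<^sub>R H x (nths hs (- I))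
        - (G' x ((y - x) # nths hs I) *\<^sub>R H x (nths hs (- I)) + G x (nths hs I) *\<^sub>R H' x ((y - x) # nths hs (- I))))
       \<le> (e * (4 * M + 1) + M * M * ?n) * ?n * (?p * ?r)"
    proof (rule scaleR_remainder_bound)
      show "\<bar>G y (nths hs I) - G x (nths hs I) - G' x ((y - x) # nths hs I)\<bar> \<le> e * ?n * ?p"
        using d1(2)[of y "nths hs I"] y d l by simp
      show "norm (H y (nths hs (- I)) - H x (nths hs (- I)) - H' x ((y - x) # nths hs (- I))) \<le> e * ?n * ?r"
        using d2(2)[of y "nths hs (- I)"] y d l by simp
      show "\<bar>G x (nths hs I)\<bar> \<le> M * ?p"
        using M1(2)[OF l(1)] mult_right_mono[OF M(2) pr(1)] by simp
      show "norm (H x (nths hs (- I))) \<le> M * ?r"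
        using M2(2)[OF l(2)] mult_right_mono[OF M(3) pr(2)] by simp
      have "M3 * (?n * ?p) \<le> M * (?n * ?p)" using M pr by (intro mult_right_mono) auto
      then show "\<bar>G' x ((y - x) # nths hs I)\<bar> \<le> M * ?n * ?p"
        using M3(2)[OF l(1), of "y - x"] by (simp add: mult.assoc)
      have "M4 * (?n * ?r) \<le> M * (?n * ?r)" using M pr by (intro mult_right_mono) auto
      then show "norm (H' x ((y - x) # nths hs (- I))) \<le> M * ?n * ?r"
        using M4(2)[OF l(2), of "y - x"] by (simp add: mult.assoc)
    qed (use pr M e y d in auto)
    also have "\<dots> \<le> \<epsilon> * ?n * (?p * ?r)"
    proof -
      have "M * M * ?n \<le> (M * M + 1) * (\<epsilon> / (2 * (M * M + 1)))"
        using y d M MM by (intro mult_mono) auto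
      also have "\<dots> = \<epsilon> / 2" using MM by (simp add: field_simps)
      finally show ?thesis using e pr by (intro mult_right_mono) auto
    qed
    finally show "norm (G y (nths hs I) *\<^sub>R H y (nths hs (- I)) - G x (nths hs I) *\<^sub>R H x (nths hs (- I))
        - (G' x ((y - x) # nths hs I) *\<^sub>R H x (nths hs (- I)) + G x (nths hs I) *\<^sub>R H' x ((y - x) # nths hs (- I))))
        \<le> \<epsilon> * ?n * prod_list (map norm hs)"
      by (simp add: prod_list_nths_compl)
  qed
qed

text \<open>The induction runs over all splits \<open>I\<close> simultaneously, since
  differentiation produces two products with two new splits. In each of them one factor stays
  undifferentiated and is used at the lower order \<open>n\<close>.\<close>

lemma smooth_form_scaleR:
  fixes G :: "'a::real_normed_vector \<Rightarrow> 'a list \<Rightarrow> real" and H :: "'a \<Rightarrow> 'a list \<Rightarrow> 'b::real_normed_vector"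
  assumes "smooth_form n (card {i. i < k \<and> i \<in> I}) G" "smooth_form n (card {i. i < k \<and> i \<in> - I}) H"
  shows "smooth_form n k (\<lambda>x hs. G x (nths hs I) *\<^sub>R H x (nths hs (- I)))"
  using assms
proof (induction n arbitrary: k G H I)
  case 0
  then show ?case by (simp add: list_form_bound_scaleR)
next
  case (Suc n)
  then obtain G' H' where 1: "list_form_deriv (card {i. i < k \<and> i \<in> I}) G G'" "smooth_form n (Suc (card {i. i < k \<and> i \<in> I})) G'"
    "list_form_deriv (card {i. i < k \<and> i \<in> - I}) H H'" "smooth_form n (Suc (card {i. i < k \<and> i \<in> - I})) H'" by auto
  have b: "list_form_bound (card {i. i < k \<and> i \<in> I}) G" "list_form_bound (card {i. i < k \<and> i \<in> - I}) H"
    using Suc.prems by auto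
  have GH: "smooth_form n (card {i. i < k \<and> i \<in> I}) G" "smooth_form n (card {i. i < k \<and> i \<in> - I}) H"
    using Suc.prems smooth_form_mono by (meson lessI less_imp_le)+
  have "smooth_form n (Suc k) (\<lambda>x hs. G' x (nths hs (insert 0 (Suc ` I))) *\<^sub>R H x (nths hs (- insert 0 (Suc ` I)))
        + G x (nths hs (Suc ` I)) *\<^sub>R H' x (nths hs (- Suc ` I)))"
    using 1 GH by (intro smooth_form_add Suc.IH)
      (simp_all only: card_shift_insert card_shift_Suc card_shift_compl_insert card_shift_compl_Suc)
  with list_form_deriv_scaleR[OF 1(1,3) b smooth_form_bound[OF 1(2)] smooth_form_bound[OF 1(4)]]
  show ?case using list_form_bound_scaleR[OF b] by auto
qed

lemma smooth_bdd_add: "smooth_bdd f \<Longrightarrow> smooth_bdd g \<Longrightarrow> smooth_bdd (\<lambda>x. f x + g x)"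
  unfolding smooth_bdd_def by (auto dest: smooth_form_add)

lemma smooth_bdd_scaleR: "smooth_bdd f \<Longrightarrow> smooth_bdd g \<Longrightarrow> smooth_bdd (\<lambda>x. f x *\<^sub>R g x)"
  unfolding smooth_bdd_def using smooth_form_scaleR[where k=0 and I="{}" and G="\<lambda>x _. f x" and H="\<lambda>x _. g x"]
  by auto

section \<open>Constants and bounded linear maps\<close>

lemma smooth_form_zero: "smooth_form n k (\<lambda>_ _. 0)"
proof (induction n arbitrary: k)
  case 0
  then show ?case by (auto simp: list_form_bound_def)
next
  case (Suc n)
  have "list_form_deriv k (\<lambda>_ _. 0) (\<lambda>_ _. 0)"
    unfolding list_form_deriv_def by (auto simp: linear_iff prod_list_norm_nonneg intro!: exI[of _ 1])
  with Suc show ?case by (auto simp: list_form_bound_def)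
qed

lemma smooth_bdd_const: "smooth_bdd (\<lambda>_. c)"
proof -
  have "smooth_form n 0 (\<lambda>_ _. c)" for n
  proof (cases n)
    case 0
    then show ?thesis by (auto simp: list_form_bound_def intro!: exI[of _ "norm c"])
  next
    case (Suc m)
    have "list_form_deriv 0 (\<lambda>_ _. c) (\<lambda>_ _. 0)"
      unfolding list_form_deriv_def by (auto simp: linear_iff intro!: exI[of _ 1])
    with Suc smooth_form_zero show ?thesis by (auto simp: list_form_bound_def intro!: exI[of _ "norm c"])
  qed
  then show ?thesis unfolding smooth_bdd_def by blast
qed

lemma smooth_bdd_bounded_linear:
  assumes "bounded_linear f"
  shows "smooth_bdd f"
proof -
  interpret bounded_linear f by fact
  obtain K where K: "K \<ge> 0" "\<And>x. norm (f x) \<le> norm x * K" using nonneg_bounded by auto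
  have b0: "list_form_bound 0 (\<lambda>x _. f x)"
    unfolding list_form_bound_def
  proof (intro allI)
    fix R
    have "norm (f x) \<le> \<bar>R\<bar> * K" if "norm x \<le> R" for x
      using K(2)[of x] mult_right_mono[OF _ K(1), of "norm x" "\<bar>R\<bar>"] that by fastforce
    then show "\<exists>M\<ge>0. \<forall>x hs. norm x \<le> R \<longrightarrow> length hs = 0 \<longrightarrow> norm (f x) \<le> M * prod_list (map norm (hs::'a list))"
      using K(1) by (intro exI[of _ "\<bar>R\<bar> * K"]) auto
  qed
  have b1: "list_form_bound 1 (\<lambda>_ hs. f (hd hs))"
    unfolding list_form_bound_def using K by (auto simp: length_Suc_conv mult.commute intro!: exI[of _ K])
  have d0: "list_form_deriv 0 (\<lambda>x _. f x) (\<lambda>_ hs. f (hd hs))"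
    unfolding list_form_deriv_def by (auto simp: diff linear_axioms intro!: exI[of _ 1])
  have d1: "list_form_deriv 1 (\<lambda>_ hs. f (hd hs)) (\<lambda>_ _. 0)"
    unfolding list_form_deriv_def by (auto simp: linear_iff prod_list_norm_nonneg intro!: exI[of _ 1])
  have "smooth_form n 0 (\<lambda>x _. f x)" for n
  proof (cases n)
    case 0
    then show ?thesis using b0 by simp
  next
    case (Suc m)
    have "smooth_form m 1 (\<lambda>_ hs. f (hd hs))"
      using b1 d1 smooth_form_zero[of _ 2] by (cases m) (auto simp: numeral_2_eq_2)
    with Suc b0 d0 show ?thesis by auto
  qed
  then show ?thesis by (simp add: smooth_bdd_def)
qed

section \<open>Composition with smooth functions of one real variable\<close>

primrec real_smooth :: "nat \<Rightarrow> real set \<Rightarrow> (real \<Rightarrow> real) \<Rightarrow> bool" where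
  "real_smooth 0 U h \<longleftrightarrow> continuous_on U h"
| "real_smooth (Suc n) U h \<longleftrightarrow> (\<exists>h'. (\<forall>x\<in>U. (h has_real_derivative h' x) (at x)) \<and> real_smooth n U h')"

lemma real_smooth_continuous: "real_smooth n U h \<Longrightarrow> continuous_on U h"
  by (cases n) (auto intro!: continuous_at_imp_continuous_on intro: DERIV_isCont)

lemma list_form_deriv_has_derivative:
  assumes G': "list_form_deriv 0 (\<lambda>x _. f x) G'" "list_form_bound 1 G'"
  shows "(f has_derivative (\<lambda>h. G' x [h])) (at x)"
  unfolding has_derivative_at_alt
proof (intro conjI allI impI)
  have bd: "\<exists>M\<ge>0. \<forall>x h. norm x \<le> R \<longrightarrow> norm (G' x [h]) \<le> M * norm h" for R
    using list_form_deriv_bound[OF G'(1), of R] G'(2) by simp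
  have "linear (\<lambda>h. G' x [h])" using G'(1) unfolding list_form_deriv_def by auto
  moreover obtain M where "\<forall>h. norm (G' x [h]) \<le> M * norm h"
    using bd[of "norm x"] by auto
  ultimately show "bounded_linear (\<lambda>h. G' x [h])"
    by (intro bounded_linear_intro[where K = M]) (auto simp: linear_iff mult.commute)
next
  fix e :: real assume "0 < e"
  then obtain d where "d > 0" "\<And>y hs. norm (y - x) < d \<Longrightarrow> length hs = 0 \<Longrightarrow>
    norm (f y - f x - G' x ((y - x) # hs)) \<le> e * norm (y - x) * prod_list (map norm hs)"
    by (rule list_form_derivD[OF G'(1), of e x]) (rule that)
  then show "\<exists>d>0. \<forall>y. norm (y - x) < d \<longrightarrow> norm (f y - f x - G' x [y - x]) \<le> e * norm (y - x)"
    by fastforce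
qed

lemma smooth_form_has_derivative:
  assumes "smooth_form 1 0 (\<lambda>x _. f x)"
  obtains f' where "\<And>x. (f has_derivative f' x) (at x)"
    "\<And>R. \<exists>M\<ge>0. \<forall>x h. norm x \<le> R \<longrightarrow> norm (f' x h) \<le> M * norm h"
proof -
  obtain G' where G': "list_form_deriv 0 (\<lambda>x _. f x) G'" "list_form_bound 1 G'"
    using assms by auto
  have "\<exists>M\<ge>0. \<forall>x h. norm x \<le> R \<longrightarrow> norm (G' x [h]) \<le> M * norm h" for R
    using list_form_deriv_bound[OF G'(1), of R] G'(2) by simp
  with list_form_deriv_has_derivative[OF G'] show ?thesis by (rule that)
qed

lemma smooth_bddD: "smooth_bdd f \<Longrightarrow> smooth_form n 0 (\<lambda>x _. f x)"
  by (simp add: smooth_bdd_def)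

lemma smooth_bdd_bounded_on_cball:
  fixes f :: "'a::real_normed_vector \<Rightarrow> 'b::real_normed_vector"
  assumes "smooth_bdd f"
  obtains M where "M \<ge> 0" "\<And>x. norm x \<le> R \<Longrightarrow> norm (f x) \<le> M"
proof -
  have "list_form_bound 0 (\<lambda>x _. f x)"
    using smooth_bddD[OF assms, of 0] by simp
  then obtain M where "M \<ge> 0" "\<forall>x hs. norm x \<le> R \<longrightarrow> length hs = 0 \<longrightarrow> norm (f x) \<le> M * prod_list (map norm (hs :: 'a list))"
    unfolding list_form_bound_def by blast
  then show ?thesis using that[of M] by simp
qed

lemma smooth_bdd_has_derivative:
  assumes "smooth_bdd f"
  obtains f' where "\<And>x. (f has_derivative f' x) (at x)"
    "\<And>R. \<exists>M\<ge>0. \<forall>x h. norm x \<le> R \<longrightarrow> norm (f' x h) \<le> M * norm h"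
  using smooth_form_has_derivative[OF smooth_bddD[OF assms, of 1]] by blast

lemma smooth_bdd_lipschitz_on_cball:
  assumes "smooth_bdd f"
  obtains M where "M \<ge> 0" "\<And>x y. norm x \<le> R \<Longrightarrow> norm y \<le> R \<Longrightarrow> norm (f x - f y) \<le> M * norm (x - y)"
proof -
  obtain f' where f': "\<And>x. (f has_derivative f' x) (at x)"
    and bd: "\<And>R. \<exists>M\<ge>0. \<forall>x h. norm x \<le> R \<longrightarrow> norm (f' x h) \<le> M * norm h"
    using smooth_bdd_has_derivative[OF assms] by blast
  obtain M where M: "M \<ge> 0" "\<And>x h. norm x \<le> R \<Longrightarrow> norm (f' x h) \<le> M * norm h"
    using bd[of R] by blast
  have "norm (f x - f y) \<le> M * norm (x - y)" if "norm x \<le> R" "norm y \<le> R" for x y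
  proof (rule differentiable_bound[of "cball 0 R" f f'])
    show "(f has_derivative f' x) (at x within cball 0 R)" for x
      using f' by (rule has_derivative_at_withinI)
    show "onorm (f' x) \<le> M" if "x \<in> cball 0 R" for x
      using M that by (intro onorm_bound) auto
  qed (use that in auto)
  with M(1) show ?thesis by (rule that)
qed

text \<open>By the chain rule the derivative of \<open>h (f x)\<close> is
  \<open>h' (f x) *\<^sub>R f'\<close>, again a product, so the Leibniz rule drives the induction on
  the order. The compact set \<open>K\<close> turns continuity of the derivatives of
  \<open>h\<close> on \<open>U\<close> into bounds uniform on balls.\<close>

lemma smooth_bdd_compose:
  fixes h :: "real \<Rightarrow> real" and f :: "'a::real_normed_vector \<Rightarrow> real"
  assumes h: "\<And>n. real_smooth n U h" and f: "smooth_bdd f"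
    and K: "\<And>R. \<exists>K. compact K \<and> K \<subseteq> U \<and> f ` cball 0 R \<subseteq> K"
  shows "smooth_bdd (\<lambda>x. h (f x))"
proof -
  \<comment> \<open>The witness for the derivative of \<open>f\<close> may depend on the order, so
    one is chosen for each.\<close>
  have "\<forall>n. \<exists>f'. list_form_deriv 0 (\<lambda>x _. f x) f' \<and> smooth_form n 1 f'"
    using smooth_bddD[OF f, of "Suc n" for n] by simp
  from choice[OF this] obtain f' where "\<forall>n. list_form_deriv 0 (\<lambda>x _. f x) (f' n) \<and> smooth_form n 1 (f' n)"
    by (rule exE)
  then have f': "\<And>n. list_form_deriv 0 (\<lambda>x _. f x) (f' n)" "\<And>n. smooth_form n 1 (f' n)"
    by simp_all
  have fU: "f x \<in> U" for x
  proof -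
    obtain K where "K \<subseteq> U" "f ` cball 0 (norm x) \<subseteq> K" using K[of "norm x"] by (elim exE conjE) (rule that)
    moreover have "f x \<in> f ` cball 0 (norm x)" by (rule imageI) simp
    ultimately show ?thesis by (meson subsetD)
  qed
  have bound: "list_form_bound 0 (\<lambda>x _. g (f x))" if g: "continuous_on U g" for g :: "real \<Rightarrow> real"
    unfolding list_form_bound_def
  proof (intro allI)
    fix R
    obtain K where K: "compact K" "K \<subseteq> U" "f ` cball 0 R \<subseteq> K"
      using assms(3)[of R] by (elim exE conjE) (rule that)
    have "compact (g ` K)" using K g by (meson compact_continuous_image continuous_on_subset)
    from compact_imp_bounded[OF this] obtain M where "\<forall>y\<in>g ` K. norm y \<le> M"
      unfolding bounded_iff by (rule exE)
    then have "norm (g (f x)) \<le> max M 0" if "norm x \<le> R" for x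
      using K(3) that by (force simp: image_subset_iff)
    then show "\<exists>M\<ge>0. \<forall>x hs. norm x \<le> R \<longrightarrow> length hs = 0 \<longrightarrow> norm (g (f x)) \<le> M * prod_list (map norm (hs::'a list))"
      by (intro exI[of _ "max M 0"]) auto
  qed
  have "real_smooth n U g \<Longrightarrow> smooth_form n 0 (\<lambda>x _. g (f x))" for n g
  proof (induction n arbitrary: g)
    case 0
    then show ?case using bound by simp
  next
    case (Suc n)
    then obtain g' where g': "\<And>x. x \<in> U \<Longrightarrow> (g has_real_derivative g' x) (at x)" "real_smooth n U g'"
      by auto
    \<comment> \<open>With the split \<open>I = {}\<close> every direction goes to
      \<open>f' n\<close>.\<close>
    have "smooth_form n 1 (\<lambda>x hs. g' (f x) *\<^sub>R f' n x hs)"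
      using smooth_form_scaleR[where k=1 and I="{}" and G="\<lambda>x _. g' (f x)" and H="f' n" and n=n]
        Suc.IH[OF g'(2)] f'(2)[of n] by (simp add: nths_all)
    moreover have "list_form_deriv 0 (\<lambda>x _. g (f x)) (\<lambda>x hs. g' (f x) *\<^sub>R f' n x hs)"
      unfolding list_form_deriv_def
    proof (intro conjI allI impI)
      fix x and hs :: "'a list" assume "length hs = 0"
      then have "linear (\<lambda>h. f' n x (h # hs))" using f'(1)[of n] unfolding list_form_deriv_def by simp
      then show "linear (\<lambda>h. g' (f x) *\<^sub>R f' n x (h # hs))" by (rule linear_compose_scale_right)
    next
      fix x :: 'a and \<epsilon> :: real assume e: "\<epsilon> > 0"
      have "(f has_derivative (\<lambda>h. f' n x [h])) (at x)"
        by (rule list_form_deriv_has_derivative[OF f'(1) smooth_form_bound[OF f'(2)]])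
      moreover have "(g has_derivative (\<lambda>d. g' (f x) * d)) (at (f x))"
        using g'(1)[OF fU] by (simp add: has_field_derivative_def)
      ultimately have "((\<lambda>x. g (f x)) has_derivative (\<lambda>h. g' (f x) * f' n x [h])) (at x)"
        by (rule has_derivative_compose)
      from this[unfolded has_derivative_at_alt, THEN conjunct2, rule_format, OF e]
      obtain d where "d > 0" "\<forall>y. norm (y - x) < d \<longrightarrow> norm (g (f y) - g (f x) - g' (f x) * f' n x [y - x]) \<le> \<epsilon> * norm (y - x)"
        by (elim exE conjE) (rule that)
      then show "\<exists>\<delta>>0. \<forall>y. norm (y - x) < \<delta> \<longrightarrow> (\<forall>hs. length hs = 0 \<longrightarrow>
          norm (g (f y) - g (f x) - g' (f x) *\<^sub>R f' n x ((y - x) # hs)) \<le> \<epsilon> * norm (y - x) * prod_list (map norm hs))"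
        by (intro exI[of _ d]) auto
    qed
    ultimately show ?case
      using bound[OF real_smooth_continuous[OF Suc.prems]] by auto
  qed
  then show ?thesis using h unfolding smooth_bdd_def by simp
qed

text \<open>The witnesses of different orders of smoothness agree, since a Frechet derivative is unique;
  hence they can be chained into a single sequence of derivatives.\<close>

lemma list_form_deriv_unique:
  assumes "list_form_deriv k G G1" "list_form_deriv k G G2" and "length hs = Suc k"
  shows "G1 x hs = G2 x hs"
proof -
  obtain h ts where hs: "hs = h # ts" "length ts = k" using assms(3) by (auto simp: length_Suc_conv)
  let ?P = "prod_list (map norm ts)"
  have lin: "linear (\<lambda>h. G1 x (h # ts))" "linear (\<lambda>h. G2 x (h # ts))"
    using assms hs unfolding list_form_deriv_def by auto
  have "norm (G1 x (h # ts) - G2 x (h # ts)) \<le> e" if "e > 0" for e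
  proof -
    define X where "X = norm h * ?P + 1"
    define e' where "e' = e / (2 * X)"
    have "norm h * ?P \<ge> 0" using prod_list_norm_nonneg[of ts] by (intro mult_nonneg_nonneg) auto
    then have pos: "X > 0" unfolding X_def by linarith
    have "e' > 0" using that pos by (simp add: e'_def)
    obtain d1 where d1: "d1 > 0" "\<And>y hs. norm (y - x) < d1 \<Longrightarrow> length hs = k \<Longrightarrow>
       norm (G y hs - G x hs - G1 x ((y - x) # hs)) \<le> e' * norm (y - x) * prod_list (map norm hs)"
      by (rule list_form_derivD[OF assms(1) \<open>e' > 0\<close>, of x]) (rule that)
    obtain d2 where d2: "d2 > 0" "\<And>y hs. norm (y - x) < d2 \<Longrightarrow> length hs = k \<Longrightarrow>
       norm (G y hs - G x hs - G2 x ((y - x) # hs)) \<le> e' * norm (y - x) * prod_list (map norm hs)"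
      by (rule list_form_derivD[OF assms(2) \<open>e' > 0\<close>, of x]) (rule that)
    define Y where "Y = norm h + 1"
    define t where "t = min d1 d2 / (2 * Y)"
    have np: "Y > 0" using norm_ge_zero[of h] unfolding Y_def by linarith
    have t: "t > 0" using d1 d2 np by (simp add: t_def)
    have "t * norm h \<le> t * Y" using t by (simp add: Y_def)
    also have "\<dots> = min d1 d2 / 2" using np by (simp add: t_def)
    also have "\<dots> < min d1 d2" using d1 d2 by auto
    finally have th: "norm (t *\<^sub>R h) < min d1 d2" using t by simp
    have "norm (G (x + t *\<^sub>R h) ts - G x ts - G1 x ((t *\<^sub>R h) # ts)) \<le> e' * norm (t *\<^sub>R h) * ?P"
      using d1(2)[of "x + t *\<^sub>R h" ts] th hs by simp
    moreover have "norm (G (x + t *\<^sub>R h) ts - G x ts - G2 x ((t *\<^sub>R h) # ts)) \<le> e' * norm (t *\<^sub>R h) * ?P"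
      using d2(2)[of "x + t *\<^sub>R h" ts] th hs by simp
    ultimately have "norm (G1 x ((t *\<^sub>R h) # ts) - G2 x ((t *\<^sub>R h) # ts)) \<le> 2 * (e' * norm (t *\<^sub>R h) * ?P)"
      using norm_triangle_ineq4[of "G (x + t *\<^sub>R h) ts - G x ts - G2 x ((t *\<^sub>R h) # ts)" "G (x + t *\<^sub>R h) ts - G x ts - G1 x ((t *\<^sub>R h) # ts)"]
      by simp
    moreover have "G1 x ((t *\<^sub>R h) # ts) - G2 x ((t *\<^sub>R h) # ts) = t *\<^sub>R (G1 x (h # ts) - G2 x (h # ts))"
      using linear_cmul[OF lin(1), of t h] linear_cmul[OF lin(2), of t h] by (simp only: scaleR_diff_right)
    ultimately have "t * norm (G1 x (h # ts) - G2 x (h # ts)) \<le> 2 * (e' * norm (t *\<^sub>R h) * ?P)"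
      using t by (simp only: norm_scaleR abs_of_pos)
    also have "\<dots> = t * (2 * e' * (norm h * ?P))" using t by simp
    finally have "norm (G1 x (h # ts) - G2 x (h # ts)) \<le> 2 * e' * (norm h * ?P)"
      using t by (simp only: mult_le_cancel_left_pos)
    also have "\<dots> \<le> 2 * e' * X" using \<open>e' > 0\<close> by (simp add: X_def)
    also have "\<dots> = e" using pos by (simp add: e'_def)
    finally show ?thesis .
  qed
  then have "norm (G1 x (h # ts) - G2 x (h # ts)) \<le> 0" by (rule field_le_epsilon) auto
  then show ?thesis using hs by simp
qed

lemma smooth_form_cong:
  assumes "smooth_form n k G" "\<And>x hs. length hs = k \<Longrightarrow> G x hs = H x hs"
  shows "smooth_form n k H"
proof -
  have b: "list_form_bound k H \<longleftrightarrow> list_form_bound k G"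
    unfolding list_form_bound_def using assms(2) by simp
  have d: "list_form_deriv k H G' \<longleftrightarrow> list_form_deriv k G G'" for G'
    unfolding list_form_deriv_def using assms(2) by simp
  show ?thesis using assms(1) by (cases n) (auto simp: b d)
qed

lemma smooth_map_if_smooth_bdd:
  assumes "smooth_bdd F"
  shows "smooth_map F"
proof -
  define nxt where "nxt k G = (SOME G'. list_form_deriv k G G')" for k and G :: "'a \<Rightarrow> 'a list \<Rightarrow> 'b"
  define Dk where "Dk = rec_nat (\<lambda>x _. F x) nxt"
  have Dk0: "Dk 0 = (\<lambda>x _. F x)" and DkS: "Dk (Suc k) = nxt k (Dk k)" for k
    by (simp_all add: Dk_def)
  have step: "list_form_deriv k G (nxt k G) \<and> (\<forall>n. smooth_form n (Suc k) (nxt k G))"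
    if all: "\<forall>n. smooth_form n k G" for k and G :: "'a \<Rightarrow> 'a list \<Rightarrow> 'b"
  proof -
    have "\<exists>G'. list_form_deriv k G G'"
      using spec[OF all, of 1] by auto
    then have d: "list_form_deriv k G (nxt k G)" unfolding nxt_def by (rule someI_ex)
    have "smooth_form n (Suc k) (nxt k G)" for n
    proof -
      obtain G' where "list_form_deriv k G G'" "smooth_form n (Suc k) G'"
        using spec[OF all, of "Suc n"] by auto
      with d show ?thesis using smooth_form_cong[OF \<open>smooth_form n (Suc k) G'\<close>, of "nxt k G"] list_form_deriv_unique by blast
    qed
    with d show ?thesis by simp
  qed
  have sm: "\<forall>n. smooth_form n k (Dk k)" for k
  proof (induction k)
    case 0
    then show ?case using smooth_bddD[OF assms] by (simp add: Dk0)
  next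
    case (Suc k)
    then show ?case using step by (simp add: DkS)
  qed
  have der: "list_form_deriv k (Dk k) (Dk (Suc k))" for k
    using step[OF sm] by (simp add: DkS)
  have bd: "list_form_bound k (Dk k)" for k
    using sm smooth_form_bound by blast
  show ?thesis
    unfolding smooth_map_def
  proof (intro exI[of _ Dk] conjI)
    show "\<forall>x. Dk 0 x [] = F x" by (simp add: Dk0)
    show "\<forall>k x. \<exists>M. \<forall>hs. length hs = k \<longrightarrow> norm (Dk k x hs) \<le> M * prod_list (map norm hs)"
      using bd unfolding list_form_bound_def by (meson order_refl)
    show "\<forall>k x hs. length hs = k \<longrightarrow> linear (\<lambda>h. Dk (Suc k) x (h # hs))"
      using der unfolding list_form_deriv_def by blast
    show "\<forall>k x. \<forall>\<epsilon>>0. \<exists>\<delta>>0. \<forall>y. norm (y - x) < \<delta> \<longrightarrow> (\<forall>hs. length hs = k \<longrightarrow>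
        norm (Dk k y hs - Dk k x hs - Dk (Suc k) x ((y - x) # hs)) \<le> \<epsilon> * norm (y - x) * prod_list (map norm hs))"
      using der unfolding list_form_deriv_def by blast
  qed
qed

section \<open>Slowly varying cutoffs\<close>

lemma real_smooth_cmult_add:
  "real_smooth n U f \<Longrightarrow> real_smooth n U g \<Longrightarrow> real_smooth n U (\<lambda>x. a * f x + b * g x)"
proof (induction n arbitrary: f g)
  case 0
  then show ?case by (auto intro!: continuous_intros)
next
  case (Suc n)
  then obtain f' g' where "\<forall>x\<in>U. (f has_real_derivative f' x) (at x)" "real_smooth n U f'"
    "\<forall>x\<in>U. (g has_real_derivative g' x) (at x)" "real_smooth n U g'" by auto
  with Suc.IH show ?case
    by (auto intro!: exI[of _ "\<lambda>x. a * f' x + b * g' x"] derivative_eq_intros)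
qed

text \<open>The powers in the denominator make the family closed under differentiation up to linear
  combinations. Smoothness of all members, in particular of exp(-1/x) extended by 0, is then a
  single induction.\<close>

definition flat_exp :: "nat \<Rightarrow> real \<Rightarrow> real" where
  "flat_exp k x = (if x > 0 then exp (- (1 / x)) / x ^ k else 0)"

lemma flat_exp_nonneg: "flat_exp k x \<ge> 0"
  by (simp add: flat_exp_def)

lemma power_div_fact_le_exp:
  fixes y :: real
  assumes "0 \<le> y"
  shows "y ^ n / fact n \<le> exp y"
proof -
  have "(\<Sum>i\<in>{n}. y ^ i /\<^sub>R fact i) \<le> (\<Sum>i. y ^ i /\<^sub>R fact i)"
    using assms by (intro sum_le_suminf summable_exp_generic) auto
  then show ?thesis by (simp add: exp_def divide_inverse mult.commute)
qed

text \<open>Keeping only the term of degree k + 2 of the exponential series leaves a factor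
  \<open>x\<^sup>2\<close>, which forces the derivative at 0 to vanish.\<close>

lemma flat_exp_bound:
  assumes "x > 0"
  shows "flat_exp k x \<le> fact (k + 2) * x\<^sup>2"
proof -
  define C :: real where "C = fact (k + 2)"
  define E where "E = exp (1 / x)"
  have pos: "C > 0" "E > 0" by (simp_all add: C_def E_def)
  have "(1 / x) ^ (k + 2) / C \<le> E"
    using power_div_fact_le_exp[of "1 / x" "k + 2"] assms unfolding C_def[symmetric] E_def[symmetric] by simp
  then have "1 / x ^ (k + 2) \<le> E * C"
    using pos by (simp only: divide_le_eq power_one_over if_True)
  then have "1 \<le> E * C * x ^ (k + 2)" using assms by (simp only: divide_le_eq zero_less_power if_True)
  then have "1 \<le> (C * x\<^sup>2) * (E * x ^ k)" by (simp only: power_add power2_eq_square mult_ac)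
  then have "1 / (E * x ^ k) \<le> C * x\<^sup>2" using assms pos by (simp add: divide_le_eq)
  then have "flat_exp k x \<le> C * x\<^sup>2" using assms by (simp add: flat_exp_def exp_minus E_def divide_inverse)
  then show ?thesis unfolding C_def .
qed

lemma flat_exp_has_derivative:
  "(flat_exp k has_real_derivative (- real k * flat_exp (Suc k) x + 1 * flat_exp (k + 2) x)) (at x)"
proof -
  consider "x > 0" | "x < 0" | "x = 0" by linarith
  then show ?thesis
  proof cases
    case 1
    have "((\<lambda>x. exp (- inverse x) * inverse x ^ k) has_real_derivative
        - real k * (exp (- inverse x) * inverse x ^ Suc k) + 1 * (exp (- inverse x) * inverse x ^ (k + 2))) (at x)"
    proof (cases k)
      case 0
      then show ?thesis using 1 by (auto intro!: derivative_eq_intros simp: algebra_simps)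
    next
      case (Suc m)
      then show ?thesis using 1 power_eq_if[of "inverse x" m]
        by (auto intro!: derivative_eq_intros simp: algebra_simps split: if_splits)
    qed
    then have "((\<lambda>x. exp (- (1 / x)) / x ^ k) has_real_derivative (- real k * flat_exp (Suc k) x + 1 * flat_exp (k + 2) x)) (at x)"
      using 1 by (simp add: flat_exp_def divide_inverse power_inverse)
    then show ?thesis
      by (rule has_field_derivative_transform_within_open[of _ _ _ "{0<..}"]) (use 1 in \<open>auto simp: flat_exp_def\<close>)
  next
    case 2
    have "((\<lambda>x. 0) has_real_derivative (- real k * flat_exp (Suc k) x + 1 * flat_exp (k + 2) x)) (at x)"
      using 2 by (auto simp: flat_exp_def)
    then show ?thesis
      by (rule has_field_derivative_transform_within_open[of _ _ _ "{..<0}"]) (use 2 in \<open>auto simp: flat_exp_def\<close>)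
  next
    case 3
    have "(flat_exp k has_real_derivative 0) (at 0)"
    proof (rule has_derivative_imp_has_field_derivative[where D = "\<lambda>_. 0"])
      show "(flat_exp k has_derivative (\<lambda>_. 0)) (at 0)"
        unfolding has_derivative_at_alt
      proof (intro conjI allI impI)
        fix e :: real assume e: "0 < e"
        define C :: real where "C = fact (k + 2)"
        have C: "C > 0" by (simp add: C_def)
        have "norm (flat_exp k y) \<le> e * norm y" if y: "norm y < e / C" for y :: real
        proof (cases "y > 0")
          case True
          have "flat_exp k y \<le> (C * y) * y" using flat_exp_bound[OF True, of k] unfolding C_def[symmetric] by (simp add: power2_eq_square mult.assoc)
          also have "\<dots> \<le> e * y" using y True C by (intro mult_right_mono) (auto simp: field_simps)
          finally show ?thesis using True by (simp add: flat_exp_nonneg)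
        next
          case False
          then show ?thesis using e mult_nonneg_nonneg[of e "\<bar>y\<bar>"] by (simp add: flat_exp_def)
        qed
        then show "\<exists>d>0. \<forall>y. norm (y - 0) < d \<longrightarrow> norm (flat_exp k y - flat_exp k 0 - 0) \<le> e * norm (y - 0)"
          using e C by (intro exI[of _ "e / C"]) (auto simp: flat_exp_def)
      qed simp
    qed simp
    then show ?thesis using 3 by (simp add: flat_exp_def)
  qed
qed

lemma real_smooth_flat_exp: "real_smooth n U (flat_exp k)"
proof (induction n arbitrary: k)
  case 0
  then show ?case by (auto intro!: continuous_at_imp_continuous_on DERIV_isCont flat_exp_has_derivative)
next
  case (Suc n)
  then show ?case
    using flat_exp_has_derivative[of k] real_smooth_cmult_add[OF Suc.IH Suc.IH, of "- real k" "Suc k" 1 "k + 2"]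
    by (auto intro!: exI[of _ "\<lambda>x. - real k * flat_exp (Suc k) x + 1 * flat_exp (k + 2) x"])
qed

lemma real_smooth_powr: "real_smooth n {0<..} (\<lambda>x. c * x powr a)"
proof (induction n arbitrary: a c)
  case 0
  then show ?case by (auto intro!: continuous_intros)
next
  case (Suc n)
  have "((\<lambda>x. c * x powr a) has_real_derivative (c * a) * x powr (a - 1)) (at x)" if "x > 0" for x
    using that by (auto intro!: derivative_eq_intros)
  with Suc[of "c * a" "a - 1"] show ?case
    by (auto intro!: exI[of _ "\<lambda>x. (c * a) * x powr (a - 1)"])
qed

lemma real_smooth_ln: "real_smooth n {0<..} ln"
proof (cases n)
  case 0
  then show ?thesis by (auto intro!: continuous_intros)
next
  case (Suc m)
  have "(ln has_real_derivative 1 * x powr (- 1)) (at x)" if "x > 0" for x :: real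
    using that by (auto intro!: derivative_eq_intros simp: powr_minus field_simps)
  with Suc real_smooth_powr[of m 1 "-1"] show ?thesis
    by (auto intro!: exI[of _ "\<lambda>x. 1 * x powr (- 1)"])
qed

lemma smooth_bdd_compose_UNIV:
  assumes "\<And>n. real_smooth n UNIV h" "smooth_bdd f"
  shows "smooth_bdd (\<lambda>x. h (f x))"
proof (rule smooth_bdd_compose[OF assms])
  fix R
  obtain M where "M \<ge> 0" "\<And>x. norm x \<le> R \<Longrightarrow> norm (f x) \<le> M"
    by (rule smooth_bdd_bounded_on_cball[OF assms(2), of R]) (rule that)
  then show "\<exists>K. compact K \<and> K \<subseteq> UNIV \<and> f ` cball 0 R \<subseteq> K"
    by (intro exI[of _ "{-M..M}"]) (fastforce simp: abs_le_iff)
qed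

lemma smooth_bdd_compose_pos:
  assumes "\<And>n. real_smooth n {0<..} h" "smooth_bdd f" "d > 0" "\<And>x. d \<le> f x"
  shows "smooth_bdd (\<lambda>x. h (f x))"
proof (rule smooth_bdd_compose[OF assms(1,2)])
  fix R
  obtain M where "M \<ge> 0" "\<And>x. norm x \<le> R \<Longrightarrow> norm (f x) \<le> M"
    by (rule smooth_bdd_bounded_on_cball[OF assms(2), of R]) (rule that)
  then show "\<exists>K. compact K \<and> K \<subseteq> {0<..} \<and> f ` cball 0 R \<subseteq> K"
    using assms(3,4) by (intro exI[of _ "{d..M}"]) (fastforce simp: abs_le_iff)
qed

lemma smooth_bdd_mult: "smooth_bdd f \<Longrightarrow> smooth_bdd g \<Longrightarrow> smooth_bdd (\<lambda>x. f x * g x :: real)"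
  using smooth_bdd_scaleR[of f g] by simp

lemma smooth_bdd_cmult: "smooth_bdd g \<Longrightarrow> smooth_bdd (\<lambda>x. c *\<^sub>R g x)"
  using smooth_bdd_scaleR[OF smooth_bdd_const, of g c] .

lemma smooth_bdd_diff: "smooth_bdd f \<Longrightarrow> smooth_bdd g \<Longrightarrow> smooth_bdd (\<lambda>x. f x - g x)"
  using smooth_bdd_add[OF _ smooth_bdd_cmult[of g "-1"], of f] by simp

lemma smooth_bdd_divide:
  fixes f g :: "'a::real_normed_vector \<Rightarrow> real"
  assumes "smooth_bdd f" "smooth_bdd g" "d > 0" "\<And>x. d \<le> g x"
  shows "smooth_bdd (\<lambda>x. f x / g x)"
proof -
  have "smooth_bdd (\<lambda>x. 1 * g x powr (- 1))"
    by (rule smooth_bdd_compose_pos[OF real_smooth_powr assms(2-4)])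
  moreover have "1 * g x powr (- 1) = 1 / g x" for x
    using assms(3) assms(4)[of x] by (simp add: powr_minus field_simps)
  ultimately show ?thesis using smooth_bdd_mult[OF assms(1)] by fastforce
qed

definition smooth_step :: "real \<Rightarrow> real" where
  "smooth_step x = flat_exp 0 x / (flat_exp 0 x + flat_exp 0 (1 - x))"

text \<open>One of x and 1 - x is at least 1/2. Division of \<open>smooth_bdd\<close> functions asks
  for such a uniform lower bound, not merely for positivity.\<close>

lemma smooth_step_denom: "exp (- 2) \<le> flat_exp 0 x + flat_exp 0 (1 - x)"
proof -
  have *: "exp (- 2) \<le> flat_exp 0 y" if "y \<ge> 1 / 2" for y :: real
    using that by (auto simp: flat_exp_def field_simps)
  show ?thesis
  proof (cases "x \<ge> 1/2")
    case True
    then show ?thesis using *[of x] flat_exp_nonneg[of 0 "1-x"] by linarith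
  next
    case False
    then show ?thesis using *[of "1-x"] flat_exp_nonneg[of 0 x] by linarith
  qed
qed

lemma smooth_step_denom_pos: "0 < flat_exp 0 x + flat_exp 0 (1 - x)"
  using smooth_step_denom[of x] by (smt (verit) exp_gt_zero)

lemma smooth_step_ge_0: "0 \<le> smooth_step x" and smooth_step_le_1: "smooth_step x \<le> 1"
  using smooth_step_denom_pos[of x] flat_exp_nonneg[of 0 x] flat_exp_nonneg[of 0 "1 - x"]
  by (auto simp: smooth_step_def)

lemma smooth_step_eq_0: "x \<le> 0 \<Longrightarrow> smooth_step x = 0"
  by (simp add: smooth_step_def flat_exp_def)

lemma smooth_step_eq_1: "1 \<le> x \<Longrightarrow> smooth_step x = 1"
  by (simp add: smooth_step_def flat_exp_def)

lemma smooth_step_pos: "0 < x \<Longrightarrow> 0 < smooth_step x"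
  using smooth_step_denom_pos[of x] by (simp add: smooth_step_def flat_exp_def)

lemma smooth_bdd_smooth_step:
  assumes "smooth_bdd f"
  shows "smooth_bdd (\<lambda>x. smooth_step (f x))"
  unfolding smooth_step_def
  by (intro smooth_bdd_divide[where d = "exp (- 2)"] smooth_bdd_add smooth_step_denom exp_gt_zero
      smooth_bdd_compose_UNIV[OF real_smooth_flat_exp] smooth_bdd_diff smooth_bdd_const assms)

lemma smooth_step_derivative:
  obtains S' K where "\<And>x. (smooth_step has_real_derivative S' x) (at x)" "K > 0" "\<And>x. \<bar>S' x\<bar> \<le> K"
    "\<And>x. x \<notin> {0..1} \<Longrightarrow> S' x = 0"
proof -
  have "smooth_bdd (\<lambda>x::real. smooth_step x)"
    by (intro smooth_bdd_smooth_step smooth_bdd_bounded_linear bounded_linear_ident)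
  then obtain f' where f': "\<And>x. (smooth_step has_derivative f' x) (at x)"
    "\<And>R. \<exists>M\<ge>0. \<forall>x h. norm x \<le> R \<longrightarrow> norm (f' x h) \<le> M * norm h"
    by (rule smooth_bdd_has_derivative) (rule that)
  define S' where "S' x = f' x 1" for x
  have d: "(smooth_step has_real_derivative S' x) (at x)" for x
  proof (rule has_derivative_imp_has_field_derivative[OF f'(1)])
    fix y
    have "bounded_linear (f' x)" using f'(1) by (rule has_derivative_bounded_linear)
    then have "f' x (y *\<^sub>R 1) = y *\<^sub>R f' x 1" by (rule linear_cmul[OF bounded_linear.linear])
    then show "y * S' x = f' x y" by (simp add: S'_def)
  qed
  have z: "S' x = 0" if "x \<notin> {0..1}" for x
  proof -
    have "x < 0 \<or> x > 1" using that by auto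
    then have "(smooth_step has_real_derivative 0) (at x)"
    proof
      assume "x < 0"
      show ?thesis
        by (rule has_field_derivative_transform_within_open[of "\<lambda>_. 0" _ _ "{..<0}"])
          (use \<open>x < 0\<close> in \<open>auto simp: smooth_step_eq_0\<close>)
    next
      assume "x > 1"
      show ?thesis
        by (rule has_field_derivative_transform_within_open[of "\<lambda>_. 1" _ _ "{1<..}"])
          (use \<open>x > 1\<close> in \<open>auto simp: smooth_step_eq_1\<close>)
    qed
    with d show ?thesis by (rule DERIV_unique)
  qed
  \<comment> \<open>The unit ball contains [0, 1], outside of which the derivative vanishes; so the
    bound on this ball is global.\<close>
  obtain M where M: "M \<ge> 0" "\<forall>x h. norm x \<le> 1 \<longrightarrow> norm (f' x h) \<le> M * norm h"
    using f'(2)[of 1] by (elim exE conjE) (rule that)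
  have "\<bar>S' x\<bar> \<le> M + 1" for x
  proof (cases "x \<in> {0..1}")
    case True
    then show ?thesis using M(2)[rule_format, of x 1] by (auto simp: S'_def)
  next
    case False
    then show ?thesis using z M(1) by simp
  qed
  with d z M(1) show ?thesis by (intro that[of S' "M + 1"]) auto
qed

lemma continuous_on_smooth_step [continuous_intros]:
  "continuous_on A f \<Longrightarrow> continuous_on A (\<lambda>x. smooth_step (f x))"
proof -
  have "continuous_on UNIV smooth_step"
    by (rule smooth_step_derivative) (auto intro!: continuous_at_imp_continuous_on DERIV_isCont)
  then show "continuous_on A f \<Longrightarrow> continuous_on A (\<lambda>x. smooth_step (f x))"
    by (rule continuous_on_compose2) auto
qed

text \<open>The logarithm makes the transition slow: \<open>p * \<bar>c' p\<bar>\<close> is of order \<open>\<kappa>\<close>.\<close>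

definition log_cutoff :: "real \<Rightarrow> real \<Rightarrow> real \<Rightarrow> real" where
  "log_cutoff \<kappa> P p = 1 - smooth_step (\<kappa> * ln (1 + p / P) - 1)"

lemma log_cutoff_ge_0: "0 \<le> log_cutoff \<kappa> P p" and log_cutoff_le_1: "log_cutoff \<kappa> P p \<le> 1"
  using smooth_step_ge_0 smooth_step_le_1 by (simp_all add: log_cutoff_def)

lemma log_cutoff_eq_1:
  assumes "0 < \<kappa>" "\<kappa> \<le> 1" "0 < P" "0 \<le> p" "p \<le> P"
  shows "log_cutoff \<kappa> P p = 1"
proof -
  have "ln (1 + p / P) \<le> p / P" using assms by (intro ln_add_one_self_le_self) auto
  also have "\<dots> \<le> 1" using assms by simp
  finally have "\<kappa> * ln (1 + p / P) \<le> 1 * 1" using assms by (intro mult_mono) auto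
  then show ?thesis by (simp add: log_cutoff_def smooth_step_eq_0)
qed

lemma log_cutoff_arg_ge_1:
  fixes \<kappa> P p :: real
  assumes "0 < \<kappa>" "0 < P" "P * exp (2 / \<kappa>) \<le> p"
  shows "1 < \<kappa> * ln (1 + p / P) - 1"
proof -
  have "exp (2 / \<kappa>) \<le> p / P" using assms by (simp add: field_simps)
  then have "exp (2 / \<kappa>) < 1 + p / P" by simp
  then have "2 / \<kappa> < ln (1 + p / P)" by (metis exp_gt_zero less_trans ln_exp ln_less_cancel_iff)
  then show ?thesis using assms by (simp add: field_simps)
qed

lemma log_cutoff_eq_0:
  assumes "0 < \<kappa>" "0 < P" "P * exp (2 / \<kappa>) \<le> p"
  shows "log_cutoff \<kappa> P p = 0"
  using log_cutoff_arg_ge_1[OF assms] by (simp add: log_cutoff_def smooth_step_eq_1)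

text \<open>The derivative is a value of the derivative of the profile times -\<kappa> / (P + p).
  Hence \<open>K\<close> depends on the profile alone, and \<open>K\<close> and \<open>c'\<close>
  can be fixed before \<kappa> and \<open>P\<close> are chosen.\<close>

lemma log_cutoff_derivative:
  obtains K c' where "K > 0"
    "\<And>\<kappa> P p. 0 < P \<Longrightarrow> 0 \<le> p \<Longrightarrow> (log_cutoff \<kappa> P has_real_derivative c' \<kappa> P p) (at p)"
    "\<And>\<kappa> P p. 0 < P \<Longrightarrow> 0 \<le> p \<Longrightarrow> 0 < \<kappa> \<Longrightarrow> \<bar>c' \<kappa> P p\<bar> * (P + p) \<le> K * \<kappa>"
    "\<And>\<kappa> P p. 0 < P \<Longrightarrow> 0 < \<kappa> \<Longrightarrow> P * exp (2 / \<kappa>) \<le> p \<Longrightarrow> c' \<kappa> P p = 0"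
    "\<And>x. \<exists>D. (smooth_step has_real_derivative D) (at x) \<and> \<bar>D\<bar> \<le> K"
proof -
  obtain S' K where S: "\<And>x. (smooth_step has_real_derivative S' x) (at x)" "K > 0" "\<And>x. \<bar>S' x\<bar> \<le> K"
    "\<And>x. x \<notin> {0..1} \<Longrightarrow> S' x = 0" by (rule smooth_step_derivative) (rule that)
  define c' where "c' \<kappa> P p = - (S' (\<kappa> * ln (1 + p / P) - 1) * (\<kappa> / (P + p)))" for \<kappa> P p
  show ?thesis
  proof (rule that[of K c'])
    fix \<kappa> P p :: real assume P: "0 < P"
    { assume p: "0 \<le> p"
      have "((\<lambda>p. \<kappa> * ln (1 + p / P) - 1) has_real_derivative \<kappa> / (P + p)) (at p)"
        using P p by (auto intro!: derivative_eq_intros simp: add_pos_nonneg field_simps)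
      from DERIV_chain2[OF S(1) this]
      show "(log_cutoff \<kappa> P has_real_derivative c' \<kappa> P p) (at p)"
        unfolding log_cutoff_def[abs_def] c'_def by (auto intro!: derivative_eq_intros)
      show "\<bar>c' \<kappa> P p\<bar> * (P + p) \<le> K * \<kappa>" if "0 < \<kappa>"
      proof -
        have "\<bar>c' \<kappa> P p\<bar> * (P + p) = \<bar>S' (\<kappa> * ln (1 + p / P) - 1)\<bar> * \<kappa>"
          using P p that by (simp add: c'_def abs_mult)
        also have "\<dots> \<le> K * \<kappa>" using S(3) that by (intro mult_right_mono) auto
        finally show ?thesis .
      qed }
    show "c' \<kappa> P p = 0" if "0 < \<kappa>" "P * exp (2 / \<kappa>) \<le> p"
      using log_cutoff_arg_ge_1[OF that(1) P that(2)] S(4) by (simp add: c'_def)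
  qed (use S in auto)
qed

lemma smooth_bdd_log_cutoff:
  assumes "smooth_bdd f" "\<And>x. 0 \<le> f x" "0 < P"
  shows "smooth_bdd (\<lambda>x. log_cutoff \<kappa> P (f x))"
proof -
  have "smooth_bdd (\<lambda>x. 1 + (1 / P) *\<^sub>R f x)"
    by (intro smooth_bdd_add smooth_bdd_const smooth_bdd_cmult assms)
  then have "smooth_bdd (\<lambda>x. ln (1 + (1 / P) *\<^sub>R f x))"
    using assms by (intro smooth_bdd_compose_pos[OF real_smooth_ln, where d = 1]) auto
  then have "smooth_bdd (\<lambda>x. 1 - smooth_step (\<kappa> *\<^sub>R ln (1 + (1 / P) *\<^sub>R f x) - 1))"
    by (intro smooth_bdd_diff smooth_bdd_smooth_step smooth_bdd_const smooth_bdd_cmult)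
  then show ?thesis by (simp add: log_cutoff_def)
qed

section \<open>Semilinear equations with compact resolvent\<close>

locale hilbert_basis =
  fixes e :: "nat \<Rightarrow> 'a::{real_inner,complete_space}"
  assumes basis: "orthonormal_basis e"
begin

lemma inner_e: "inner (e n) (e m) = (if n = m then 1 else 0)"
  using basis by (simp add: orthonormal_basis_def)

lemma closure_span_e: "closure (span (range e)) = UNIV"
  using basis by (simp add: orthonormal_basis_def)

lemma norm_e [simp]: "norm (e n) = 1"
  by (simp add: norm_eq_sqrt_inner inner_e)

definition proj :: "nat \<Rightarrow> 'a \<Rightarrow> 'a" where
  "proj N u = (\<Sum>n<N. inner u (e n) *\<^sub>R e n)"

lemma inner_sum_e: "finite I \<Longrightarrow> inner (\<Sum>n\<in>I. a n *\<^sub>R e n) (e m) = (if m \<in> I then a m else 0)"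
  by (simp add: inner_sum_left inner_e if_distrib sum.If_cases cong: if_cong)

lemma norm_sum_e: "finite I \<Longrightarrow> norm (\<Sum>n\<in>I. a n *\<^sub>R e n) = L2_set a I"
  by (simp add: norm_eq_sqrt_inner L2_set_def inner_sum_right inner_sum_e power2_eq_square)

lemma inner_proj_e: "inner (proj N u) (e m) = (if m < N then inner u (e m) else 0)"
  by (simp add: proj_def inner_sum_e)

lemma proj_add: "proj N (u + v) = proj N u + proj N v"
  by (simp add: proj_def inner_add_left algebra_simps sum.distrib)

lemma proj_scaleR: "proj N (c *\<^sub>R u) = c *\<^sub>R proj N u"
  by (simp add: proj_def scaleR_sum_right)

lemma proj_diff: "proj N (u - v) = proj N u - proj N v"
  by (simp add: proj_def inner_diff_left algebra_simps sum_subtractf)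

lemma norm_proj: "norm (proj N u) = L2_set (\<lambda>n. inner u (e n)) {..<N}"
  by (simp add: proj_def norm_sum_e)

lemma bessel:
  assumes "finite I"
  shows "L2_set (\<lambda>n. inner u (e n)) I \<le> norm u"
proof -
  let ?p = "\<Sum>n\<in>I. inner u (e n) *\<^sub>R e n"
  have "inner u ?p = inner ?p ?p"
    using assms by (simp add: inner_sum_right inner_sum_e)
  then have "(norm ?p)\<^sup>2 \<le> norm u * norm ?p"
    using norm_cauchy_schwarz[of u ?p] by (simp add: power2_norm_eq_inner)
  then have "norm ?p \<le> norm u"
    by (cases "norm ?p = 0") (auto simp: power2_eq_square)
  then show ?thesis using assms by (simp add: norm_sum_e)
qed

lemma norm_proj_le: "norm (proj N u) \<le> norm u"
  by (simp add: norm_proj bessel)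

text \<open>Convergence is clear on the span of the basis and passes to its closure because the
  projections are contractions.\<close>

lemma proj_tendsto: "(\<lambda>N. proj N u) \<longlonglongrightarrow> u"
proof -
  let ?V = "{u. (\<lambda>N. proj N u) \<longlonglongrightarrow> u}"
  have "subspace ?V"
  proof (rule subspaceI)
    show "0 \<in> ?V" by (simp add: proj_def)
  qed (auto simp: proj_add proj_scaleR intro!: tendsto_intros)
  moreover have "e m \<in> ?V" for m
  proof -
    have "proj N (e m) = e m" if "N \<ge> Suc m" for N
      using that by (simp add: proj_def inner_e if_distrib if_distribR sum.If_cases cong: if_cong)
    then show ?thesis
      by (auto intro!: tendsto_eventually eventually_sequentiallyI[of "Suc m"])
  qed
  ultimately have span: "span (range e) \<subseteq> ?V" by (intro span_minimal) auto
  show ?thesis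
  proof (rule LIMSEQ_I)
    fix r :: real assume "0 < r"
    have "u \<in> closure (span (range e))" using closure_span_e by simp
    then obtain v where v: "v \<in> span (range e)" "dist v u < r / 3"
      using closure_approachable[of u "span (range e)"] \<open>0 < r\<close> by (meson divide_pos_pos zero_less_numeral)
    have "(\<lambda>N. proj N v) \<longlonglongrightarrow> v" using span v by auto
    then obtain N0 where N0: "\<And>N. N \<ge> N0 \<Longrightarrow> norm (proj N v - v) < r / 3"
      using LIMSEQ_D[of "\<lambda>N. proj N v" v "r/3"] \<open>0 < r\<close> by auto
    have "norm (proj N u - u) < r" if "N \<ge> N0" for N
    proof -
      have "proj N u - u = proj N (u - v) + (proj N v - v) + (v - u)" by (simp add: proj_diff)
      then have "norm (proj N u - u) \<le> norm (proj N (u - v)) + norm (proj N v - v) + norm (v - u)"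
        by (metis norm_triangle_ineq norm_triangle_le add_right_mono)
      moreover have "norm (proj N (u - v)) \<le> norm (v - u)" using norm_proj_le[of N "u - v"] by (simp add: norm_minus_commute)
      ultimately show ?thesis using N0[OF that] v(2) by (simp add: dist_norm)
    qed
    then show "\<exists>no. \<forall>n\<ge>no. norm (proj n u - u) < r" by blast
  qed
qed

lemma coord_eqI: "(\<And>n. inner u (e n) = inner v (e n)) \<Longrightarrow> u = v"
  using LIMSEQ_unique[OF proj_tendsto[of u]] proj_tendsto[of v] by (simp add: proj_def)

lemma norm_le_L2_set:
  assumes "\<And>N. L2_set (\<lambda>n. inner u (e n)) {..<N} \<le> B"
  shows "norm u \<le> B"
  using assms by (intro LIMSEQ_le_const2[OF tendsto_norm[OF proj_tendsto[of u]]]) (auto simp: norm_proj)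

lemma inner_sums: "(\<lambda>n. inner u (e n) * inner v (e n)) sums inner u v"
  unfolding sums_def
  using tendsto_inner[OF proj_tendsto[of u] tendsto_const[of v]]
  by (simp add: proj_def inner_sum_left inner_commute[of "e _"])

lemma inner_proj_right: "inner x (proj N y) = (\<Sum>n<N. inner x (e n) * inner y (e n))"
  by (simp add: proj_def inner_sum_right mult.commute)

lemma riesz_fischer:
  assumes "\<And>N. L2_set a {..<N} \<le> B"
  obtains u where "\<And>n. inner u (e n) = a n" "norm u \<le> B"
proof -
  define s where "s N = (\<Sum>n<N. a n *\<^sub>R e n)" for N
  have sq: "(\<Sum>n<N. (a n)\<^sup>2) \<le> B\<^sup>2" for N
    using power_mono[OF assms L2_set_nonneg, of N 2] by (simp add: L2_set_def sum_nonneg)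
  have sm: "summable (\<lambda>n. (a n)\<^sup>2)"
    by (rule summableI_nonneg_bounded[of _ "B\<^sup>2"]) (auto simp: sq)
  have "Cauchy s"
  proof (rule CauchyI)
    fix r :: real assume r: "0 < r"
    then have "r\<^sup>2 > 0" by simp
    then obtain N0 where N0: "\<And>m n. m \<ge> N0 \<Longrightarrow> norm (\<Sum>k=m..<n. (a k)\<^sup>2) < r\<^sup>2"
      using sm unfolding summable_Cauchy by blast
    have less: "norm (s m - s n) < r" if mn: "N0 \<le> m" "m \<le> n" for m n
    proof -
      have "s n - s m = (\<Sum>k=m..<n. a k *\<^sub>R e k)"
        unfolding s_def using mn by (simp add: sum_diff_nat_ivl lessThan_atLeast0)
      then have "norm (s m - s n) = L2_set a {m..<n}" by (simp add: norm_sum_e norm_minus_commute[of "s m"])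
      also have "\<dots> < r"
        using N0[OF mn(1), of n] r real_sqrt_less_mono[of "\<Sum>k=m..<n. (a k)\<^sup>2" "r\<^sup>2"]
        by (simp add: L2_set_def sum_nonneg)
      finally show ?thesis .
    qed
    then have "norm (s m - s n) < r" if "N0 \<le> m" "N0 \<le> n" for m n
      using that less[of m n] less[of n m] by (cases "m \<le> n") (simp_all add: norm_minus_commute)
    then show "\<exists>M. \<forall>m\<ge>M. \<forall>n\<ge>M. norm (s m - s n) < r" by blast
  qed
  then obtain u where u: "s \<longlonglongrightarrow> u" using Cauchy_convergent convergent_def by blast
  have c: "inner u (e n) = a n" for n
  proof (rule LIMSEQ_unique[OF tendsto_inner[OF u tendsto_const]])
    show "(\<lambda>N. inner (s N) (e n)) \<longlonglongrightarrow> a n"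
      by (rule tendsto_eventually) (rule eventually_sequentiallyI[of "Suc n"], simp add: s_def inner_sum_e)
  qed
  moreover have "norm u \<le> B" by (rule norm_le_L2_set) (simp add: c assms)
  ultimately show ?thesis by (rule that)
qed

text \<open>Pointwise convergence of contractions is uniform on compact sets: the finitely many
  centres of an r/3-net control all other points.\<close>

lemma compact_uniform_proj:
  assumes "compact K" "0 < r"
  obtains N0 where "\<And>N x. N \<ge> N0 \<Longrightarrow> x \<in> K \<Longrightarrow> norm (x - proj N x) < r"
proof -
  have "\<exists>F. finite F \<and> K \<subseteq> (\<Union>x\<in>F. ball x (r / 3))"
    using assms(1)[unfolded compact_eq_totally_bounded, THEN conjunct2, rule_format, of "r / 3"] assms(2) by simp
  then obtain F where F: "finite F" "K \<subseteq> (\<Union>x\<in>F. ball x (r / 3))"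
    by (elim exE conjE) (rule that)
  have "\<exists>N0. \<forall>N\<ge>N0. norm (proj N x - x) < r / 3" for x
    using LIMSEQ_D[OF proj_tendsto[of x], of "r / 3"] assms(2) by auto
  then obtain n0 where n0: "\<And>x N. N \<ge> n0 x \<Longrightarrow> norm (proj N x - x) < r / 3" by metis
  show ?thesis
  proof (rule that[of "Max (insert 0 (n0 ` F))"])
    fix N x assume N: "Max (insert 0 (n0 ` F)) \<le> N" and x: "x \<in> K"
    then obtain y where y: "y \<in> F" "dist y x < r / 3" using F by auto
    then have "n0 y \<le> N" using N F by auto
    from n0[OF this] have 1: "norm (y - proj N y) < r / 3" by (simp add: norm_minus_commute)
    have "x - proj N x = (x - y) + (y - proj N y) + proj N (y - x)" by (simp add: proj_diff)
    then have "norm (x - proj N x) \<le> norm (x - y) + norm (y - proj N y) + norm (proj N (y - x))"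
      by (metis norm_triangle_ineq norm_triangle_le add_right_mono)
    moreover have "norm (proj N (y - x)) \<le> norm (x - y)" using norm_proj_le[of N "y - x"] by (simp add: norm_minus_commute)
    moreover have "norm (x - y) < r / 3" using y(2) by (simp add: dist_norm norm_minus_commute)
    ultimately show "norm (x - proj N x) < r" using 1 by linarith
  qed
qed

end

section \<open>Scalar linear equations and Gronwall's inequality\<close>

text \<open>Minkowski's inequality for Duhamel's formula, by duality: \<open>a\<close> is paired
  with itself, Cauchy-Schwarz is applied under scalar integrals, and one factor
  \<open>L2_set a I\<close> is divided out. In this way only integrals of real functions
  occur.\<close>

lemma L2_set_convolution:
  fixes a c l :: "nat \<Rightarrow> real" and g :: "real \<Rightarrow> real"
  assumes "finite I" and "0 \<le> t"
    and a: "\<And>n. n \<in> I \<Longrightarrow> a n = exp (- l n * t) * c n + integral {0..t} (\<lambda>s. exp (- l n * (t - s)) * \<phi> n s)"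
    and \<phi>: "\<And>n. n \<in> I \<Longrightarrow> continuous_on {0..t} (\<phi> n)"
    and C: "L2_set c I \<le> C"
    and g: "\<And>s. s \<in> {0..t} \<Longrightarrow> L2_set (\<lambda>n. \<phi> n s) I \<le> g s" "continuous_on {0..t} g"
    and \<mu>: "\<And>n. n \<in> I \<Longrightarrow> \<mu> \<le> l n"
  shows "L2_set a I \<le> exp (- \<mu> * t) * C + integral {0..t} (\<lambda>s. exp (- \<mu> * (t - s)) * g s)"
proof -
  let ?A = "L2_set a I" and ?B = "exp (- \<mu> * t) * C + integral {0..t} (\<lambda>s. exp (- \<mu> * (t - s)) * g s)"
  have dual: "(\<Sum>n\<in>I. a n * (exp (- l n * r) * b n)) \<le> ?A * (exp (- \<mu> * r) * L2_set b I)" if "0 \<le> r" for r b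
  proof -
    have "(\<Sum>n\<in>I. a n * (exp (- l n * r) * b n)) \<le> (\<Sum>n\<in>I. exp (- \<mu> * r) * (\<bar>a n\<bar> * \<bar>b n\<bar>))"
    proof (rule sum_mono)
      fix n assume "n \<in> I"
      then have "\<mu> * r \<le> l n * r" using \<mu> that by (intro mult_right_mono) auto
      then have "exp (- l n * r) \<le> exp (- \<mu> * r)" by simp
      then have "exp (- l n * r) * (\<bar>a n\<bar> * \<bar>b n\<bar>) \<le> exp (- \<mu> * r) * (\<bar>a n\<bar> * \<bar>b n\<bar>)"
        by (intro mult_right_mono) auto
      moreover have "a n * (exp (- l n * r) * b n) \<le> exp (- l n * r) * (\<bar>a n\<bar> * \<bar>b n\<bar>)"
        using abs_ge_self[of "a n * (exp (- l n * r) * b n)"] by (simp add: abs_mult algebra_simps)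
      ultimately show "a n * (exp (- l n * r) * b n) \<le> exp (- \<mu> * r) * (\<bar>a n\<bar> * \<bar>b n\<bar>)" by linarith
    qed
    also have "\<dots> = exp (- \<mu> * r) * (\<Sum>n\<in>I. \<bar>a n\<bar> * \<bar>b n\<bar>)" by (simp add: sum_distrib_left)
    also have "\<dots> \<le> exp (- \<mu> * r) * (?A * L2_set b I)"
      by (intro mult_left_mono L2_set_mult_ineq) auto
    finally show ?thesis by (simp add: algebra_simps)
  qed
  have int1: "(\<lambda>s. a n * (exp (- l n * (t - s)) * \<phi> n s)) integrable_on {0..t}" if "n \<in> I" for n
    using \<phi>[OF that] by (intro integrable_continuous_real continuous_intros)
  have "?A\<^sup>2 = (\<Sum>n\<in>I. a n * a n)" by (simp add: L2_set_def sum_nonneg power2_eq_square)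
  also have "\<dots> = (\<Sum>n\<in>I. a n * (exp (- l n * t) * c n) + integral {0..t} (\<lambda>s. a n * (exp (- l n * (t - s)) * \<phi> n s)))"
  proof (rule sum.cong[OF refl])
    fix n assume n: "n \<in> I"
    have "a n * a n = a n * (exp (- l n * t) * c n + integral {0..t} (\<lambda>s. exp (- l n * (t - s)) * \<phi> n s))"
      using a[OF n] by simp
    then show "a n * a n = a n * (exp (- l n * t) * c n) + integral {0..t} (\<lambda>s. a n * (exp (- l n * (t - s)) * \<phi> n s))"
      by (simp add: distrib_left)
  qed
  also have "\<dots> = (\<Sum>n\<in>I. a n * (exp (- l n * t) * c n)) + (\<Sum>n\<in>I. integral {0..t} (\<lambda>s. a n * (exp (- l n * (t - s)) * \<phi> n s)))"
    by (rule sum.distrib)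
  also have "(\<Sum>n\<in>I. integral {0..t} (\<lambda>s. a n * (exp (- l n * (t - s)) * \<phi> n s)))
      = integral {0..t} (\<lambda>s. \<Sum>n\<in>I. a n * (exp (- l n * (t - s)) * \<phi> n s))"
    using int1 assms(1) by (simp add: integral_sum)
  also have "\<dots> \<le> integral {0..t} (\<lambda>s. ?A * (exp (- \<mu> * (t - s)) * g s))"
  proof (rule integral_le)
    show "(\<lambda>s. \<Sum>n\<in>I. a n * (exp (- l n * (t - s)) * \<phi> n s)) integrable_on {0..t}"
      using int1 assms(1) by (intro integrable_sum)
    show "(\<lambda>s. ?A * (exp (- \<mu> * (t - s)) * g s)) integrable_on {0..t}"
      using g(2) by (intro integrable_continuous_real continuous_intros)
    fix s assume s: "s \<in> {0..t}"
    have "(\<Sum>n\<in>I. a n * (exp (- l n * (t - s)) * \<phi> n s)) \<le> ?A * (exp (- \<mu> * (t - s)) * L2_set (\<lambda>n. \<phi> n s) I)"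
      using dual[of "t - s" "\<lambda>n. \<phi> n s"] s by auto
    also have "\<dots> \<le> ?A * (exp (- \<mu> * (t - s)) * g s)"
      using g(1)[OF s] by (intro mult_left_mono) auto
    finally show "(\<Sum>n\<in>I. a n * (exp (- l n * (t - s)) * \<phi> n s)) \<le> ?A * (exp (- \<mu> * (t - s)) * g s)" .
  qed
  also have "(\<Sum>n\<in>I. a n * (exp (- l n * t) * c n)) \<le> ?A * (exp (- \<mu> * t) * C)"
  proof -
    have "?A * (exp (- \<mu> * t) * L2_set c I) \<le> ?A * (exp (- \<mu> * t) * C)"
      using C by (intro mult_left_mono) auto
    with dual[OF assms(2), of c] show ?thesis by linarith
  qed
  finally have "?A\<^sup>2 \<le> ?A * ?B" by (simp add: distrib_left)
  moreover have "0 \<le> ?B"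
  proof -
    have "0 \<le> C" using C L2_set_nonneg[of c I] by linarith
    moreover have "0 \<le> integral {0..t} (\<lambda>s. exp (- \<mu> * (t - s)) * g s)"
    proof (rule integral_nonneg)
      show "(\<lambda>s. exp (- \<mu> * (t - s)) * g s) integrable_on {0..t}"
        using g(2) by (intro integrable_continuous_real continuous_intros)
      show "0 \<le> exp (- \<mu> * (t - s)) * g s" if "s \<in> {0..t}" for s
        using order_trans[OF L2_set_nonneg g(1)[OF that]] by simp
    qed
    ultimately show ?thesis by auto
  qed
  ultimately show ?thesis
    by (cases "?A = 0") (auto simp: power2_eq_square L2_set_nonneg order.strict_iff_order)
qed

lemma linear_ode_solution:
  fixes y \<phi> :: "real \<Rightarrow> real"
  assumes "\<And>t. t \<in> {0..T} \<Longrightarrow> (y has_real_derivative \<phi> t - l * y t) (at t within {0..T})"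
    and "t \<in> {0..T}"
  shows "y t = exp (- l * t) * y 0 + integral {0..t} (\<lambda>s. exp (- l * (t - s)) * \<phi> s)"
proof -
  have "((\<lambda>s. exp (- l * (t - s)) * \<phi> s) has_integral
      exp (- l * (t - t)) * y t - exp (- l * (t - 0)) * y 0) {0..t}"
  proof (rule fundamental_theorem_of_calculus)
    fix s assume s: "s \<in> {0..t}"
    have "(y has_real_derivative \<phi> s - l * y s) (at s within {0..t})"
      by (rule has_field_derivative_subset[OF assms(1)]) (use assms(2) s in auto)
    then have "((\<lambda>s. exp (- l * (t - s)) * y s) has_real_derivative exp (- l * (t - s)) * \<phi> s) (at s within {0..t})"
      by (auto intro!: derivative_eq_intros simp: algebra_simps)
    then show "((\<lambda>s. exp (- l * (t - s)) * y s) has_vector_derivative exp (- l * (t - s)) * \<phi> s) (at s within {0..t})"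
      by (simp add: has_real_derivative_iff_has_vector_derivative)
  qed (use assms in auto)
  then show ?thesis by (simp add: integral_unique)
qed

text \<open>Factoring out \<open>exp (- l * t)\<close> removes \<open>t\<close> from the integrand,
  so that differentiation only concerns the upper limit.\<close>

lemma linear_ode_exists:
  fixes \<phi> :: "real \<Rightarrow> real"
  assumes "continuous_on {0..} \<phi>" and "0 \<le> t"
  shows "((\<lambda>t. exp (- l * t) * y0 + integral {0..t} (\<lambda>s. exp (- l * (t - s)) * \<phi> s)) has_real_derivative
     \<phi> t - l * (exp (- l * t) * y0 + integral {0..t} (\<lambda>s. exp (- l * (t - s)) * \<phi> s))) (at t within {0..})"
proof -
  have fac: "integral {0..t} (\<lambda>s. exp (- l * (t - s)) * \<phi> s) = exp (- l * t) * integral {0..t} (\<lambda>s. exp (l * s) * \<phi> s)" for t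
  proof -
    have "exp (- l * (t - s)) * \<phi> s = exp (- l * t) * (exp (l * s) * \<phi> s)" for s
    proof -
      have "- l * (t - s) = - l * t + l * s" by (simp add: algebra_simps)
      then show ?thesis by (simp only: exp_add mult.assoc)
    qed
    then have "(\<lambda>s. exp (- l * (t - s)) * \<phi> s) = (\<lambda>s. exp (- l * t) * (exp (l * s) * \<phi> s))" by (rule ext)
    then show ?thesis by simp
  qed
  have c: "continuous_on {0..t+1} (\<lambda>s. exp (l * s) * \<phi> s)"
    using assms(1) by (intro continuous_intros) (auto intro: continuous_on_subset)
  have "((\<lambda>t. integral {0..t} (\<lambda>s. exp (l * s) * \<phi> s)) has_real_derivative exp (l * t) * \<phi> t) (at t within {0..t+1})"
    using integral_has_real_derivative[OF c, of t] assms(2) by auto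
  then have d: "((\<lambda>t. integral {0..t} (\<lambda>s. exp (l * s) * \<phi> s)) has_real_derivative exp (l * t) * \<phi> t) (at t within {0..})"
    using assms(2) by (subst (asm) at_within_nhd[of t "{..<t+1}" "{0..t+1}" "{0..}"]) auto
  show ?thesis
    unfolding fac using d
    by (auto intro!: derivative_eq_intros simp: exp_minus algebra_simps)
qed

lemma gronwall:
  fixes g :: "real \<Rightarrow> real"
  assumes "continuous_on {0..T} g" "0 \<le> L"
    and "\<And>t. t \<in> {0..T} \<Longrightarrow> g t \<le> a + L * integral {0..t} g"
    and "t \<in> {0..T}"
  shows "g t \<le> a * exp (L * t)"
proof -
  \<comment> \<open>With this integrating factor the upper bound becomes nonincreasing: its
    derivative is a nonnegative multiple of \<open>g\<close> minus that bound.\<close>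
  define h where "h t = exp (- L * t) * (a + L * integral {0..t} g)" for t
  have "h t \<le> h 0"
  proof (rule DERIV_nonpos_imp_decreasing_open[of 0 t h])
    show "0 \<le> t" using assms(4) by simp
    have d: "(h has_real_derivative exp (- L * s) * L * (g s - (a + L * integral {0..s} g))) (at s within {0..T})"
      if "s \<in> {0..T}" for s
      unfolding h_def using integral_has_real_derivative[OF assms(1) that]
      by (auto intro!: derivative_eq_intros simp: algebra_simps)
    show "continuous_on {0..t} h"
      using assms(4) by (intro continuous_on_subset[OF DERIV_continuous_on[OF d]]) auto
    fix s assume s: "0 < s" "s < t"
    have "(h has_real_derivative exp (- L * s) * L * (g s - (a + L * integral {0..s} g))) (at s)"
      using d[of s] s assms(4) at_within_interior[of s "{0..T}"] by auto
    moreover have "exp (- L * s) * L * (g s - (a + L * integral {0..s} g)) \<le> 0"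
      using assms(3)[of s] s assms(2,4) by (intro mult_nonneg_nonpos) auto
    ultimately show "\<exists>y. (h has_real_derivative y) (at s) \<and> y \<le> 0" by blast
  qed
  then have "a + L * integral {0..t} g \<le> a * exp (L * t)"
    by (simp add: h_def exp_minus field_simps)
  with assms(3)[OF assms(4)] show ?thesis by linarith
qed

section \<open>The linear operator in coordinates\<close>

locale spectral_op = hilbert_basis e
  for e :: "nat \<Rightarrow> 'a::{real_inner,complete_space}" +
  fixes D :: "'a set" and A :: "'a \<Rightarrow> 'a" and lam :: "nat \<Rightarrow> real"
  assumes e_in_D: "e n \<in> D" and A_e: "A (e n) = lam n *\<^sub>R e n"
    and A_sym: "u \<in> D \<Longrightarrow> v \<in> D \<Longrightarrow> inner (A u) v = inner u (A v)"
    and lam_0: "0 < lam 0" and lam_mono: "incseq lam"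
    and lam_lim: "filterlim lam at_top sequentially"
begin

lemma lam_pos: "0 < lam n"
  using lam_0 incseqD[OF lam_mono, of 0 n] by linarith

lemma inner_A_e: "v \<in> D \<Longrightarrow> inner (A v) (e n) = lam n * inner v (e n)"
  using A_sym[of v "e n"] e_in_D A_e by simp

text \<open>The weak formulation tested against eigenvectors only, a family of scalar equations to
  which Duhamel's formula applies. For bounded Lipschitz \<open>F\<close> and closed convex
  \<open>I\<close> it turns out to be equivalent to testing with all of \<open>D\<close>.\<close>

definition coord_solution :: "('a \<Rightarrow> 'a) \<Rightarrow> real set \<Rightarrow> (real \<Rightarrow> 'a) \<Rightarrow> bool" where
  "coord_solution F I u \<longleftrightarrow> continuous_on I u \<and>
     (\<forall>n. \<forall>t\<in>I. ((\<lambda>s. inner (u s) (e n)) has_real_derivative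
         (inner (F (u t)) (e n) - lam n * inner (u t) (e n))) (at t within I))"

lemma coord_solution_if_is_solution: "is_solution D A F I u \<Longrightarrow> coord_solution F I u"
  unfolding is_solution_def coord_solution_def using e_in_D A_e by (auto dest!: bspec[of D _ "e _"])

lemma coord_solution_subset: "coord_solution F I u \<Longrightarrow> J \<subseteq> I \<Longrightarrow> coord_solution F J u"
  unfolding coord_solution_def by (meson DERIV_subset continuous_on_subset subsetD)

lemma coord_solution_shift:
  assumes "coord_solution F I u" "\<And>t. t \<in> J \<Longrightarrow> a + t \<in> I"
  shows "coord_solution F J (\<lambda>t. u (a + t))"
  unfolding coord_solution_def
proof (intro conjI allI ballI)
  show "continuous_on J (\<lambda>t. u (a + t))"
    using assms unfolding coord_solution_def
    by (intro continuous_on_compose2[of I u J "\<lambda>t. a + t"] continuous_intros) auto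
  fix n t assume t: "t \<in> J"
  have "((\<lambda>s. inner (u s) (e n)) has_real_derivative
         (inner (F (u (a + t))) (e n) - lam n * inner (u (a + t)) (e n))) (at (a + t) within (\<lambda>s. a + s) ` J)"
    using assms t unfolding coord_solution_def by (blast intro: DERIV_subset)
  moreover have "((\<lambda>s. a + s) has_real_derivative 1) (at t within J)"
    by (auto intro!: derivative_eq_intros)
  ultimately have "(((\<lambda>s. inner (u s) (e n)) \<circ> (\<lambda>s. a + s)) has_real_derivative
         (inner (F (u (a + t))) (e n) - lam n * inner (u (a + t)) (e n)) * 1) (at t within J)"
    by (rule DERIV_image_chain)
  then show "((\<lambda>s. inner (u (a + s)) (e n)) has_real_derivative
         (inner (F (u (a + t))) (e n) - lam n * inner (u (a + t)) (e n))) (at t within J)"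
    by (simp add: o_def)
qed

lemma tail_norm_le:
  assumes "\<And>M. L2_set (\<lambda>n. inner u (e n)) {N..<M} \<le> B"
  shows "norm (u - proj N u) \<le> B"
proof (rule norm_le_L2_set)
  fix M
  have "L2_set (\<lambda>n. inner (u - proj N u) (e n)) {..<M} = L2_set (\<lambda>n. inner u (e n)) {N..<M}"
    unfolding L2_set_def
    by (intro arg_cong[where f=sqrt] sum.mono_neutral_cong_right) (auto simp: inner_diff_left inner_proj_e)
  with assms show "L2_set (\<lambda>n. inner (u - proj N u) (e n)) {..<M} \<le> B" by simp
qed

lemma L2_set_tail_le: "L2_set (\<lambda>n. inner u (e n)) {N..<M} \<le> norm (u - proj N u)"
proof -
  have "L2_set (\<lambda>n. inner u (e n)) {N..<M} = L2_set (\<lambda>n. inner (u - proj N u) (e n)) {N..<M}"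
    by (rule L2_set_cong) (auto simp: inner_diff_left inner_proj_e)
  also have "\<dots> \<le> norm (u - proj N u)" by (rule bessel) simp
  finally show ?thesis .
qed

lemma norm_tail_le: "norm (u - proj N u) \<le> norm u"
  by (rule tail_norm_le) (simp add: bessel)

end

section \<open>Well-posedness for bounded Lipschitz nonlinearities\<close>

locale semilinear = spectral_op +
  fixes F :: "'a \<Rightarrow> 'a" and L CF :: real
  assumes F_lip: "norm (F u - F v) \<le> L * norm (u - v)" and F_bdd: "norm (F u) \<le> CF" and L_pos: "0 < L"
begin

lemma CF_nonneg: "0 \<le> CF"
  using F_bdd[of 0] norm_ge_zero[of "F 0"] by linarith

lemma continuous_on_F [continuous_intros]: "continuous_on S u \<Longrightarrow> continuous_on S (\<lambda>t. F (u t))"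
proof -
  have "L-lipschitz_on UNIV F" using F_lip L_pos by (auto simp: lipschitz_on_def dist_norm)
  then have "continuous_on UNIV F" by (rule lipschitz_on_continuous_on)
  then show "continuous_on S u \<Longrightarrow> continuous_on S (\<lambda>t. F (u t))" by (rule continuous_on_compose2) auto
qed

text \<open>Termwise differentiation of the series for \<open>inner (u s) \<phi>\<close>: the
  differentiated partial sums equal \<open>inner (F (u s)) (proj N \<phi>) - inner (u s) (proj N (A
  \<phi>))\<close>. They converge uniformly near \<open>t\<close>, because \<open>F\<close> is
  bounded and \<open>u\<close> is bounded on compact sets.\<close>

lemma coord_solution_imp_is_solution:
  assumes u: "coord_solution F I u" and I: "convex I" "closed I"
  shows "is_solution D A F I u"
  unfolding is_solution_def
proof (intro conjI ballI)
  show cont: "continuous_on I u" using u by (simp add: coord_solution_def)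
  fix \<phi> t assume \<phi>: "\<phi> \<in> D" and t: "t \<in> I"
  \<comment> \<open>\<open>S\<close> is compact, which bounds \<open>u\<close>, and it is a
    neighbourhood of \<open>t\<close> in \<open>I\<close>, which preserves the derivative at
    \<open>t\<close>.\<close>
  define S where "S = I \<inter> {t - 1..t + 1}"
  have S: "convex S" "compact S" "t \<in> S" "S \<subseteq> I"
    using I t by (auto simp: S_def intro!: convex_Int closed_Int_compact)
  have "bounded (u ` S)"
    using S cont by (intro compact_imp_bounded compact_continuous_image) (auto intro: continuous_on_subset)
  then obtain B where B: "\<forall>x\<in>u ` S. norm x \<le> B" unfolding bounded_iff by (rule exE)
  then have "norm (u t) \<le> B" using S(3) by simp
  then have B0: "0 \<le> B" using norm_ge_zero[of "u t"] by linarith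
  define f where "f N s = (\<Sum>n<N. inner (u s) (e n) * inner \<phi> (e n))" for N s
  define f' where "f' N s h = (\<Sum>n<N. (inner (F (u s)) (e n) - lam n * inner (u s) (e n)) * inner \<phi> (e n)) * h" for N s h
  define g' where "g' s h = (inner (F (u s)) \<phi> - inner (u s) (A \<phi>)) * h" for s h
  have f'_eq: "f' N s h = (inner (F (u s)) (proj N \<phi>) - inner (u s) (proj N (A \<phi>))) * h" for N s h
    unfolding f'_def inner_proj_right
    by (simp add: inner_A_e[OF \<phi>] sum_subtractf[symmetric] algebra_simps)
  have "\<exists>g. \<forall>x\<in>S. (\<lambda>n. f n x) \<longlonglongrightarrow> g x \<and> (g has_derivative g' x) (at x within S)"
  proof (rule has_derivative_sequence[OF S(1)])
    fix N s assume s: "s \<in> S"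
    have "((\<lambda>s. inner (u s) (e n) * inner \<phi> (e n)) has_real_derivative
       (inner (F (u s)) (e n) - lam n * inner (u s) (e n)) * inner \<phi> (e n)) (at s within S)" for n
      using coord_solution_subset[OF u S(4)] s by (intro DERIV_cmult_right) (simp add: coord_solution_def)
    then have "(f N has_real_derivative (\<Sum>n<N. (inner (F (u s)) (e n) - lam n * inner (u s) (e n)) * inner \<phi> (e n))) (at s within S)"
      unfolding f_def by (rule DERIV_sum)
    then show "(f N has_derivative f' N s) (at s within S)"
      by (simp add: has_field_derivative_def f'_def[abs_def])
  next
    fix r :: real assume r: "0 < r"
    define r' where "r' = r / (CF + B + 1)"
    have pos: "CF + B + 1 > 0" using CF_nonneg B0 by linarith
    then have r': "r' > 0" using r by (simp add: r'_def)
    have "\<forall>\<^sub>F N in sequentially. dist (proj N \<phi>) \<phi> < r' \<and> dist (proj N (A \<phi>)) (A \<phi>) < r'"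
      using r' by (intro eventually_conj tendstoD[OF proj_tendsto])
    then show "\<forall>\<^sub>F n in sequentially. \<forall>x\<in>S. \<forall>h. norm (f' n x h - g' x h) \<le> r * norm h"
    proof eventually_elim
      case (elim N)
      show ?case
      proof (intro ballI allI)
      fix x h assume x: "x \<in> S"
      note N = elim
      have "f' N x h - g' x h = (inner (F (u x)) (proj N \<phi> - \<phi>) - inner (u x) (proj N (A \<phi>) - A \<phi>)) * h"
        by (simp add: f'_eq g'_def inner_diff_right algebra_simps)
      moreover have "\<bar>inner (F (u x)) (proj N \<phi> - \<phi>) - inner (u x) (proj N (A \<phi>) - A \<phi>)\<bar> \<le> CF * r' + B * r'"
      proof -
        have "\<bar>inner (F (u x)) (proj N \<phi> - \<phi>)\<bar> \<le> norm (F (u x)) * norm (proj N \<phi> - \<phi>)" by (rule Cauchy_Schwarz_ineq2)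
        also have "\<dots> \<le> CF * r'" using F_bdd N CF_nonneg by (intro mult_mono) (auto simp: dist_norm)
        finally have 1: "\<bar>inner (F (u x)) (proj N \<phi> - \<phi>)\<bar> \<le> CF * r'" .
        have "\<bar>inner (u x) (proj N (A \<phi>) - A \<phi>)\<bar> \<le> norm (u x) * norm (proj N (A \<phi>) - A \<phi>)" by (rule Cauchy_Schwarz_ineq2)
        also have "\<dots> \<le> B * r'" using B x N B0 by (intro mult_mono) (auto simp: dist_norm)
        finally show ?thesis using 1 by linarith
      qed
      moreover have "CF * r' + B * r' \<le> r"
      proof -
        have "CF * r' + B * r' \<le> (CF + B + 1) * r'" using r' by (simp add: algebra_simps)
        also have "\<dots> = r" using pos by (simp add: r'_def)
        finally show ?thesis .
      qed
      ultimately show "norm (f' N x h - g' x h) \<le> r * norm h"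
        by (simp add: abs_mult mult_right_mono)
      qed
    qed
  next
    show "t \<in> S" by fact
    show "(\<lambda>n. f n t) \<longlonglongrightarrow> inner (u t) \<phi>"
      using inner_sums[of "u t" \<phi>] by (simp add: f_def sums_def)
  qed
  then obtain g where g: "\<forall>x\<in>S. (\<lambda>n. f n x) \<longlonglongrightarrow> g x \<and> (g has_derivative g' x) (at x within S)"
    by (rule exE)
  have g_eq: "g x = inner (u x) \<phi>" if "x \<in> S" for x
    using LIMSEQ_unique[of "\<lambda>N. f N x" "g x" "inner (u x) \<phi>"] g that inner_sums[of "u x" \<phi>]
    by (simp add: f_def sums_def)
  have "((\<lambda>s. inner (u s) \<phi>) has_derivative g' t) (at t within S)"
  proof (rule has_derivative_transform[OF S(3)])
    show "(g has_derivative g' t) (at t within S)" using bspec[OF g S(3)] by (rule conjunct2)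
  qed (simp add: g_eq)
  then have "((\<lambda>s. inner (u s) \<phi>) has_real_derivative (inner (F (u t)) \<phi> - inner (u t) (A \<phi>))) (at t within S)"
    by (simp add: has_field_derivative_def g'_def[abs_def])
  moreover have "at t within S = at t within I"
    by (rule at_within_nhd[of t "{t - 1<..<t + 1}"]) (auto simp: S_def)
  ultimately show "((\<lambda>s. inner (u s) \<phi>) has_real_derivative (inner (F (u t)) \<phi> - inner (u t) (A \<phi>))) (at t within I)"
    by simp
qed

lemma is_solution_iff:
  "convex I \<Longrightarrow> closed I \<Longrightarrow> is_solution D A F I u \<longleftrightarrow> coord_solution F I u"
  using coord_solution_if_is_solution coord_solution_imp_is_solution by blast

lemma coord_solution_duhamel:
  assumes u: "coord_solution F {0..T} u" and t: "t \<in> {0..T}"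
  shows "inner (u t) (e n) = exp (- lam n * t) * inner (u 0) (e n) +
    integral {0..t} (\<lambda>s. exp (- lam n * (t - s)) * inner (F (u s)) (e n))"
  using u by (intro linear_ode_solution[OF _ t]) (simp add: coord_solution_def)

text \<open>All rates are positive, so the convolution estimate applies with \<mu> = 0.\<close>

lemma duhamel_diff:
  assumes "0 \<le> t" and f: "continuous_on {0..t} f" and h: "continuous_on {0..t} h"
    and v: "\<And>n. inner v (e n) = exp (- lam n * t) * inner u0 (e n) + integral {0..t} (\<lambda>s. exp (- lam n * (t - s)) * inner (f s) (e n))"
    and w: "\<And>n. inner w (e n) = exp (- lam n * t) * inner u1 (e n) + integral {0..t} (\<lambda>s. exp (- lam n * (t - s)) * inner (h s) (e n))"
    and g: "\<And>s. s \<in> {0..t} \<Longrightarrow> norm (f s - h s) \<le> g s" "continuous_on {0..t} g"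
  shows "norm (v - w) \<le> norm (u0 - u1) + integral {0..t} g"
proof -
  have "L2_set (\<lambda>n. inner (v - w) (e n)) {..<N} \<le>
     exp (- 0 * t) * norm (u0 - u1) + integral {0..t} (\<lambda>s. exp (- 0 * (t - s)) * g s)" for N
  proof (rule L2_set_convolution[where c = "\<lambda>n. inner (u0 - u1) (e n)" and l = lam
        and \<phi> = "\<lambda>n s. inner (f s - h s) (e n)"])
    fix n
    have "integral {0..t} (\<lambda>s. exp (- lam n * (t - s)) * inner (f s - h s) (e n)) =
      integral {0..t} (\<lambda>s. exp (- lam n * (t - s)) * inner (f s) (e n)) -
      integral {0..t} (\<lambda>s. exp (- lam n * (t - s)) * inner (h s) (e n))"
      unfolding inner_diff_left right_diff_distrib using f h
      by (intro integral_diff integrable_continuous_real continuous_intros)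
    with v w show "inner (v - w) (e n) = exp (- lam n * t) * inner (u0 - u1) (e n) +
      integral {0..t} (\<lambda>s. exp (- lam n * (t - s)) * inner (f s - h s) (e n))"
      by (simp add: inner_diff_left algebra_simps)
    show "continuous_on {0..t} (\<lambda>s. inner (f s - h s) (e n))"
      using f h by (intro continuous_intros)
    show "0 \<le> lam n" using lam_pos[of n] by simp
  next
    fix s assume "s \<in> {0..t}"
    have "L2_set (\<lambda>n. inner (f s - h s) (e n)) {..<N} \<le> norm (f s - h s)" by (rule bessel) simp
    then show "L2_set (\<lambda>n. inner (f s - h s) (e n)) {..<N} \<le> g s"
      using g(1)[OF \<open>s \<in> {0..t}\<close>] by linarith
  qed (use assms in \<open>auto simp: bessel\<close>)
  then show ?thesis by (intro norm_le_L2_set) simp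
qed

lemma coord_solution_dependence:
  assumes u: "coord_solution F {0..T} u" and v: "coord_solution F {0..T} v" and t: "t \<in> {0..T}"
  shows "norm (u t - v t) \<le> norm (u 0 - v 0) * exp (L * t)"
proof (rule gronwall[of T _ L _ t])
  have cu: "continuous_on {0..T} u" and cv: "continuous_on {0..T} v"
    using u v by (auto simp: coord_solution_def)
  show "continuous_on {0..T} (\<lambda>t. norm (u t - v t))"
    using cu cv by (intro continuous_intros)
  show "0 \<le> L" using L_pos by simp
  fix t assume t: "t \<in> {0..T}"
  have sub: "continuous_on {0..t} u" "continuous_on {0..t} v"
    using cu cv t by (auto intro: continuous_on_subset)
  have "norm (u t - v t) \<le> norm (u 0 - v 0) + integral {0..t} (\<lambda>s. L * norm (u s - v s))"
    using t sub F_lip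
    by (intro duhamel_diff[OF _ _ _ coord_solution_duhamel[OF u t] coord_solution_duhamel[OF v t]] continuous_intros) auto
  then show "norm (u t - v t) \<le> norm (u 0 - v 0) + L * integral {0..t} (\<lambda>s. norm (u s - v s))" by simp
qed (rule t)

lemma coord_solution_unique:
  assumes "coord_solution F {0..T} u" "coord_solution F {0..T} v" "t \<in> {0..T}" "u 0 = v 0"
  shows "u t = v t"
  using coord_solution_dependence[OF assms(1-3)] assms(4) by simp

text \<open>From mode \<open>N\<close> on all rates are at least \<open>lam N\<close>, while the
  forcing has norm at most \<open>CF\<close>. Since \<open>lam N\<close> tends to infinity, this is
  the source of compactness.\<close>

lemma coord_solution_tail:
  assumes u: "coord_solution F {0..T} u" and t: "t \<in> {0..T}"
  shows "norm (u t - proj N (u t)) \<le> exp (- lam N * t) * norm (u 0 - proj N (u 0)) + (1 - exp (- lam N * t)) * (CF / lam N)"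
proof -
  have cu: "continuous_on {0..t} u"
    using u t by (auto simp: coord_solution_def intro: continuous_on_subset)
  have "norm (u t - proj N (u t)) \<le> exp (- lam N * t) * norm (u 0 - proj N (u 0)) + integral {0..t} (\<lambda>s. exp (- lam N * (t - s)) * CF)"
  proof (intro tail_norm_le L2_set_convolution[where c = "\<lambda>n. inner (u 0) (e n)" and l = lam
        and \<phi> = "\<lambda>n s. inner (F (u s)) (e n)"])
    fix M s
    have "L2_set (\<lambda>n. inner (F (u s)) (e n)) {N..<M} \<le> norm (F (u s))" by (rule bessel) simp
    then show "L2_set (\<lambda>n. inner (F (u s)) (e n)) {N..<M} \<le> CF" using F_bdd[of "u s"] by linarith
  next
    fix M n assume "n \<in> {N..<M}"
    then show "lam N \<le> lam n" using lam_mono by (auto dest: incseqD)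
    show "inner (u t) (e n) = exp (- lam n * t) * inner (u 0) (e n) + integral {0..t} (\<lambda>s. exp (- lam n * (t - s)) * inner (F (u s)) (e n))"
      by (rule coord_solution_duhamel[OF u t])
    show "continuous_on {0..t} (\<lambda>s. inner (F (u s)) (e n))" using cu by (intro continuous_intros)
  qed (use t in \<open>auto simp: L2_set_tail_le\<close>)
  also have "integral {0..t} (\<lambda>s. exp (- lam N * (t - s)) * CF) = exp (- lam N * (t - t)) * (CF / lam N) - exp (- lam N * (t - 0)) * (CF / lam N)"
  proof (intro integral_unique fundamental_theorem_of_calculus)
    show "((\<lambda>s. exp (- lam N * (t - s)) * (CF / lam N)) has_vector_derivative exp (- lam N * (t - s)) * CF) (at s within {0..t})" for s
      unfolding has_real_derivative_iff_has_vector_derivative[symmetric]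
      using lam_pos[of N] by (auto intro!: derivative_eq_intros)
  qed (use t in auto)
  also have "\<dots> = (1 - exp (- lam N * t)) * (CF / lam N)" by (simp only: left_diff_distrib) simp
  finally show ?thesis .
qed

text \<open>The formula prescribes the coordinates. Continuity into the whole space follows from
  uniform convergence of the projections on [0, T]: the image of [0, T] under \<open>f\<close> is
  compact, so its tails are uniformly small.\<close>

lemma duhamel_exists:
  assumes f: "continuous_on {0..} f"
  obtains v where "continuous_on {0..} v"
    "\<And>n t. 0 \<le> t \<Longrightarrow> inner (v t) (e n) = exp (- lam n * t) * inner u0 (e n) +
      integral {0..t} (\<lambda>s. exp (- lam n * (t - s)) * inner (f s) (e n))"
proof -
  define a where "a t n = exp (- lam n * t) * inner u0 (e n) + integral {0..t} (\<lambda>s. exp (- lam n * (t - s)) * inner (f s) (e n))" for t n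
  have fc: "continuous_on {0..t} f" for t using f by (rule continuous_on_subset) auto
  have bound: "L2_set (a t) {N..<M} \<le> exp (- 0 * t) * norm (u0 - proj N u0) + integral {0..t} (\<lambda>s. exp (- 0 * (t - s)) * norm (f s - proj N (f s)))"
    if "0 \<le> t" for t N M
  proof (rule L2_set_convolution[where c = "\<lambda>n. inner u0 (e n)" and l = lam and \<phi> = "\<lambda>n s. inner (f s) (e n)"])
    show "0 \<le> lam n" for n using lam_pos[of n] by simp
    show "continuous_on {0..t} (\<lambda>s. inner (f s) (e n))" for n using fc by (intro continuous_intros)
    show "continuous_on {0..t} (\<lambda>s. norm (f s - proj N (f s)))"
      unfolding proj_def using fc by (intro continuous_intros)
  qed (use that in \<open>auto simp: L2_set_tail_le a_def\<close>)
  have "\<exists>v. \<forall>n. inner v (e n) = a t n" if "0 \<le> t" for t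
    using riesz_fischer[of "a t", OF bound[OF that, of 0, folded lessThan_atLeast0]] by metis
  then obtain v where v: "\<And>t n. 0 \<le> t \<Longrightarrow> inner (v t) (e n) = a t n" by metis
  have "continuous_on {0..} v"
  proof -
    have cT: "continuous_on {0..T} v" for T
    proof (rule uniform_limit_theorem)
      have "continuous_on {0..} (\<lambda>t. a t n)" for n
        unfolding a_def
        by (rule DERIV_continuous_on[OF linear_ode_exists]) (use f in \<open>auto intro!: continuous_intros\<close>)
      then have "continuous_on {0..T} (\<lambda>t. inner (v t) (e n))" for n
        by (rule continuous_on_subset[THEN continuous_on_eq]) (auto simp: v)
      then show "\<forall>\<^sub>F N in sequentially. continuous_on {0..T} (\<lambda>t. proj N (v t))"
        unfolding proj_def by (intro always_eventually allI continuous_on_sum continuous_on_scaleR continuous_on_const)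
      show "uniform_limit {0..T} (\<lambda>N t. proj N (v t)) v sequentially"
        unfolding uniform_limit_iff
      proof (intro allI impI)
        fix r :: real assume r: "0 < r"
        define r' where "r' = r / (2 * (\<bar>T\<bar> + 1))"
        have r': "r' > 0" using r by (simp add: r'_def)
        have "compact (insert u0 (f ` {0..T}))"
          using compact_continuous_image[OF fc compact_Icc, of T] by (rule compact_insert)
        then obtain N0 where N0: "\<And>N x. N \<ge> N0 \<Longrightarrow> x \<in> insert u0 (f ` {0..T}) \<Longrightarrow> norm (x - proj N x) < r'"
          using r' by (rule compact_uniform_proj) (rule that)
        have "dist (proj N (v t)) (v t) < r" if N: "N \<ge> N0" and t: "t \<in> {0..T}" for N t
        proof -
          have t0: "0 \<le> t" using t by simp
          have 1: "norm (v t - proj N (v t)) \<le> norm (u0 - proj N u0) + integral {0..t} (\<lambda>s. norm (f s - proj N (f s)))"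
            using bound[OF t0, of N] by (intro tail_norm_le) (simp add: v[OF t0])
          have 2: "integral {0..t} (\<lambda>s. norm (f s - proj N (f s))) \<le> integral {0..t} (\<lambda>s. r')"
          proof (rule integral_le)
            show "(\<lambda>s. norm (f s - proj N (f s))) integrable_on {0..t}"
              unfolding proj_def using fc by (intro integrable_continuous_real continuous_intros)
            show "norm (f s - proj N (f s)) \<le> r'" if "s \<in> {0..t}" for s
              using N0[OF N, of "f s"] that t by fastforce
          qed (rule integrable_const_ivl)
          have 3: "norm (u0 - proj N u0) < r'" using N0[OF N, of u0] by simp
          have 4: "integral {0..t} (\<lambda>s. r') = t * r'" using t0 by simp
          have "norm (v t - proj N (v t)) < r' + t * r'" using 1 2 3 4 by linarith
          also have "\<dots> \<le> r' * (\<bar>T\<bar> + 1)" using t r' by (simp add: algebra_simps)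
          also have "\<dots> = r / 2" by (simp add: r'_def field_simps)
          also have "\<dots> < r" using r by simp
          finally show ?thesis by (simp add: dist_norm norm_minus_commute)
        qed
        then show "\<forall>\<^sub>F N in sequentially. \<forall>t\<in>{0..T}. dist (proj N (v t)) (v t) < r"
          by (auto intro: eventually_sequentiallyI[of N0])
      qed
    qed auto
    show ?thesis
      unfolding continuous_on_eq_continuous_within
    proof
      fix t :: real assume t: "t \<in> {0..}"
      have "continuous (at t within {0..t+1}) v"
        using cT[of "t+1"] t by (simp add: continuous_on_eq_continuous_within)
      moreover have "at t within {0..t+1} = at t within {0..}"
        by (rule at_within_nhd[of t "{..<t+1}"]) (use t in auto)
      ultimately show "continuous (at t within {0..}) v" by simp
    qed
  qed
  with v show ?thesis by (intro that) (auto simp: a_def)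
qed

text \<open>Banach's fixed point theorem for the weighted unknown exp(-\<alpha> t) u(t). With
  \<alpha> = 2 L the contraction factor is 1/2 on the whole half-line at once, and boundedness of
  \<open>F\<close> keeps the weighted iterates bounded.\<close>

lemma coord_solution_exists:
  obtains u where "coord_solution F {0..} u" "u 0 = u0"
proof -
  define \<alpha> where "\<alpha> = 2 * L"
  have \<alpha>: "\<alpha> > 0" using L_pos by (simp add: \<alpha>_def)
  define f where "f g s = F (exp (\<alpha> * s) *\<^sub>R apply_bcontfun g s)" for g s
  have f_cont: "continuous_on S (f g)" for g S
    unfolding f_def by (intro continuous_intros) auto
  have "\<exists>v. continuous_on {0..} v \<and> (\<forall>n t. 0 \<le> t \<longrightarrow> inner (v t) (e n) = exp (- lam n * t) * inner u0 (e n) +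
      integral {0..t} (\<lambda>s. exp (- lam n * (t - s)) * inner (f g s) (e n)))" for g
    by (rule duhamel_exists[OF f_cont[of _ g]]) blast
  then have "\<forall>g. \<exists>v. continuous_on {0..} v \<and> (\<forall>n t. 0 \<le> t \<longrightarrow> inner (v t) (e n) = exp (- lam n * t) * inner u0 (e n) +
      integral {0..t} (\<lambda>s. exp (- lam n * (t - s)) * inner (f g s) (e n)))" by (rule allI)
  from choice[OF this] obtain V where "\<forall>g. continuous_on {0..} (V g) \<and> (\<forall>n t. 0 \<le> t \<longrightarrow> inner (V g t) (e n) = exp (- lam n * t) * inner u0 (e n) +
      integral {0..t} (\<lambda>s. exp (- lam n * (t - s)) * inner (f g s) (e n)))" by (rule exE)
  then have V_cont: "\<And>g. continuous_on {0..} (V g)" and V: "\<And>g n t. 0 \<le> t \<Longrightarrow>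
      inner (V g t) (e n) = exp (- lam n * t) * inner u0 (e n) + integral {0..t} (\<lambda>s. exp (- lam n * (t - s)) * inner (f g s) (e n))"
    by simp_all
  \<comment> \<open>\<open>max 0 t\<close> extends the iterates to negative times by constants,
    since the fixed point is sought among bounded continuous functions on the whole line.\<close>
  define N where "N g t = exp (- \<alpha> * max 0 t) *\<^sub>R V g (max 0 t)" for g t
  have N_bcont: "N g \<in> bcontfun" for g
  proof (rule bcontfun_normI)
    show "continuous_on UNIV (N g)"
      unfolding N_def by (intro continuous_intros continuous_on_compose2[OF V_cont[of g]]) auto
    fix t :: real
    define r where "r = max 0 t"
    have r: "0 \<le> r" by (simp add: r_def)
    have "norm (V g r - 0) \<le> norm (u0 - 0) + integral {0..r} (\<lambda>_. CF)"
      using F_bdd by (intro duhamel_diff[OF r f_cont _ V[OF r], where h = "\<lambda>_. 0"]) (auto simp: f_def)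
    then have "norm (V g r) \<le> norm u0 + CF * r" using r by (simp add: mult.commute)
    then have "exp (- \<alpha> * r) * norm (V g r) \<le> exp (- \<alpha> * r) * norm u0 + CF * (exp (- \<alpha> * r) * r)"
      by (metis distrib_left exp_ge_zero mult.left_commute mult_left_mono)
    moreover have "exp (- \<alpha> * r) * norm u0 \<le> 1 * norm u0"
      using \<alpha> r by (intro mult_right_mono) auto
    moreover have "exp (- \<alpha> * r) * r \<le> 1 / \<alpha>"
    proof -
      have "\<alpha> * r \<le> exp (\<alpha> * r)" using exp_ge_add_one_self[of "\<alpha> * r"] by linarith
      then show ?thesis using \<alpha> by (simp add: exp_minus field_simps)
    qed
    ultimately show "norm (N g t) \<le> norm u0 + CF * (1 / \<alpha>)"
      using mult_left_mono[OF _ CF_nonneg, of "exp (- \<alpha> * r) * r" "1 / \<alpha>"]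
      unfolding N_def r_def[symmetric] by simp
  qed
  have contr: "dist (Bcontfun (N g)) (Bcontfun (N h)) \<le> 1 / 2 * dist g h" for g h
  proof (rule dist_bound)
    fix t :: real
    define r where "r = max 0 t"
    have r: "0 \<le> r" by (simp add: r_def)
    let ?d = "dist g h"
    have "norm (V g r - V h r) \<le> norm (u0 - u0) + integral {0..r} (\<lambda>s. L * (exp (\<alpha> * s) * ?d))"
    proof (rule duhamel_diff[OF r f_cont f_cont V[OF r] V[OF r]])
      show "continuous_on {0..r} (\<lambda>s. L * (exp (\<alpha> * s) * ?d))" by (intro continuous_intros)
      fix s
      have "norm (f g s - f h s) \<le> L * norm (exp (\<alpha> * s) *\<^sub>R apply_bcontfun g s - exp (\<alpha> * s) *\<^sub>R apply_bcontfun h s)"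
        unfolding f_def by (rule F_lip)
      also have "\<dots> = L * (exp (\<alpha> * s) * dist (apply_bcontfun g s) (apply_bcontfun h s))"
        by (simp add: scaleR_diff_right[symmetric] dist_norm)
      also have "\<dots> \<le> L * (exp (\<alpha> * s) * ?d)"
        using L_pos by (intro mult_left_mono dist_bounded) auto
      finally show "norm (f g s - f h s) \<le> L * (exp (\<alpha> * s) * ?d)" .
    qed
    also have "integral {0..r} (\<lambda>s. L * (exp (\<alpha> * s) * ?d)) = exp (\<alpha> * r) * ?d / 2 - exp (\<alpha> * 0) * ?d / 2"
    proof (intro integral_unique fundamental_theorem_of_calculus r)
      show "((\<lambda>s. exp (\<alpha> * s) * ?d / 2) has_vector_derivative L * (exp (\<alpha> * s) * ?d)) (at s within {0..r})" for s
        unfolding has_real_derivative_iff_has_vector_derivative[symmetric]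
        by (auto intro!: derivative_eq_intros simp: \<alpha>_def)
    qed
    finally have "norm (V g r - V h r) \<le> exp (\<alpha> * r) * ?d / 2 - ?d / 2" by simp
    moreover have "0 \<le> ?d / 2" by simp
    ultimately have "norm (V g r - V h r) \<le> exp (\<alpha> * r) * (?d / 2)" by linarith
    then have "exp (- \<alpha> * r) * norm (V g r - V h r) \<le> ?d / 2"
      by (simp add: exp_minus field_simps)
    then show "dist (apply_bcontfun (Bcontfun (N g)) t) (apply_bcontfun (Bcontfun (N h)) t) \<le> 1 / 2 * ?d"
      using N_bcont by (simp add: Bcontfun_inverse N_def r_def[symmetric] dist_norm scaleR_diff_right[symmetric])
  qed
  have "\<exists>!g. Bcontfun (N g) = g"
    using contr by (intro banach_fix_type[of "1/2"]) auto
  then obtain g where g: "Bcontfun (N g) = g" by blast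
  have "apply_bcontfun g t = exp (- \<alpha> * t) *\<^sub>R V g t" if "0 \<le> t" for t
    using Bcontfun_inverse[OF N_bcont[of g]] that by (simp add: g N_def max_absorb2)
  then have fg: "f g t = F (V g t)" if "0 \<le> t" for t
    using that by (simp add: f_def exp_minus)
  have "coord_solution F {0..} (V g)"
    unfolding coord_solution_def
  proof (intro conjI V_cont allI ballI)
    fix n and t :: real assume t: "t \<in> {0..}"
    have "((\<lambda>t. exp (- lam n * t) * inner u0 (e n) + integral {0..t} (\<lambda>s. exp (- lam n * (t - s)) * inner (f g s) (e n))) has_real_derivative
     inner (f g t) (e n) - lam n * (exp (- lam n * t) * inner u0 (e n) + integral {0..t} (\<lambda>s. exp (- lam n * (t - s)) * inner (f g s) (e n)))) (at t within {0..})"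
      using t by (intro linear_ode_exists continuous_intros f_cont) auto
    then have "((\<lambda>t. inner (V g t) (e n)) has_real_derivative
     inner (f g t) (e n) - lam n * (exp (- lam n * t) * inner u0 (e n) + integral {0..t} (\<lambda>s. exp (- lam n * (t - s)) * inner (f g s) (e n)))) (at t within {0..})"
      by (rule has_field_derivative_transform_within[OF _ zero_less_one t]) (simp add: V)
    then show "((\<lambda>s. inner (V g s) (e n)) has_real_derivative inner (F (V g t)) (e n) - lam n * inner (V g t) (e n)) (at t within {0..})"
      using t by (simp add: V fg)
  qed
  moreover have "V g 0 = u0"
    by (rule coord_eqI) (simp add: V)
  ultimately show ?thesis by (rule that)
qed

lemma coord_solution_unique_half_line:
  assumes "coord_solution F {0..} u" "coord_solution F {0..} v" "u 0 = v 0" "0 \<le> t"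
  shows "u t = v t"
  by (rule coord_solution_unique[of t]) (use assms in \<open>auto elim: coord_solution_subset\<close>)

lemma wellposed: "wellposed D A F"
  unfolding wellposed_def
proof
  fix u0
  obtain u where u: "coord_solution F {0..} u" "u 0 = u0" by (rule coord_solution_exists)
  show "\<exists>u. is_solution D A F {0..} u \<and> u 0 = u0 \<and> (\<forall>v. is_solution D A F {0..} v \<and> v 0 = u0 \<longrightarrow> (\<forall>t\<ge>0. v t = u t))"
  proof (intro exI[of _ u] conjI allI impI)
    show "is_solution D A F {0..} u" using u by (simp add: is_solution_iff)
    show "u 0 = u0" by fact
    fix v and t :: real assume "is_solution D A F {0..} v \<and> v 0 = u0" "0 \<le> t"
    then show "v t = u t"
      using u by (rule_tac coord_solution_unique_half_line) (auto simp: is_solution_iff)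
  qed
qed

section \<open>The solution semigroup and its compact absorbing set\<close>

lemma semigroup_eq:
  assumes "coord_solution F {0..} u" "0 \<le> t"
  shows "semigroup D A F t (u 0) = u t"
  unfolding semigroup_def
proof (rule the_equality)
  show "\<exists>v. is_solution D A F {0..} v \<and> v 0 = u 0 \<and> v t = u t"
    using assms by (intro exI[of _ u]) (auto simp: is_solution_iff)
  fix x assume "\<exists>v. is_solution D A F {0..} v \<and> v 0 = u 0 \<and> v t = x"
  then obtain v where "coord_solution F {0..} v" "v 0 = u 0" "v t = x"
    by (auto simp: is_solution_iff)
  with assms show "x = u t" using coord_solution_unique_half_line[of v u t] by simp
qed

lemma semigroup_add:
  assumes "0 \<le> s" "0 \<le> t"
  shows "semigroup D A F (s + t) x = semigroup D A F s (semigroup D A F t x)"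
proof -
  obtain u where u: "coord_solution F {0..} u" "u 0 = x" by (rule coord_solution_exists)
  have "coord_solution F {0..} (\<lambda>r. u (t + r))"
    using u(1) assms by (rule_tac coord_solution_shift) auto
  from semigroup_eq[OF this assms(1)] semigroup_eq[OF u(1) assms(2)] semigroup_eq[OF u(1), of "s + t"]
  show ?thesis using assms u(2) by (simp add: add.commute)
qed

lemma semigroup_0: "semigroup D A F 0 x = x"
proof -
  obtain u where u: "coord_solution F {0..} u" "u 0 = x" by (rule coord_solution_exists)
  show ?thesis using semigroup_eq[OF u(1), of 0] u(2) by simp
qed

lemma semigroup_lipschitz:
  assumes "0 \<le> t"
  shows "norm (semigroup D A F t x - semigroup D A F t y) \<le> norm (x - y) * exp (L * t)"
proof -
  obtain u where u: "coord_solution F {0..} u" "u 0 = x" by (rule coord_solution_exists)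
  obtain v where v: "coord_solution F {0..} v" "v 0 = y" by (rule coord_solution_exists[of y])
  have "norm (u t - v t) \<le> norm (u 0 - v 0) * exp (L * t)"
    by (rule coord_solution_dependence[of t]) (use u v assms in \<open>auto elim: coord_solution_subset\<close>)
  then show ?thesis using semigroup_eq[OF u(1) assms] semigroup_eq[OF v(1) assms] u(2) v(2) by simp
qed

lemma semigroup_tail:
  assumes "0 \<le> t"
  shows "norm (semigroup D A F t x - proj N (semigroup D A F t x)) \<le>
     exp (- lam N * t) * norm (x - proj N x) + (1 - exp (- lam N * t)) * (CF / lam N)"
proof -
  obtain u where u: "coord_solution F {0..} u" "u 0 = x" by (rule coord_solution_exists)
  have "norm (u t - proj N (u t)) \<le> exp (- lam N * t) * norm (u 0 - proj N (u 0)) + (1 - exp (- lam N * t)) * (CF / lam N)"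
    by (rule coord_solution_tail[of t]) (use u assms in \<open>auto elim: coord_solution_subset\<close>)
  then show ?thesis using semigroup_eq[OF u(1) assms] u(2) by simp
qed

text \<open>All tails are controlled at once, which gives compactness as \<open>lam N\<close> tends
  to infinity. Tails converge to the level \<open>CF / lam N\<close>; the extra 1 allows absorption
  in finite time.\<close>

definition absorbing_set :: "'a set" where
  "absorbing_set = {u. \<forall>N. norm (u - proj N u) \<le> (CF + 1) / lam N}"

lemma proj_0 [simp]: "proj 0 u = 0"
  by (simp add: proj_def)

lemma compact_coord_box: "compact {u. \<exists>a. (\<forall>n<N. \<bar>a n\<bar> \<le> R) \<and> u = (\<Sum>n<N. a n *\<^sub>R e n)}"
proof (induction N)
  case 0
  then show ?case by simp
next
  case (Suc N)
  let ?B = "\<lambda>N. {u. \<exists>a. (\<forall>n<N. \<bar>a n\<bar> \<le> R) \<and> u = (\<Sum>n<N. a n *\<^sub>R e n)}"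
  have "?B (Suc N) = (\<lambda>(x, c). x + c *\<^sub>R e N) ` (?B N \<times> {- R..R})"
  proof (intro set_eqI iffI)
    fix u assume "u \<in> ?B (Suc N)"
    then obtain a where "\<forall>n<Suc N. \<bar>a n\<bar> \<le> R" "u = (\<Sum>n<Suc N. a n *\<^sub>R e n)" by blast
    then show "u \<in> (\<lambda>(x, c). x + c *\<^sub>R e N) ` (?B N \<times> {- R..R})"
      by (intro image_eqI[of _ _ "(\<Sum>n<N. a n *\<^sub>R e n, a N)"]) (auto simp: abs_le_iff less_Suc_eq)
  next
    fix u assume "u \<in> (\<lambda>(x, c). x + c *\<^sub>R e N) ` (?B N \<times> {- R..R})"
    then obtain p where "p \<in> ?B N \<times> {- R..R}" "u = (\<lambda>(x, c). x + c *\<^sub>R e N) p"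
      by (rule imageE)
    moreover obtain x c where p: "p = (x, c)" by (cases p)
    ultimately have xc: "x \<in> ?B N" "c \<in> {- R..R}" "u = x + c *\<^sub>R e N"
      by (simp_all only: mem_Times_iff fst_conv snd_conv prod.case)
    from xc(1) obtain a where "\<forall>n<N. \<bar>a n\<bar> \<le> R" "x = (\<Sum>n<N. a n *\<^sub>R e n)"
      by blast
    with xc have "\<forall>n<N. \<bar>a n\<bar> \<le> R" "\<bar>c\<bar> \<le> R" "u = (\<Sum>n<N. a n *\<^sub>R e n) + c *\<^sub>R e N"
      by (auto simp: abs_le_iff)
    then show "u \<in> ?B (Suc N)"
      by (auto intro!: exI[of _ "a(N := c)"] sum.cong simp: less_Suc_eq)
  qed
  moreover
  have "continuous_on (?B N \<times> {- R..R}) (\<lambda>(x, c). x + c *\<^sub>R e N)"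
    unfolding case_prod_beta by (intro continuous_intros)
  from compact_continuous_image[OF this compact_Times[OF Suc compact_Icc]] calculation show ?case
    by simp
qed

text \<open>Total boundedness: for suitable \<open>N\<close> the tails are smaller than r/2, and the
  projections lie in a finite-dimensional box.\<close>

lemma compact_absorbing_set: "compact absorbing_set"
  unfolding compact_eq_totally_bounded
proof (intro conjI allI impI)
  have "closed absorbing_set"
    unfolding absorbing_set_def proj_def Collect_all_eq
    by (intro closed_INT ballI closed_Collect_le continuous_intros)
  then show "complete absorbing_set" by (simp add: complete_eq_closed)
  fix r :: real assume r: "0 < r"
  have "\<forall>\<^sub>F N in sequentially. 2 * (CF + 1) / r < lam N"
    using lam_lim by (auto simp: filterlim_at_top_dense)
  then obtain N where "2 * (CF + 1) / r < lam N" unfolding eventually_sequentially by blast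
  then have N: "(CF + 1) / lam N < r / 2"
    using r lam_pos[of N] by (simp add: field_simps)
  let ?R = "(CF + 1) / lam 0"
  let ?B = "{u. \<exists>a. (\<forall>n<N. \<bar>a n\<bar> \<le> ?R) \<and> u = (\<Sum>n<N. a n *\<^sub>R e n)}"
  have "r / 2 > 0" using r by simp
  then have "\<exists>k. finite k \<and> ?B \<subseteq> (\<Union>x\<in>k. ball x (r / 2))"
    using compact_coord_box[of N ?R, unfolded compact_eq_totally_bounded] by blast
  then obtain k where k: "finite k" "?B \<subseteq> (\<Union>x\<in>k. ball x (r / 2))" by (elim exE conjE) (rule that)
  have "absorbing_set \<subseteq> (\<Union>x\<in>k. ball x r)"
  proof
    fix u assume u: "u \<in> absorbing_set"
    then have "norm (u - proj 0 u) \<le> ?R" unfolding absorbing_set_def by blast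
    then have "\<bar>inner u (e n)\<bar> \<le> ?R" for n
      using Cauchy_Schwarz_ineq2[of u "e n"] by simp
    then have "proj N u \<in> ?B"
      unfolding proj_def by (intro CollectI exI[of _ "\<lambda>n. inner u (e n)"]) simp
    with k(2) have "proj N u \<in> (\<Union>x\<in>k. ball x (r / 2))" by (rule subsetD)
    then obtain x where x: "x \<in> k" "dist x (proj N u) < r / 2" by auto
    have "norm (u - proj N u) \<le> (CF + 1) / lam N" using u unfolding absorbing_set_def by blast
    then have "norm (u - proj N u) < r / 2" using N by linarith
    then have "dist (proj N u) u < r / 2" by (simp add: dist_norm norm_minus_commute)
    then have "dist x u < r" using x(2) dist_triangle[of x u "proj N u"] by linarith
    then show "u \<in> (\<Union>x\<in>k. ball x r)" using x(1) by auto
  qed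
  with k(1) show "\<exists>k. finite k \<and> absorbing_set \<subseteq> (\<Union>x\<in>k. ball x r)" by blast
qed

lemma absorbing_set_nonempty: "0 \<in> absorbing_set"
  using CF_nonneg lam_pos less_imp_le[OF lam_pos] by (auto simp: absorbing_set_def proj_def)

lemma absorbing_set_invariant:
  assumes "0 \<le> t" "x \<in> absorbing_set"
  shows "semigroup D A F t x \<in> absorbing_set"
  unfolding absorbing_set_def
proof (intro CollectI allI)
  fix N
  let ?E = "exp (- lam N * t)"
  have E: "0 \<le> ?E" "?E \<le> 1" using assms(1) lam_pos[of N] by auto
  have "?E * norm (x - proj N x) \<le> ?E * ((CF + 1) / lam N)"
    using assms(2) by (intro mult_left_mono) (auto simp: absorbing_set_def)
  moreover have "(1 - ?E) * (CF / lam N) \<le> (1 - ?E) * ((CF + 1) / lam N)"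
    using E lam_pos[of N] by (intro mult_left_mono divide_right_mono) auto
  moreover have "?E * ((CF + 1) / lam N) + (1 - ?E) * ((CF + 1) / lam N) = (CF + 1) / lam N"
    by (simp only: distrib_right[symmetric]) simp
  ultimately have "?E * norm (x - proj N x) + (1 - ?E) * (CF / lam N) \<le> (CF + 1) / lam N"
    by linarith
  with semigroup_tail[OF assms(1), of x N]
  show "norm (semigroup D A F t x - proj N (semigroup D A F t x)) \<le> (CF + 1) / lam N" by linarith
qed

text \<open>One time has to serve every \<open>N\<close>. Since exp x is at least x^2 / 2, applied
  to x = lam N t, it suffices that lam N t^2 is at least 2 \<rho>, and N = 0 is the worst
  case.\<close>

lemma tail_absorbed:
  assumes "2 * \<rho> / lam 0 + 1 \<le> t" "0 \<le> \<rho>"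
  shows "exp (- lam N * t) * \<rho> + CF / lam N \<le> (CF + 1) / lam N"
proof -
  have l0: "0 < lam 0" by (rule lam_pos)
  have "0 \<le> 2 * \<rho> / lam 0" using assms(2) l0 by simp
  then have t: "1 \<le> t" "2 * \<rho> / lam 0 \<le> t" using assms(1) by linarith+
  have "2 * \<rho> / lam 0 \<le> t * t" using t mult_left_mono[of 1 t t] by linarith
  then have "2 * \<rho> \<le> lam 0 * t\<^sup>2" using l0 by (simp add: field_simps power2_eq_square)
  also have "\<dots> \<le> lam N * t\<^sup>2" using lam_mono by (intro mult_right_mono) (auto dest: incseqD)
  finally have "lam N * (2 * \<rho>) \<le> lam N * (lam N * t\<^sup>2)" using lam_pos[of N] by simp
  then have "lam N * \<rho> \<le> (lam N * t)\<^sup>2 / 2" by (simp add: power2_eq_square mult_ac)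
  also have "\<dots> \<le> exp (lam N * t)"
    using exp_lower_Taylor_quadratic[of "lam N * t"] lam_pos[of N] t by (smt (verit) mult_nonneg_nonneg)
  finally have "exp (- lam N * t) * \<rho> \<le> 1 / lam N"
    using lam_pos[of N] by (simp add: exp_minus field_simps)
  then show ?thesis by (simp add: add_divide_distrib)
qed

lemma absorbing_set_absorbs:
  assumes "norm x \<le> \<rho>" "2 * \<rho> / lam 0 + 1 \<le> t"
  shows "semigroup D A F t x \<in> absorbing_set"
  unfolding absorbing_set_def
proof (intro CollectI allI)
  fix N
  have \<rho>: "0 \<le> \<rho>" using assms(1) norm_ge_zero[of x] by linarith
  then have "0 \<le> 2 * \<rho> / lam 0" using lam_pos[of 0] by simp
  then have t: "0 \<le> t" using assms(2) by linarith
  have "exp (- lam N * t) * norm (x - proj N x) \<le> exp (- lam N * t) * \<rho>"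
    using assms(1) norm_tail_le[of x N] by (intro mult_left_mono) auto
  moreover have "(1 - exp (- lam N * t)) * (CF / lam N) \<le> 1 * (CF / lam N)"
    using CF_nonneg lam_pos[of N] by (intro mult_right_mono) auto
  ultimately show "norm (semigroup D A F t x - proj N (semigroup D A F t x)) \<le> (CF + 1) / lam N"
    using semigroup_tail[OF t, of x N] tail_absorbed[OF assms(2) \<rho>, of N] by linarith
qed

end

section \<open>Existence of a global attractor\<close>

lemma compact_nest_nonempty:
  fixes F :: "nat \<Rightarrow> 'a::t2_space set"
  assumes F: "\<And>n. compact (F n)" "\<And>n. F n \<noteq> {}" and mono: "\<And>m n. m \<le> n \<Longrightarrow> F n \<subseteq> F m"
  shows "\<Inter>(range F) \<noteq> {}"
proof -
  have "F 0 \<inter> (\<Inter>n\<in>UNIV. F n) \<noteq> {}"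
  proof (rule compact_imp_fip_image[OF F(1)])
    show "closed (F n)" for n using F(1) by (rule compact_imp_closed)
    fix I :: "nat set" assume "finite I"
    then have "F (Max (insert 0 I)) \<subseteq> F 0 \<inter> (\<Inter>n\<in>I. F n)"
      by (intro Int_greatest INT_greatest mono) auto
    then show "F 0 \<inter> (\<Inter>n\<in>I. F n) \<noteq> {}" using F(2)[of "Max (insert 0 I)"] by blast
  qed
  then show ?thesis by blast
qed

text \<open>Positive invariance of \<open>K\<close> makes its images decrease in time; they are
  compact, so the intersection is nonempty and, by compactness again, both strictly invariant and
  attracting.\<close>

lemma global_attractor_exists:
  fixes S :: "real \<Rightarrow> 'a::real_normed_vector \<Rightarrow> 'a"
  assumes S0: "\<And>x. S 0 x = x"
    and S_add: "\<And>s t x. 0 \<le> s \<Longrightarrow> 0 \<le> t \<Longrightarrow> S (s + t) x = S s (S t x)"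
    and S_cont: "\<And>t. 0 \<le> t \<Longrightarrow> continuous_on UNIV (S t)"
    and K: "compact K" "K \<noteq> {}" "\<And>t x. 0 \<le> t \<Longrightarrow> x \<in> K \<Longrightarrow> S t x \<in> K"
    and absorb: "\<And>B. bounded B \<Longrightarrow> \<exists>T\<ge>0. \<forall>t\<ge>T. \<forall>b\<in>B. S t b \<in> K"
  shows "global_attractor S (\<Inter>t\<in>{0..}. S t ` K)"
proof -
  let ?A = "\<Inter>t\<in>{0..}. S t ` K"
  have mono: "S t ` K \<subseteq> S s ` K" if "0 \<le> s" "s \<le> t" for s t
  proof
    fix y assume "y \<in> S t ` K"
    then obtain x where "x \<in> K" "y = S t x" by blast
    then have "y = S s (S (t - s) x)" "S (t - s) x \<in> K" using S_add[of s "t - s" x] K(3) that by auto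
    then show "y \<in> S s ` K" by blast
  qed
  have A_nat: "?A = (\<Inter>n. S (real n) ` K)"
  proof
    show "(\<Inter>n. S (real n) ` K) \<subseteq> ?A"
    proof (intro subsetI INT_I)
      fix x and t :: real assume x: "x \<in> (\<Inter>n. S (real n) ` K)" and t: "t \<in> {0..}"
      obtain n where "t \<le> real n" using real_arch_simple by blast
      then show "x \<in> S t ` K" using mono[of t "real n"] x t by auto
    qed
  qed auto
  have comp: "compact (S t ` K)" if "0 \<le> t" for t
    using S_cont[OF that] K(1) by (meson compact_continuous_image continuous_on_subset subset_UNIV)
  have A_compact: "compact ?A"
  proof -
    have "closed ?A" by (intro closed_INT ballI compact_imp_closed comp) auto
    moreover have "?A \<subseteq> S 0 ` K" by auto
    ultimately show ?thesis using compact_Int_closed[OF comp[of 0], of ?A] by (simp add: Int_absorb1)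
  qed
  have A_ne: "?A \<noteq> {}"
    unfolding A_nat by (rule compact_nest_nonempty) (use comp K(2) mono in auto)
  have inv: "S t ` ?A = ?A" if t: "0 \<le> t" for t
  proof
    show "S t ` ?A \<subseteq> ?A"
    proof (intro subsetI INT_I)
      fix y and s :: real assume "y \<in> S t ` ?A" and s: "s \<in> {0..}"
      then obtain x where x: "x \<in> ?A" "y = S t x" by blast
      then obtain k where k: "k \<in> K" "x = S s k" using s by blast
      have "y = S s (S t k)" using x(2) k(2) S_add[of s t k] S_add[of t s k] s t by (simp add: add.commute)
      then show "y \<in> S s ` K" using K(3)[OF t k(1)] by blast
    qed
    show "?A \<subseteq> S t ` ?A"
    proof
      fix y assume y: "y \<in> ?A"
      \<comment> \<open>The preimages of \<open>y\<close> within the images of \<open>K\<close> are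
        nested nonempty compact sets; a common point lies in the attractor and is mapped to
        \<open>y\<close>.\<close>
      let ?G = "\<lambda>n::nat. S (real n) ` K \<inter> S t -` {y}"
      have "\<Inter>(range ?G) \<noteq> {}"
      proof (rule compact_nest_nonempty)
        fix n :: nat
        have "closed (S t -` {y})"
          by (rule continuous_closed_vimage[OF closed_singleton]) (use S_cont[OF t] in \<open>simp add: continuous_on_eq_continuous_at\<close>)
        then show "compact (?G n)" by (intro compact_Int_closed comp) auto
        have "y \<in> S (t + real n) ` K" using y t by (auto dest: INT_D)
        then obtain k where "k \<in> K" "y = S t (S (real n) k)" using S_add[of t "real n"] t by auto
        then show "?G n \<noteq> {}" by auto
      next
        show "?G n \<subseteq> ?G m" if "m \<le> n" for m n using mono[of "real m" "real n"] that by auto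
      qed
      then obtain x where "\<And>n. x \<in> ?G n" by blast
      then have "x \<in> ?A" "S t x = y" unfolding A_nat by auto
      then show "y \<in> S t ` ?A" by blast
    qed
  qed
  have attr: "\<exists>T. \<forall>t\<ge>T. \<forall>b\<in>B. infdist (S t b) ?A < r" if B: "bounded B" and r: "0 < r" for B r
  proof -
    have "\<exists>n. \<forall>x\<in>S (real n) ` K. infdist x ?A < r"
    proof (rule ccontr)
      assume neg: "\<nexists>n. \<forall>x\<in>S (real n) ` K. infdist x ?A < r"
      \<comment> \<open>If every image kept a point at distance at least \<open>r\<close>, these
        points would form nested compact sets, and a common one would lie in the intersection
        itself.\<close>
      let ?G = "\<lambda>n::nat. S (real n) ` K \<inter> {x. r \<le> infdist x ?A}"
      have "\<Inter>(range ?G) \<noteq> {}"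
      proof (rule compact_nest_nonempty)
        fix n :: nat
        have "closed {x. r \<le> infdist x ?A}"
          by (intro closed_Collect_le continuous_intros)
        then show "compact (?G n)" by (intro compact_Int_closed comp) auto
        show "?G n \<noteq> {}" using neg by (force simp: not_less)
      next
        show "?G n \<subseteq> ?G m" if "m \<le> n" for m n using mono[of "real m" "real n"] that by auto
      qed
      then obtain x where x: "\<And>n. x \<in> ?G n" by blast
      then have "x \<in> ?A" unfolding A_nat by auto
      then show False using x[of 0] r by simp
    qed
    then obtain n where n: "\<And>x. x \<in> S (real n) ` K \<Longrightarrow> infdist x ?A < r" by blast
    obtain T where T: "T \<ge> 0" "\<And>t b. T \<le> t \<Longrightarrow> b \<in> B \<Longrightarrow> S t b \<in> K" using absorb[OF B] by blast
    have "infdist (S t b) ?A < r" if "T + real n \<le> t" "b \<in> B" for t b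
    proof (rule n)
      have "S t b = S (real n) (S (t - real n) b)" using S_add[of "real n" "t - real n" b] that T(1) by simp
      moreover have "S (t - real n) b \<in> K" using T(2) that by simp
      ultimately show "S t b \<in> S (real n) ` K" by blast
    qed
    then show ?thesis by blast
  qed
  show ?thesis
    unfolding global_attractor_def using A_ne A_compact inv attr by simp
qed

context semilinear
begin

definition attractor :: "'a set" where
  "attractor = (\<Inter>t\<in>{0..}. semigroup D A F t ` absorbing_set)"

lemma global_attractor_attractor: "global_attractor (semigroup D A F) attractor"
  unfolding attractor_def
proof (rule global_attractor_exists)
  show "continuous_on UNIV (semigroup D A F t)" if t: "0 \<le> t" for t
  proof (rule lipschitz_on_continuous_on)
    show "(exp (L * t))-lipschitz_on UNIV (semigroup D A F t)"
      using semigroup_lipschitz[OF t] by (auto simp: lipschitz_on_def dist_norm mult.commute)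
  qed
  fix B :: "'a set" assume "bounded B"
  then obtain \<rho> where \<rho>: "\<forall>x\<in>B. norm x \<le> \<rho>" unfolding bounded_iff by (rule exE)
  then have "semigroup D A F t b \<in> absorbing_set" if "2 * \<bar>\<rho>\<bar> / lam 0 + 1 \<le> t" "b \<in> B" for t b
    by (intro absorbing_set_absorbs[OF _ that(1)]) (use \<rho> that(2) in force)
  moreover have "0 \<le> 2 * \<bar>\<rho>\<bar> / lam 0 + 1" using lam_pos[of 0] by simp
  ultimately show "\<exists>T\<ge>0. \<forall>t\<ge>T. \<forall>b\<in>B. semigroup D A F t b \<in> absorbing_set" by blast
qed (use absorbing_set_nonempty in \<open>auto simp: semigroup_0 semigroup_add compact_absorbing_set absorbing_set_invariant\<close>)

text \<open>Every value is the image of an arbitrarily old value of the same bounded solution. Hence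
  all values lie in the absorbing set, and then in all its images.\<close>

lemma bounded_solution_in_attractor:
  assumes u: "coord_solution F UNIV u" and bd: "\<And>t. norm (u t) \<le> \<rho>"
  shows "u t \<in> attractor"
proof -
  have fwd: "semigroup D A F s (u r) = u (r + s)" if "0 \<le> s" for r s
    using semigroup_eq[of "\<lambda>s. u (r + s)" s] coord_solution_shift[OF u, of "{0..}" r] that by simp
  have K: "u r \<in> absorbing_set" for r
  proof -
    define s where "s = 2 * \<rho> / lam 0 + 1"
    have "0 \<le> \<rho>" using bd[of 0] norm_ge_zero[of "u 0"] by linarith
    then have "0 \<le> s" using lam_pos[of 0] by (simp add: s_def)
    then show ?thesis
      using absorbing_set_absorbs[OF bd[of "r - s"], of s] fwd[of s "r - s"] by (simp add: s_def)
  qed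
  show ?thesis
    unfolding attractor_def
  proof (rule INT_I)
    fix s :: real assume "s \<in> {0..}"
    then have "u t = semigroup D A F s (u (t - s))" using fwd[of s "t - s"] by simp
    then show "u t \<in> semigroup D A F s ` absorbing_set" using K by blast
  qed
qed

end

section \<open>Diagonal and weighted permutation operators\<close>

context hilbert_basis
begin

lemma norm_le_coord:
  assumes "\<And>n. \<bar>inner v (e n)\<bar> \<le> B * \<bar>inner u (e n)\<bar>" "0 \<le> B"
  shows "norm v \<le> B * norm u"
proof (rule norm_le_L2_set)
  fix N
  have "L2_set (\<lambda>n. inner v (e n)) {..<N} \<le> L2_set (\<lambda>n. B * inner u (e n)) {..<N}"
    unfolding L2_set_def using assms
    by (intro real_sqrt_le_mono sum_mono) (metis abs_le_square_iff abs_mult abs_of_nonneg)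
  also have "\<dots> = B * L2_set (\<lambda>n. inner u (e n)) {..<N}"
    using assms(2) by (simp add: L2_set_right_distrib)
  also have "\<dots> \<le> B * norm u" using assms(2) by (intro mult_left_mono bessel) auto
  finally show "L2_set (\<lambda>n. inner v (e n)) {..<N} \<le> B * norm u" .
qed

text \<open>One construction serves both the diagonal operators (\<tau> = id) and the signed swaps
  of chain neighbours. For bounded \<open>d\<close> and injective \<tau> the vector exists by
  Riesz-Fischer and Bessel's inequality.\<close>

definition coord_op :: "(nat \<Rightarrow> real) \<Rightarrow> (nat \<Rightarrow> nat) \<Rightarrow> 'a \<Rightarrow> 'a" where
  "coord_op d \<tau> u = (THE v. \<forall>n. inner v (e n) = d n * inner u (e (\<tau> n)))"

context
  fixes d :: "nat \<Rightarrow> real" and \<tau> :: "nat \<Rightarrow> nat" and B :: real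
  assumes d: "\<And>n. \<bar>d n\<bar> \<le> B" and \<tau>: "inj \<tau>"
begin

lemma coord_op_exists: "\<exists>v. (\<forall>n. inner v (e n) = d n * inner u (e (\<tau> n))) \<and> norm v \<le> B * norm u"
proof -
  have B: "0 \<le> B" using d[of 0] by linarith
  have "L2_set (\<lambda>n. d n * inner u (e (\<tau> n))) {..<N} \<le> B * norm u" for N
  proof -
    have "L2_set (\<lambda>n. d n * inner u (e (\<tau> n))) {..<N} \<le> L2_set (\<lambda>n. B * inner u (e (\<tau> n))) {..<N}"
      unfolding L2_set_def
    proof (intro real_sqrt_le_mono sum_mono)
      fix n
      have "\<bar>d n * inner u (e (\<tau> n))\<bar> \<le> \<bar>B * inner u (e (\<tau> n))\<bar>"
        using d[of n] B by (simp add: abs_mult mult_right_mono)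
      then show "(d n * inner u (e (\<tau> n)))\<^sup>2 \<le> (B * inner u (e (\<tau> n)))\<^sup>2" by (simp only: abs_le_square_iff)
    qed
    also have "\<dots> = B * L2_set (\<lambda>n. inner u (e (\<tau> n))) {..<N}" using B by (simp add: L2_set_right_distrib)
    also have "L2_set (\<lambda>n. inner u (e (\<tau> n))) {..<N} = L2_set (\<lambda>n. inner u (e n)) (\<tau> ` {..<N})"
      unfolding L2_set_def using \<tau> by (simp add: sum.reindex inj_on_subset[OF _ subset_UNIV] o_def)
    also have "\<dots> \<le> norm u" by (rule bessel) simp
    finally show ?thesis using B by (simp add: mult_left_mono)
  qed
  then show ?thesis using riesz_fischer[of "\<lambda>n. d n * inner u (e (\<tau> n))" "B * norm u"] by blast
qed

lemma coord_op_coord: "inner (coord_op d \<tau> u) (e n) = d n * inner u (e (\<tau> n))"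
proof -
  obtain v where v: "\<forall>n. inner v (e n) = d n * inner u (e (\<tau> n))" using coord_op_exists by blast
  then have "coord_op d \<tau> u = v" unfolding coord_op_def by (intro the_equality coord_eqI) auto
  with v show ?thesis by simp
qed

lemma norm_coord_op: "norm (coord_op d \<tau> u) \<le> B * norm u"
proof -
  obtain v where v: "\<forall>n. inner v (e n) = d n * inner u (e (\<tau> n))" "norm v \<le> B * norm u" using coord_op_exists by blast
  then have "coord_op d \<tau> u = v" by (intro coord_eqI) (simp add: coord_op_coord)
  with v show ?thesis by simp
qed

lemma bounded_linear_coord_op: "bounded_linear (coord_op d \<tau>)"
proof (rule bounded_linear_intro)
  show "norm (coord_op d \<tau> u) \<le> norm u * B" for u using norm_coord_op[of u] by (simp add: mult.commute)
qed (auto intro!: coord_eqI simp: coord_op_coord inner_add_left algebra_simps)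

end

lemma bounded_linear_proj: "bounded_linear (proj N)"
  by (rule bounded_linear_intro[where K = 1]) (auto simp: proj_add proj_scaleR norm_proj_le)

lemma proj_proj: "proj N (proj N u) = proj N u"
  by (rule coord_eqI) (simp add: inner_proj_e)

lemma inner_proj_proj: "inner (proj N u) v = inner (proj N u) (proj N v)"
proof -
  have "inner (proj N u) v = (\<Sum>n<N. inner u (e n) * inner v (e n))"
    using inner_proj_right[of v N u] by (simp add: inner_commute[of v] mult.commute)
  then show ?thesis by (simp add: inner_proj_right inner_proj_e)
qed

lemma norm_tail_square: "(norm (u - proj N u))\<^sup>2 = (norm u)\<^sup>2 - (norm (proj N u))\<^sup>2"
  using inner_proj_proj[of N u u]
  by (simp add: power2_norm_eq_inner inner_diff_left inner_diff_right inner_commute)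

end

text \<open>Greedy choice of the first eigenvalue at least \<open>c\<close> above the current one:
  its predecessor is less than \<open>c\<close> above, and one further step adds at most
  \<open>L0\<close>. The lower bound \<open>c\<close> excludes clusters, so that the chain grows at
  least linearly.\<close>

lemma eventually_chain_step:
  fixes lam :: "nat \<Rightarrow> real"
  assumes "incseq lam" "filterlim lam at_top sequentially" "\<And>n. lam (Suc n) - lam n \<le> L0" "0 < c"
  obtains m where "n < m" "c \<le> lam m - lam n" "lam m - lam n \<le> L0 + c"
proof -
  have "\<forall>\<^sub>F m in sequentially. lam n + c \<le> lam m"
    using assms(2) by (simp add: filterlim_at_top)
  then have ex: "\<exists>m. lam n + c \<le> lam m" unfolding eventually_sequentially by blast
  define m where "m = (LEAST m. lam n + c \<le> lam m)"
  have m: "lam n + c \<le> lam m" unfolding m_def using ex by (rule LeastI_ex)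
  have nm: "n < m"
  proof (rule ccontr)
    assume "\<not> n < m"
    then have "lam m \<le> lam n" using incseqD[OF assms(1), of m n] by simp
    with m assms(4) show False by linarith
  qed
  then obtain m' where m': "m = Suc m'" by (cases m) auto
  have "\<not> lam n + c \<le> lam m'"
    using not_less_Least[of m' "\<lambda>m. lam n + c \<le> lam m"] m' unfolding m_def by simp
  then have "lam m - lam n \<le> L0 + c" using assms(3)[of m'] m' by simp
  with nm m show ?thesis by (intro that[of m]) auto
qed

lemma chain_exists:
  fixes lam :: "nat \<Rightarrow> real"
  assumes "incseq lam" "filterlim lam at_top sequentially" "\<And>n. lam (Suc n) - lam n \<le> L0" "0 < c"
  obtains N where "strict_mono N" "N 0 = Suc 0" "\<And>k. c \<le> lam (N (Suc k)) - lam (N k)"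
    "\<And>k. lam (N (Suc k)) - lam (N k) \<le> L0 + c"
proof -
  have "\<forall>n. \<exists>m. n < m \<and> c \<le> lam m - lam n \<and> lam m - lam n \<le> L0 + c"
    by (rule allI, rule eventually_chain_step[OF assms]) blast
  from choice[OF this] obtain f where f: "\<forall>n. n < f n \<and> c \<le> lam (f n) - lam n \<and> lam (f n) - lam n \<le> L0 + c"
    by (rule exE)
  define N where "N k = (f ^^ k) (Suc 0)" for k
  have N: "N 0 = Suc 0" "N (Suc k) = f (N k)" for k by (simp_all add: N_def)
  have "strict_mono N" unfolding strict_mono_Suc_iff N(2) using f by simp
  moreover have "c \<le> lam (N (Suc k)) - lam (N k)" "lam (N (Suc k)) - lam (N k) \<le> L0 + c" for k
    unfolding N(2) using f by simp_all
  ultimately show ?thesis using N(1) that by simp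
qed

locale eigen_chain = spectral_op +
  fixes N :: "nat \<Rightarrow> nat" and gap G :: real
  assumes N_mono: "strict_mono N" and N_0: "N 0 = Suc 0" and gap_pos: "0 < gap"
    and gap_le: "gap \<le> lam (N (Suc k)) - lam (N k)" and gap_ge: "lam (N (Suc k)) - lam (N k) \<le> G"
begin

definition mu :: "nat \<Rightarrow> real" where "mu k = lam (N k)"

lemma mu_0: "mu 0 = lam 1"
  by (simp add: mu_def N_0)

lemma mu_pos: "0 < mu k"
  by (simp add: mu_def lam_pos)

lemma mu_Suc: "mu k + gap \<le> mu (Suc k)" "mu (Suc k) \<le> mu k + G"
  using gap_le[of k] gap_ge[of k] by (simp_all add: mu_def)

lemma mu_ge: "real k * gap \<le> mu k"
proof (induction k)
  case 0
  then show ?case using mu_pos[of 0] by simp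
next
  case (Suc k)
  then show ?case using mu_Suc(1)[of k] by (simp add: algebra_simps)
qed

lemma G_pos: "0 < G"
  using mu_Suc[of 0] gap_pos by linarith

lemma N_inj [simp]: "N i = N k \<longleftrightarrow> i = k"
  using N_mono by (simp add: strict_mono_eq)

lemma N_ge_2: "1 \<le> k \<Longrightarrow> 2 \<le> N k"
  using strict_mono_less[OF N_mono, of 0 k] by (simp add: N_0)

text \<open>The pairs \<open>(k, k + 1)\<close> of chain indices with \<open>k + j\<close> even are coupled simultaneously, for \<open>j = 0\<close>
  and for \<open>j = 1\<close>. Index \<open>0\<close> stands for the radial variable, which is not a coordinate; hence it is left out.\<close>

definition partner :: "nat \<Rightarrow> nat \<Rightarrow> nat" where
  "partner j k = (if even (k + j) then Suc k else k - 1)"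

definition chain_index :: "nat \<Rightarrow> nat" where
  "chain_index n = (THE k. n = N k)"

lemma chain_index_N [simp]: "chain_index (N k) = k"
  unfolding chain_index_def by (rule the_equality) auto

definition on_chain :: "(nat \<Rightarrow> real) \<Rightarrow> nat \<Rightarrow> real" where
  "on_chain d n = (if n \<in> range N then d (chain_index n) else 0)"

lemma on_chain_N [simp]: "on_chain d (N k) = d k"
  by (simp add: on_chain_def)

text \<open>Added to the original rates, these terms let both members of a pair decay at the mean
  rate. For j = 0 index 1 keeps its share although its partner is the radial variable, which is
  equalized separately in the clock plane.\<close>

definition equalizer_coeff :: "nat \<Rightarrow> nat \<Rightarrow> real" where
  "equalizer_coeff j k = (if k = 0 then 0 else
     if even (k + j) then - (mu (Suc k) - mu k) / 2 else (mu k - mu (k - 1)) / 2)"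

text \<open>The condition \<open>k + j < 2\<close> singles out the pair (0, 1) for j = 0, whose
  coupling involves \<eta> and is nonlinear, and the unpaired index 0 for j = 1.\<close>

definition rotation_coeff :: "nat \<Rightarrow> nat \<Rightarrow> real" where
  "rotation_coeff j k = (if k + j < 2 then 0 else if even (k + j) then - 1 else 1)"

definition equalizer :: "nat \<Rightarrow> 'a \<Rightarrow> 'a" where
  "equalizer j = coord_op (on_chain (equalizer_coeff j)) id"

definition rotation :: "nat \<Rightarrow> 'a \<Rightarrow> 'a" where
  "rotation j = coord_op (on_chain (rotation_coeff j)) (\<lambda>n. if n \<in> range N then N (partner j (chain_index n)) else n)"

lemma equalizer_coeff_bound: "\<bar>equalizer_coeff j k\<bar> \<le> G / 2"
  using mu_Suc[of k] mu_Suc[of "k - 1"] gap_pos G_pos by (auto simp: equalizer_coeff_def)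

lemma on_chain_equalizer_bound: "\<bar>on_chain (equalizer_coeff j) n\<bar> \<le> G / 2"
  using equalizer_coeff_bound G_pos by (auto simp: on_chain_def)

lemma on_chain_rotation_bound: "\<bar>on_chain (rotation_coeff j) n\<bar> \<le> 1"
  by (auto simp: on_chain_def rotation_coeff_def)

text \<open>For either parity the map is an involution; for j = 1 truncated subtraction makes 0 a
  fixed point.\<close>

lemma partner_inj: "j \<le> 1 \<Longrightarrow> inj (partner j)"
proof (rule injI)
  fix x y assume "j \<le> 1" and eq: "partner j x = partner j y"
  then consider "j = 0" | "j = 1" by linarith
  then show "x = y"
  proof cases
    case 1
    then show ?thesis
      using eq[unfolded partner_def] by (simp split: if_splits) (presburger+)
  next
    case 2
    then show ?thesis
      using eq[unfolded partner_def] by (simp split: if_splits) (presburger+)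
  qed
qed

lemma rotation_index_inj:
  assumes "j \<le> 1"
  shows "inj (\<lambda>n. if n \<in> range N then N (partner j (chain_index n)) else n)"
proof (rule injI)
  fix n n' :: nat
  let ?f = "\<lambda>n. if n \<in> range N then N (partner j (chain_index n)) else n"
  assume eq: "?f n = ?f n'"
  have range: "?f n \<in> range N \<longleftrightarrow> n \<in> range N" for n by simp
  have "?f n \<in> range N \<longleftrightarrow> ?f n' \<in> range N" by (simp only: eq)
  then have both: "n \<in> range N \<longleftrightarrow> n' \<in> range N" unfolding range .
  show "n = n'"
  proof (cases "n \<in> range N")
    case True
    then have "n' \<in> range N" using both by simp
    with True obtain k k' where "n = N k" "n' = N k'" by blast
    then show ?thesis using eq injD[OF partner_inj[OF assms], of k k'] by simp
  next
    case False
    then have "n' \<notin> range N" using both by simp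
    with False eq show ?thesis by simp
  qed
qed

lemma equalizer_coord: "inner (equalizer j u) (e n) = on_chain (equalizer_coeff j) n * inner u (e n)"
  unfolding equalizer_def using on_chain_equalizer_bound by (subst coord_op_coord[where B = "G / 2"]) auto

lemma bounded_linear_equalizer: "bounded_linear (equalizer j)"
  unfolding equalizer_def by (rule bounded_linear_coord_op[OF on_chain_equalizer_bound]) simp

lemma rotation_coord_N: "j \<le> 1 \<Longrightarrow> inner (rotation j u) (e (N k)) = rotation_coeff j k * inner u (e (N (partner j k)))"
  unfolding rotation_def by (subst coord_op_coord[OF on_chain_rotation_bound rotation_index_inj]) auto

lemma rotation_coord_other: "j \<le> 1 \<Longrightarrow> n \<notin> range N \<Longrightarrow> inner (rotation j u) (e n) = 0"
  unfolding rotation_def by (subst coord_op_coord[OF on_chain_rotation_bound rotation_index_inj]) (auto simp: on_chain_def)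

lemma bounded_linear_rotation: "j \<le> 1 \<Longrightarrow> bounded_linear (rotation j)"
  unfolding rotation_def by (rule bounded_linear_coord_op[OF on_chain_rotation_bound rotation_index_inj])

lemma on_chain_low:
  assumes "n < 2" "d 0 = 0"
  shows "on_chain d n = 0"
proof (cases "n \<in> range N")
  case True
  then obtain k where k: "n = N k" by blast
  then have "k = 0" using N_ge_2[of k] assms(1) by (cases k) auto
  then show ?thesis using k assms(2) by simp
qed (simp add: on_chain_def)

text \<open>The equalizers annihilate the clock plane. Their smallness near the circle later
  compensates the steepness of the cutoffs in front of them.\<close>

lemma norm_equalizer_le: "norm (equalizer j u) \<le> G / 2 * norm (u - proj 2 u)"
proof (rule norm_le_coord)
  fix n
  show "\<bar>inner (equalizer j u) (e n)\<bar> \<le> G / 2 * \<bar>inner (u - proj 2 u) (e n)\<bar>"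
  proof (cases "n < 2")
    case True
    then show ?thesis using on_chain_low[of n "equalizer_coeff j"]
      by (simp add: equalizer_coord equalizer_coeff_def inner_diff_left inner_proj_e)
  next
    case False
    then show ?thesis using mult_right_mono[OF on_chain_equalizer_bound[of j n] abs_ge_zero[of "inner u (e n)"]]
      by (simp add: equalizer_coord inner_diff_left inner_proj_e abs_mult)
  qed
qed (use G_pos in simp)

end

section \<open>The nonlinearity\<close>

text \<open>The derivatives of this quadratic form are written down directly: 2 <x, h>, then the
  constant form 2 <h, k>, then zero.\<close>

lemma smooth_bdd_inner_self: "smooth_bdd (\<lambda>u::'a::real_inner. inner u u)"
proof -
  have b0: "list_form_bound 0 (\<lambda>x::'a. \<lambda>_. inner x x)"
    unfolding list_form_bound_def
  proof (intro allI)
    fix R :: real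
    have "norm (inner x x) \<le> R\<^sup>2" if "norm x \<le> R" for x :: 'a
      using power_mono[OF that norm_ge_zero, of 2] by (simp add: power2_norm_eq_inner)
    then show "\<exists>M\<ge>0. \<forall>(x::'a) hs. norm x \<le> R \<longrightarrow> length hs = 0 \<longrightarrow> norm (inner x x) \<le> M * prod_list (map norm (hs::'a list))"
      by (intro exI[of _ "R\<^sup>2"]) auto
  qed
  have b1: "list_form_bound 1 (\<lambda>x::'a. \<lambda>hs. 2 * inner x (hd hs))"
    unfolding list_form_bound_def
  proof (intro allI exI[of _ "2 * \<bar>_\<bar>"] conjI impI)
    fix R :: real and x :: 'a and hs :: "'a list" assume x: "norm x \<le> R" and "length hs = 1"
    then obtain h where hs: "hs = [h]" by (auto simp: length_Suc_conv)
    have "\<bar>inner x h\<bar> \<le> norm x * norm h" by (rule Cauchy_Schwarz_ineq2)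
    also have "\<dots> \<le> \<bar>R\<bar> * norm h" using x by (intro mult_right_mono) auto
    finally show "norm (2 * inner x (hd hs)) \<le> 2 * \<bar>R\<bar> * prod_list (map norm hs)" by (simp add: hs)
  qed simp
  have b2: "list_form_bound 2 (\<lambda>x::'a. \<lambda>hs. 2 * inner (hd hs) (hd (tl hs)))"
    unfolding list_form_bound_def
  proof (intro allI exI[of _ 2] conjI impI)
    fix R :: real and x :: 'a and hs :: "'a list" assume "length hs = 2"
    then obtain h k where hs: "hs = [h, k]" by (auto simp: numeral_2_eq_2 length_Suc_conv)
    show "norm (2 * inner (hd hs) (hd (tl hs))) \<le> 2 * prod_list (map norm hs)"
      using Cauchy_Schwarz_ineq2[of h k] by (simp add: hs)
  qed simp
  have d0: "list_form_deriv 0 (\<lambda>x::'a. \<lambda>_. inner x x) (\<lambda>x hs. 2 * inner x (hd hs))"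
    unfolding list_form_deriv_def
  proof (intro conjI allI impI)
    fix x :: 'a and r :: real assume r: "0 < r"
    have "norm (inner y y - inner x x - 2 * inner x (y - x)) \<le> r * norm (y - x)" if "norm (y - x) < r" for y
    proof -
      have "inner y y - inner x x - 2 * inner x (y - x) = norm (y - x) * norm (y - x)"
        by (simp add: power2_eq_square[symmetric] power2_norm_eq_inner inner_diff_left inner_diff_right inner_commute)
      then show ?thesis using that by (simp add: mult_right_mono)
    qed
    then show "\<exists>\<delta>>0. \<forall>y. norm (y - x) < \<delta> \<longrightarrow> (\<forall>hs. length hs = 0 \<longrightarrow>
        norm (inner y y - inner x x - 2 * inner x (hd ((y - x) # hs))) \<le> r * norm (y - x) * prod_list (map norm hs))"
      using r by (intro exI[of _ r]) auto
  qed (simp add: linear_iff inner_add_right algebra_simps)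
  have d1: "list_form_deriv 1 (\<lambda>x::'a. \<lambda>hs. 2 * inner x (hd hs)) (\<lambda>x hs. 2 * inner (hd hs) (hd (tl hs)))"
    unfolding list_form_deriv_def
    by (auto simp: linear_iff inner_add_left inner_diff_left prod_list_norm_nonneg algebra_simps intro!: exI[of _ 1])
  have d2: "list_form_deriv 2 (\<lambda>x::'a. \<lambda>hs. 2 * inner (hd hs) (hd (tl hs))) (\<lambda>_ _. 0)"
    unfolding list_form_deriv_def by (auto simp: linear_iff prod_list_norm_nonneg intro!: exI[of _ 1])
  have "smooth_form n 2 (\<lambda>x::'a. \<lambda>hs. 2 * inner (hd hs) (hd (tl hs)))" for n
    using b2 d2 smooth_form_zero[of _ "Suc 2"] by (cases n) auto
  then have "smooth_form n 1 (\<lambda>x::'a. \<lambda>hs. 2 * inner x (hd hs))" for n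
    using b1 d1 by (cases n) (auto simp: numeral_2_eq_2)
  then have "smooth_form n 0 (\<lambda>x::'a. \<lambda>_. inner x x)" for n
    using b0 d0 by (cases n) auto
  then show ?thesis unfolding smooth_bdd_def by simp
qed

lemma smooth_bdd_inner_left: "smooth_bdd (\<lambda>u. inner u c)"
  by (rule smooth_bdd_bounded_linear[OF bounded_linear_inner_left])

lemma smooth_bdd_power2: "smooth_bdd f \<Longrightarrow> smooth_bdd (\<lambda>x. (f x :: real)\<^sup>2)"
  unfolding power2_eq_square by (rule smooth_bdd_mult)

lemmas smooth_bdd_intros = smooth_bdd_const smooth_bdd_add smooth_bdd_diff smooth_bdd_scaleR smooth_bdd_mult
  smooth_bdd_power2 smooth_bdd_inner_left smooth_bdd_smooth_step

text \<open>Two points either both have \<open>T\<close>-image in the ball of radius R + 1, where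
  the local Lipschitz constant \<open>M2\<close> works, or one image lies outside. In the latter
  case the other value vanishes too, or the images are at least 1 apart and the bound
  \<open>M1\<close> on \<open>f\<close> is enough. \<open>T\<close> allows for functions supported
  in a cylinder.\<close>

lemma smooth_bdd_lipschitz_if_bounded_support:
  fixes f :: "'a::real_normed_vector \<Rightarrow> 'b::real_normed_vector"
  assumes f: "smooth_bdd f" and T: "linear T" "\<And>x. norm (T x) \<le> norm x"
    and fT: "\<And>x. f x = f (T x)" and supp: "\<And>x. R \<le> norm (T x) \<Longrightarrow> f x = 0"
  obtains B where "0 \<le> B" "\<And>x. norm (f x) \<le> B" "\<And>x y. norm (f x - f y) \<le> B * norm (x - y)"
proof -
  obtain M1 where M1: "0 \<le> M1" "\<And>x. norm x \<le> R + 1 \<Longrightarrow> norm (f x) \<le> M1"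
    by (rule smooth_bdd_bounded_on_cball[OF f, of "R + 1"]) (rule that)
  obtain M2 where M2: "0 \<le> M2" "\<And>x y. norm x \<le> R + 1 \<Longrightarrow> norm y \<le> R + 1 \<Longrightarrow> norm (f x - f y) \<le> M2 * norm (x - y)"
    by (rule smooth_bdd_lipschitz_on_cball[OF f, of "R + 1"]) (rule that)
  have bd: "norm (f x) \<le> M1" for x
  proof (cases "R \<le> norm (T x)")
    case True
    then show ?thesis using supp M1(1) by simp
  next
    case False
    then show ?thesis using M1(2)[of "T x"] fT[of x] by simp
  qed
  have far: "norm (f x - f y) \<le> (M1 + M2) * norm (T x - T y)" if x: "R + 1 < norm (T x)" for x y
  proof (cases "R \<le> norm (T y)")
    case True
    then show ?thesis using supp x M1(1) M2(1) by simp
  next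
    case False
    then have 1: "1 \<le> norm (T x - T y)" using x norm_triangle_ineq2[of "T x" "T y"] by linarith
    have "norm (f x - f y) \<le> M1" using supp[of x] x bd[of y] by simp
    also have "\<dots> \<le> (M1 + M2) * 1" using M2(1) by simp
    also have "\<dots> \<le> (M1 + M2) * norm (T x - T y)" using 1 M1(1) M2(1) by (intro mult_left_mono) auto
    finally show ?thesis .
  qed
  have "norm (f x - f y) \<le> (M1 + M2) * norm (T x - T y)" for x y
  proof -
    consider "R + 1 < norm (T x)" | "R + 1 < norm (T y)" | "norm (T x) \<le> R + 1" "norm (T y) \<le> R + 1" by linarith
    then show ?thesis
    proof cases
      case 2
      then show ?thesis using far[of y x] by (simp add: norm_minus_commute)
    next
      case 3
      have "norm (f x - f y) \<le> M2 * norm (T x - T y)" using M2(2)[OF 3] fT[of x] fT[of y] by simp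
      then show ?thesis using M1(1) mult_right_mono[of M2 "M1 + M2" "norm (T x - T y)"] by simp
    qed (rule far)
  qed
  moreover have "(M1 + M2) * norm (T x - T y) \<le> (M1 + M2) * norm (x - y)" for x y
    using T(2)[of "x - y"] M1(1) M2(1) linear_diff[OF T(1), of x y] by (intro mult_left_mono) auto
  ultimately have "norm (f x - f y) \<le> (M1 + M2) * norm (x - y)" for x y by (rule order_trans)
  moreover have "norm (f x) \<le> M1 + M2" for x using bd[of x] M2(1) by linarith
  ultimately show ?thesis using M1(1) M2(1) by (intro that[of "M1 + M2"]) auto
qed

section \<open>Geometry near the periodic orbit\<close>

text \<open>\<nu> is the width of the angular sectors and \<kappa> the slope of the logarithmic
  cutoffs; the transition of \<open>cut\<close>, as a function of \<open>dev\<close>, takes place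
  between \<open>P\<close> and \<open>s1\<^sup>2\<close>. \<open>K\<close> and \<open>c'\<close>
  control the derivatives of the cutoff profiles.\<close>

locale clock = eigen_chain +
  fixes \<nu> \<kappa> P s1 K :: real and c' :: "real \<Rightarrow> real \<Rightarrow> real \<Rightarrow> real"
  assumes \<nu>: "0 < \<nu>" "\<nu> \<le> 1 / 8" and \<kappa>: "0 < \<kappa>" "\<kappa> \<le> 1" and P_pos: "0 < P"
    and P_s1: "P * exp (2 / \<kappa>) \<le> s1\<^sup>2" and s1: "0 < s1" "s1 \<le> 1 / 2" and K_pos: "0 < K"
    and c'_deriv: "\<And>\<kappa> P p. 0 < P \<Longrightarrow> 0 \<le> p \<Longrightarrow> (log_cutoff \<kappa> P has_real_derivative c' \<kappa> P p) (at p)"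
    and c'_bound: "\<And>\<kappa> P p. 0 < P \<Longrightarrow> 0 \<le> p \<Longrightarrow> 0 < \<kappa> \<Longrightarrow> \<bar>c' \<kappa> P p\<bar> * (P + p) \<le> K * \<kappa>"
    and c'_zero: "\<And>\<kappa> P p. 0 < P \<Longrightarrow> 0 < \<kappa> \<Longrightarrow> P * exp (2 / \<kappa>) \<le> p \<Longrightarrow> c' \<kappa> P p = 0"
    and step_deriv: "\<And>x. \<exists>D. (smooth_step has_real_derivative D) (at x) \<and> \<bar>D\<bar> \<le> K"
begin

lemma P_le: "P \<le> (1 / 2)\<^sup>2"
proof -
  have "P \<le> P * exp (2 / \<kappa>)" using P_pos \<kappa> by simp
  also have "\<dots> \<le> (1 / 2)\<^sup>2" using P_s1 power_mono[OF s1(2), of 2] s1(1) by linarith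
  finally show ?thesis .
qed

definition rsq :: "'a \<Rightarrow> real" where "rsq u = (inner u (e 0))\<^sup>2 + (inner u (e 1))\<^sup>2"
text \<open>A polynomial substitute for the squared distance to the unit circle in the clock
  plane.\<close>

definition dev :: "'a \<Rightarrow> real" where "dev u = (1 - rsq u)\<^sup>2 + (inner u u - rsq u)"
definition chi :: "'a \<Rightarrow> real" where "chi u = log_cutoff \<kappa> 2 (rsq u)"
definition cut :: "'a \<Rightarrow> real" where "cut u = log_cutoff \<kappa> P (dev u)"
definition psi :: "'a \<Rightarrow> real" where "psi u = rsq u + (1 - smooth_step (8 * rsq u - 1))"
text \<open>Wherever \<open>rsq u\<close> is at least 1/4 this is the sine of the angle in the clock
  plane.\<close>

definition phase :: "'a \<Rightarrow> real" where "phase u = inner u (e 1) * psi u powr (- 1 / 2)"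
text \<open>The cutoff below \<open>rsq u = 1 / 4\<close> in \<open>psi\<close> only serves to avoid the singularity of \<open>1 / rsq\<close>. Sector
  \<open>\<sigma> = \<plusminus> 1\<close> lies around the angle \<open>\<sigma> \<pi> / 2\<close>; decay rates are equalized in the wider one (\<open>a = 2\<close>), which is
  fully active wherever the narrower one (\<open>a = 1\<close>), used for the rotations, does not vanish.\<close>

definition sector :: "real \<Rightarrow> real \<Rightarrow> 'a \<Rightarrow> real" where
  "sector a \<sigma> u = smooth_step ((1 / \<nu>) * (\<sigma> * phase u - 1) + a)"
text \<open>If r' = a r, then \<eta>' = - a / r^2 = - a (1 + 2 \<eta>), while 1 - r^2 = 2 \<eta> /
  (1 + 2 \<eta>). Thus a = \<epsilon> (1 - r^2) gives \<eta>' = - 2 \<epsilon> \<eta> without any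
  remainder.\<close>

definition eta :: "'a \<Rightarrow> real" where "eta u = (1 / 2) * (1 / psi u - 1)"

lemma proj_2: "proj 2 u = inner u (e 0) *\<^sub>R e 0 + inner u (e 1) *\<^sub>R e 1"
  by (simp add: proj_def numeral_2_eq_2)

lemma rsq_eq: "rsq u = (norm (proj 2 u))\<^sup>2"
  by (simp add: rsq_def norm_proj L2_set_def numeral_2_eq_2 sum_nonneg)

lemma rsq_nonneg: "0 \<le> rsq u"
  by (simp add: rsq_def)

lemma rsq_proj: "rsq (proj 2 u) = rsq u"
  by (simp add: rsq_def inner_proj_e)

lemma dev_eq: "dev u = (1 - rsq u)\<^sup>2 + (norm (u - proj 2 u))\<^sup>2"
  by (simp only: dev_def norm_tail_square rsq_eq dot_square_norm)

lemma dev_nonneg: "0 \<le> dev u"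
  by (simp add: dev_eq)

lemma abs_rsq_le_dev: "\<bar>1 - rsq u\<bar> \<le> sqrt (dev u)"
  by (rule real_le_rsqrt) (simp add: dev_eq)

lemma tail_le_dev: "norm (u - proj 2 u) \<le> sqrt (dev u)"
  by (rule real_le_rsqrt) (simp add: dev_eq)

lemma dev_le_s1: "dev u \<le> s1\<^sup>2 \<Longrightarrow> sqrt (dev u) \<le> s1"
  using s1 by (intro real_le_lsqrt) auto

lemma rsq_bounds: "dev u \<le> s1\<^sup>2 \<Longrightarrow> 1 / 2 \<le> rsq u \<and> rsq u \<le> 3 / 2"
  using abs_rsq_le_dev[of u] dev_le_s1[of u] s1 by linarith

lemma norm_if_dev_le: "dev u \<le> s1\<^sup>2 \<Longrightarrow> norm u < 2"
proof -
  assume d: "dev u \<le> s1\<^sup>2"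
  have "(norm u)\<^sup>2 = rsq u + (norm (u - proj 2 u))\<^sup>2" by (simp add: norm_tail_square rsq_eq)
  also have "\<dots> \<le> 3 / 2 + (1 / 2)\<^sup>2"
    using rsq_bounds[OF d] tail_le_dev[of u] dev_le_s1[OF d] s1 by (intro add_mono power_mono) auto
  also have "\<dots> < 2\<^sup>2" by (simp add: power2_eq_square)
  finally show "norm u < 2" by (rule power2_less_imp_less) simp
qed

lemma cut_nonzero: "cut u \<noteq> 0 \<Longrightarrow> dev u \<le> s1\<^sup>2"
  using log_cutoff_eq_0[OF \<kappa>(1) P_pos, of "dev u"] P_s1 unfolding cut_def by linarith

lemma cut_bounds: "0 \<le> cut u" "cut u \<le> 1"
  by (simp_all add: cut_def log_cutoff_ge_0 log_cutoff_le_1)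

lemma chi_bounds: "0 \<le> chi u" "chi u \<le> 1"
  by (simp_all add: chi_def log_cutoff_ge_0 log_cutoff_le_1)

lemma chi_1: "rsq u \<le> 2 \<Longrightarrow> chi u = 1"
  using log_cutoff_eq_1[OF \<kappa>, of 2 "rsq u"] rsq_nonneg[of u] by (simp add: chi_def)

lemma cut_1: "dev u \<le> P \<Longrightarrow> cut u = 1"
  using log_cutoff_eq_1[OF \<kappa> P_pos dev_nonneg] by (simp add: cut_def)

lemma sector_bounds: "0 \<le> sector a \<sigma> u" "sector a \<sigma> u \<le> 1"
  by (simp_all add: sector_def smooth_step_ge_0 smooth_step_le_1)

lemma psi_ge: "1 / 8 \<le> psi u"
proof (cases "1 / 8 \<le> rsq u")
  case True
  then show ?thesis using smooth_step_le_1[of "8 * rsq u - 1"] by (simp add: psi_def)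
next
  case False
  then show ?thesis using rsq_nonneg[of u] by (simp add: psi_def smooth_step_eq_0)
qed

lemma psi_eq: "1 / 4 \<le> rsq u \<Longrightarrow> psi u = rsq u"
  by (simp add: psi_def smooth_step_eq_1)

lemma sector_pos: "0 < sector a \<sigma> u \<Longrightarrow> a \<le> 2 \<Longrightarrow> 1 - 2 * \<nu> < \<sigma> * phase u"
proof -
  assume "0 < sector a \<sigma> u" "a \<le> 2"
  then have "0 < (1 / \<nu>) * (\<sigma> * phase u - 1) + a" using smooth_step_eq_0 unfolding sector_def by (metis less_irrefl not_less)
  then have "- 2 < (1 / \<nu>) * (\<sigma> * phase u - 1)" using \<open>a \<le> 2\<close> by linarith
  then have "- 2 * \<nu> < \<sigma> * phase u - 1" using \<nu>(1) by (simp add: field_simps)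
  then show "1 - 2 * \<nu> < \<sigma> * phase u" by linarith
qed

text \<open>An active upper sector has phase above 1 - 2 \<nu>, an active lower one below 2 \<nu> -
  1; \<nu> \<le> 1/8 excludes both at once.\<close>

lemma sectors_disjoint: "sector 2 1 u = 0 \<or> sector 2 (- 1) u = 0"
  using sector_pos[of 2 1 u] sector_pos[of 2 "- 1" u] sector_bounds(1)[of 2 1 u] sector_bounds(1)[of 2 "- 1" u] \<nu> by linarith

lemma smooth_bdd_rsq: "smooth_bdd rsq"
  unfolding rsq_def[abs_def] by (intro smooth_bdd_intros)

lemma smooth_bdd_dev: "smooth_bdd dev"
  unfolding dev_def[abs_def] by (intro smooth_bdd_intros smooth_bdd_rsq smooth_bdd_inner_self)

lemma smooth_bdd_chi: "smooth_bdd chi"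
  unfolding chi_def[abs_def] by (intro smooth_bdd_log_cutoff smooth_bdd_rsq rsq_nonneg) simp

lemma smooth_bdd_cut: "smooth_bdd cut"
  unfolding cut_def[abs_def] by (intro smooth_bdd_log_cutoff smooth_bdd_dev dev_nonneg P_pos)

lemma smooth_bdd_psi: "smooth_bdd psi"
  unfolding psi_def[abs_def] by (intro smooth_bdd_intros smooth_bdd_rsq)

lemma smooth_bdd_phase: "smooth_bdd phase"
proof -
  have "smooth_bdd (\<lambda>u. inner u (e 1) * (1 * psi u powr (- 1 / 2)))"
    by (intro smooth_bdd_mult smooth_bdd_inner_left smooth_bdd_compose_pos[OF real_smooth_powr smooth_bdd_psi _ psi_ge]) simp
  then show ?thesis unfolding phase_def[abs_def] by (simp only: mult_1_left)
qed

lemma smooth_bdd_sector: "smooth_bdd (sector a \<sigma>)"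
  unfolding sector_def[abs_def] by (intro smooth_bdd_intros smooth_bdd_phase)

lemma smooth_bdd_eta: "smooth_bdd eta"
  unfolding eta_def[abs_def]
  by (intro smooth_bdd_intros smooth_bdd_divide[OF smooth_bdd_const smooth_bdd_psi _ psi_ge]) simp

section \<open>The components of the nonlinearity\<close>

definition low_A :: "'a \<Rightarrow> 'a" where
  "low_A u = (lam 0 * inner u (e 0)) *\<^sub>R e 0 + (lam 1 * inner u (e 1)) *\<^sub>R e 1"

definition spin :: "'a \<Rightarrow> 'a" where
  "spin u = inner u (e 0) *\<^sub>R e 1 - inner u (e 1) *\<^sub>R e 0"

text \<open>Apart from \<open>F_low\<close> this is the only component without small prefactor. Its
  first summand speeds up the decay of \<eta> by \<open>m\<close> in the upper sector; the others
  equalize the rates of chain neighbours, one parity per sector.\<close>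

definition F_main :: "real \<Rightarrow> 'a \<Rightarrow> 'a" where
  "F_main m u = (cut u * sector 2 1 u * (m / 2 * (1 - rsq u))) *\<^sub>R proj 2 u +
     (cut u * sector 2 1 u) *\<^sub>R equalizer 0 u + (cut u * sector 2 (- 1) u) *\<^sub>R equalizer 1 u"

definition F_low :: "'a \<Rightarrow> 'a" where "F_low u = chi u *\<^sub>R low_A u"

definition F_spin :: "'a \<Rightarrow> 'a" where "F_spin u = chi u *\<^sub>R spin u"

definition F_rad :: "'a \<Rightarrow> 'a" where "F_rad u = (chi u * (1 - rsq u)) *\<^sub>R proj 2 u"

text \<open>The first and third term in the upper sector form a rotation between \<eta> and the
  coordinate y of \<open>e (N 1)\<close>. The factor \<open>rsq u\<close> gives r' = r^3 y, so
  \<eta>' = - r' / r^3 = - y, while y receives \<eta>. Prefactors are suppressed here.\<close>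

definition F_coup :: "'a \<Rightarrow> 'a" where
  "F_coup u = (cut u * sector 1 1 u) *\<^sub>R ((rsq u * inner u (e (N 1))) *\<^sub>R proj 2 u + rotation 0 u + eta u *\<^sub>R e (N 1))
     + (cut u * sector 1 (- 1) u) *\<^sub>R rotation 1 u"

text \<open>The first bracket carries the Lipschitz constant; the second consists of fixed maps
  multiplied by factors that are chosen small at the very end.\<close>

definition nonlin :: "real \<Rightarrow> real \<Rightarrow> real \<Rightarrow> real \<Rightarrow> 'a \<Rightarrow> 'a" where
  "nonlin m \<omega> \<epsilon> b u = (F_low u + F_main m u) + (\<omega> *\<^sub>R F_spin u + \<epsilon> *\<^sub>R F_rad u + b *\<^sub>R F_coup u)"

lemma smooth_bdd_low_A: "smooth_bdd low_A"
  unfolding low_A_def[abs_def] by (intro smooth_bdd_intros)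

lemma smooth_bdd_spin: "smooth_bdd spin"
  unfolding spin_def[abs_def] by (intro smooth_bdd_intros)

lemma smooth_bdd_proj: "smooth_bdd (proj n)"
  by (rule smooth_bdd_bounded_linear[OF bounded_linear_proj])

lemma smooth_bdd_equalizer: "smooth_bdd (equalizer j)"
  by (rule smooth_bdd_bounded_linear[OF bounded_linear_equalizer])

lemma smooth_bdd_rotation: "j \<le> 1 \<Longrightarrow> smooth_bdd (rotation j)"
  by (rule smooth_bdd_bounded_linear[OF bounded_linear_rotation])

lemmas smooth_clock_intros = smooth_bdd_intros smooth_bdd_rsq smooth_bdd_chi smooth_bdd_cut smooth_bdd_sector smooth_bdd_eta
  smooth_bdd_low_A smooth_bdd_spin smooth_bdd_proj smooth_bdd_equalizer smooth_bdd_rotation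

lemma smooth_bdd_F_low: "smooth_bdd F_low"
  unfolding F_low_def[abs_def] by (intro smooth_clock_intros)

lemma smooth_bdd_F_spin: "smooth_bdd F_spin"
  unfolding F_spin_def[abs_def] by (intro smooth_clock_intros)

lemma smooth_bdd_F_rad: "smooth_bdd F_rad"
  unfolding F_rad_def[abs_def] by (intro smooth_clock_intros)

lemma smooth_bdd_F_main: "smooth_bdd (F_main m)"
  unfolding F_main_def[abs_def] by (intro smooth_clock_intros)

lemma smooth_bdd_F_coup: "smooth_bdd F_coup"
  unfolding F_coup_def[abs_def] by (intro smooth_clock_intros) auto

lemma smooth_bdd_nonlin: "smooth_bdd (nonlin m \<omega> \<epsilon> b)"
  unfolding nonlin_def[abs_def]
  by (intro smooth_bdd_intros smooth_bdd_F_low smooth_bdd_F_spin smooth_bdd_F_rad smooth_bdd_F_main smooth_bdd_F_coup)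

lemma chi_far: "sqrt (2 * exp (2 / \<kappa>)) \<le> norm (proj 2 u) \<Longrightarrow> chi u = 0"
  unfolding chi_def
  by (rule log_cutoff_eq_0[OF \<kappa>(1)]) (auto simp: rsq_eq intro: sqrt_le_D)

text \<open>The support is a cylinder, bounded in the clock plane only; dependence on
  \<open>proj 2 u\<close> alone makes up for it.\<close>

lemma low_lipschitz:
  assumes "smooth_bdd f" "\<And>u. f u = f (proj 2 u)" "\<And>u. chi u = 0 \<Longrightarrow> f u = 0"
  obtains B where "0 \<le> B" "\<And>x. norm (f x) \<le> B" "\<And>x y. norm (f x - f y) \<le> B * norm (x - y)"
  by (rule smooth_bdd_lipschitz_if_bounded_support[OF assms(1) bounded_linear.linear[OF bounded_linear_proj] norm_proj_le assms(2)])
    (use assms(3) chi_far that in blast)+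

lemma cut_lipschitz:
  assumes "smooth_bdd f" "\<And>u. cut u = 0 \<Longrightarrow> f u = 0"
  obtains B where "0 \<le> B" "\<And>x. norm (f x) \<le> B" "\<And>x y. norm (f x - f y) \<le> B * norm (x - y)"
proof (rule smooth_bdd_lipschitz_if_bounded_support[OF assms(1), of id 2])
  show "f x = 0" if "2 \<le> norm (id x)" for x
    using that norm_if_dev_le[of x] cut_nonzero[of x] assms(2) by fastforce
qed (use that in \<open>auto simp: linear_iff\<close>)

lemma chi_proj: "chi (proj 2 u) = chi u"
  by (simp add: chi_def rsq_proj)

lemma F_low_lipschitz:
  obtains B where "0 \<le> B" "\<And>x. norm (F_low x) \<le> B" "\<And>x y. norm (F_low x - F_low y) \<le> B * norm (x - y)"
  by (rule low_lipschitz[OF smooth_bdd_F_low]) (auto simp: F_low_def chi_proj low_A_def inner_proj_e intro: that)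

lemma F_spin_lipschitz:
  obtains B where "0 \<le> B" "\<And>x. norm (F_spin x) \<le> B" "\<And>x y. norm (F_spin x - F_spin y) \<le> B * norm (x - y)"
  by (rule low_lipschitz[OF smooth_bdd_F_spin]) (auto simp: F_spin_def chi_proj spin_def inner_proj_e intro: that)

lemma F_rad_lipschitz:
  obtains B where "0 \<le> B" "\<And>x. norm (F_rad x) \<le> B" "\<And>x y. norm (F_rad x - F_rad y) \<le> B * norm (x - y)"
  by (rule low_lipschitz[OF smooth_bdd_F_rad]) (auto simp: F_rad_def chi_proj rsq_proj proj_proj intro: that)

lemma F_coup_lipschitz:
  obtains B where "0 \<le> B" "\<And>x. norm (F_coup x) \<le> B" "\<And>x y. norm (F_coup x - F_coup y) \<le> B * norm (x - y)"
  by (rule cut_lipschitz[OF smooth_bdd_F_coup]) (auto simp: F_coup_def intro: that)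

lemma F_main_bounded:
  obtains B where "0 \<le> B" "\<And>x. norm (F_main m x) \<le> B"
  by (rule cut_lipschitz[OF smooth_bdd_F_main]) (auto simp: F_main_def intro: that)

lemma nonlin_bounded:
  obtains B where "\<And>u. norm (nonlin m \<omega> \<epsilon> b u) \<le> B"
proof -
  obtain B1 where 1: "\<And>x. norm (F_low x) \<le> B1" by (rule F_low_lipschitz) (rule that, assumption)
  obtain B2 where 2: "\<And>x. norm (F_main m x) \<le> B2" by (rule F_main_bounded[of m]) (rule that, assumption)
  obtain B3 where 3: "\<And>x. norm (F_spin x) \<le> B3" by (rule F_spin_lipschitz) (rule that, assumption)
  obtain B4 where 4: "\<And>x. norm (F_rad x) \<le> B4" by (rule F_rad_lipschitz) (rule that, assumption)
  obtain B5 where 5: "\<And>x. norm (F_coup x) \<le> B5" by (rule F_coup_lipschitz) (rule that, assumption)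
  have "norm (nonlin m \<omega> \<epsilon> b u) \<le> (B1 + B2) + (\<bar>\<omega>\<bar> * B3 + \<bar>\<epsilon>\<bar> * B4 + \<bar>b\<bar> * B5)" for u
    unfolding nonlin_def using 1[of u] 2[of u] 3[of u] 4[of u] 5[of u]
    by (intro norm_triangle_mono) (auto simp: mult_left_mono)
  then show ?thesis by (rule that)
qed

section \<open>Derivatives of the cutoffs\<close>

lemma rsq_deriv: "(rsq has_derivative (\<lambda>h. 2 * inner (proj 2 u) h)) (at u)"
  unfolding rsq_def[abs_def]
  by (auto intro!: derivative_eq_intros simp: proj_2 inner_add_left inner_commute algebra_simps)

lemma rsq_deriv_bound: "\<bar>2 * inner (proj 2 u) h\<bar> \<le> 2 * sqrt (rsq u) * norm h"
  using Cauchy_Schwarz_ineq2[of "proj 2 u" h] by (simp add: abs_mult rsq_eq)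

lemma dev_deriv: "(dev has_derivative (\<lambda>h. - 2 * (1 - rsq u) * (2 * inner (proj 2 u) h) + 2 * inner (u - proj 2 u) h)) (at u)"
  unfolding dev_def[abs_def]
  by (auto intro!: derivative_eq_intros rsq_deriv simp: inner_diff_left inner_commute algebra_simps)

lemma dev_deriv_bound:
  assumes "dev u \<le> s1\<^sup>2"
  shows "\<bar>- 2 * (1 - rsq u) * (2 * inner (proj 2 u) h) + 2 * inner (u - proj 2 u) h\<bar> \<le> 8 * sqrt (dev u) * norm h"
proof -
  have "sqrt (rsq u) \<le> 3 / 2"
    using rsq_bounds[OF assms] by (intro real_le_lsqrt) (auto simp: power2_eq_square)
  then have "2 * sqrt (rsq u) * norm h \<le> 3 * norm h" by (intro mult_right_mono) auto
  then have 1: "\<bar>2 * inner (proj 2 u) h\<bar> \<le> 3 * norm h" using rsq_deriv_bound[of u h] by linarith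
  have "\<bar>- 2 * (1 - rsq u) * (2 * inner (proj 2 u) h)\<bar> = 2 * (\<bar>1 - rsq u\<bar> * \<bar>2 * inner (proj 2 u) h\<bar>)"
    unfolding abs_mult by simp
  also have "\<dots> \<le> 2 * (sqrt (dev u) * (3 * norm h))"
    using abs_rsq_le_dev[of u] 1 by (intro mult_left_mono mult_mono) (auto simp: dev_nonneg)
  finally have 2: "\<bar>- 2 * (1 - rsq u) * (2 * inner (proj 2 u) h)\<bar> \<le> 6 * (sqrt (dev u) * norm h)" by simp
  have "\<bar>inner (u - proj 2 u) h\<bar> \<le> norm (u - proj 2 u) * norm h" by (rule Cauchy_Schwarz_ineq2)
  also have "\<dots> \<le> sqrt (dev u) * norm h" using tail_le_dev by (intro mult_right_mono) auto
  finally show ?thesis using 2 by (simp add: mult.assoc)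
qed

lemma smooth_bdd_differentiable:
  assumes "smooth_bdd f"
  obtains f' where "(f has_derivative f') (at x)"
  using smooth_bdd_has_derivative[OF assms] by metis

lemma phase_eq: "1 / 4 \<le> rsq u \<Longrightarrow> phase u = inner u (e 1) * rsq u powr (- 1 / 2)"
  by (simp add: phase_def psi_eq)

lemma powr_minus_half: "0 < x \<Longrightarrow> x powr - (1 / 2) = 1 / sqrt x"
  by (simp add: powr_minus_divide powr_half_sqrt)

text \<open>The sine of the angle is homogeneous of degree 0, so its derivative is of order 1/r:
  each of the two terms is at most |h| / r, and r^2 \<ge> 1/2 gives r \<ge> 2/3.\<close>

lemma phase_deriv:
  assumes "1 / 2 \<le> rsq u"
  obtains T where "(phase has_derivative T) (at u)" "\<And>h. \<bar>T h\<bar> \<le> 3 * norm h"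
proof -
  let ?r = "sqrt (rsq u)"
  have r: "0 < rsq u" "0 < ?r" using assms by auto
  let ?T = "\<lambda>h. inner u (e 1) * ((2 * inner (proj 2 u) h) * (- 1 / 2 * rsq u powr (- 1 / 2 - 1))) + inner h (e 1) * rsq u powr (- 1 / 2)"
  have "((\<lambda>u. rsq u powr (- 1 / 2)) has_derivative (\<lambda>h. (2 * inner (proj 2 u) h) * (- 1 / 2 * rsq u powr (- 1 / 2 - 1)))) (at u)"
  proof -
    have "((\<lambda>x. x powr (- 1 / 2)) has_derivative (\<lambda>h. h * (- 1 / 2 * rsq u powr (- 1 / 2 - 1)))) (at (rsq u))"
      using has_real_derivative_powr[OF r(1), of "- 1 / 2"] unfolding has_field_derivative_def
      by (rule has_derivative_eq_rhs) (auto simp: fun_eq_iff)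
    from has_derivative_compose[OF rsq_deriv this] show ?thesis .
  qed
  then have "((\<lambda>u. inner u (e 1) * rsq u powr (- 1 / 2)) has_derivative ?T) (at u)"
    by (intro has_derivative_mult[of "\<lambda>u. inner u (e 1)" "\<lambda>h. inner h (e 1)"])
      (auto intro!: bounded_linear_imp_has_derivative bounded_linear_inner_left)
  then have "(phase has_derivative ?T) (at u)"
  proof (rule has_derivative_transform_within_open)
    have "continuous_on UNIV rsq" unfolding rsq_def[abs_def] by (intro continuous_intros)
    then show "open {v. 1 / 4 < rsq v}" by (intro open_Collect_less continuous_intros) (auto simp: eta_contract_eq)
    show "u \<in> {v. 1 / 4 < rsq v}" using assms by simp
  qed (simp add: phase_eq)
  moreover have "\<bar>?T h\<bar> \<le> 3 * norm h" for h
  proof -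
    have y: "\<bar>inner u (e 1)\<bar> \<le> ?r" by (rule real_le_rsqrt) (simp add: rsq_def)
    have "rsq u powr (- 1 / 2 - 1) = 1 / (?r * rsq u)"
      using r powr_diff[of "rsq u" "- 1 / 2" 1] by (simp add: powr_minus_half)
    then have "\<bar>inner u (e 1) * ((2 * inner (proj 2 u) h) * (- 1 / 2 * rsq u powr (- 1 / 2 - 1)))\<bar>
        = \<bar>inner u (e 1)\<bar> * \<bar>2 * inner (proj 2 u) h\<bar> / (2 * (?r * rsq u))"
      using r by (simp add: abs_mult)
    also have "\<dots> \<le> ?r * (2 * ?r * norm h) / (2 * (?r * rsq u))"
      using r y rsq_deriv_bound[of u h] by (intro divide_right_mono mult_mono) auto
    also have "\<dots> = norm h / ?r" using r by (simp add: field_simps)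
    finally have 1: "\<bar>inner u (e 1) * ((2 * inner (proj 2 u) h) * (- 1 / 2 * rsq u powr (- 1 / 2 - 1)))\<bar> \<le> norm h / ?r" .
    have "\<bar>inner h (e 1)\<bar> \<le> norm h" using Cauchy_Schwarz_ineq2[of h "e 1"] by simp
    then have 2: "\<bar>inner h (e 1) * rsq u powr (- 1 / 2)\<bar> \<le> norm h / ?r"
      using r by (simp add: powr_minus_half abs_mult divide_right_mono)
    have "(2 / 3)\<^sup>2 \<le> rsq u" using assms by (simp add: power2_eq_square)
    then have "2 / 3 \<le> ?r" by (rule real_le_rsqrt)
    then have "norm h / ?r \<le> norm h / (2 / 3)" using r by (intro divide_left_mono) auto
    also have "norm h / (2 / 3) = 3 / 2 * norm h" by simp
    finally have "norm h / ?r + norm h / ?r \<le> 3 * norm h" by linarith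
    with 1 2 show ?thesis by (intro order_trans[OF abs_triangle_ineq]) linarith
  qed
  ultimately show ?thesis by (rule that)
qed

text \<open>A bound is claimed near the circle only. Where \<open>rsq u < 1 / 2\<close> the factor
  \<open>cut\<close> vanishes in every use, and differentiability alone matters.\<close>

lemma sector_deriv:
  assumes "\<bar>\<sigma>\<bar> = 1"
  obtains T where "(sector a \<sigma> has_derivative T) (at u)" "\<And>h. 1 / 2 \<le> rsq u \<Longrightarrow> \<bar>T h\<bar> \<le> 3 * K / \<nu> * norm h"
proof (cases "1 / 2 \<le> rsq u")
  case True
  obtain T where T: "(phase has_derivative T) (at u)" "\<And>h. \<bar>T h\<bar> \<le> 3 * norm h"
    by (rule phase_deriv[OF True]) (rule that)
  obtain S' where S': "(smooth_step has_real_derivative S') (at ((1 / \<nu>) * (\<sigma> * phase u - 1) + a))" "\<bar>S'\<bar> \<le> K"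
    using step_deriv by blast
  have "((\<lambda>u. (1 / \<nu>) * (\<sigma> * phase u - 1) + a) has_derivative (\<lambda>h. (1 / \<nu>) * (\<sigma> * T h))) (at u)"
    using \<nu>(1) by (auto intro!: derivative_eq_intros T(1))
  from has_derivative_compose[OF this S'(1)[unfolded has_field_derivative_def]]
  have "(sector a \<sigma> has_derivative (\<lambda>h. S' * ((1 / \<nu>) * (\<sigma> * T h)))) (at u)"
    by (simp add: sector_def[abs_def])
  moreover have "\<bar>S' * ((1 / \<nu>) * (\<sigma> * T h))\<bar> \<le> 3 * K / \<nu> * norm h" for h
  proof -
    have "\<bar>S' * ((1 / \<nu>) * (\<sigma> * T h))\<bar> = \<bar>S'\<bar> * ((1 / \<nu>) * \<bar>T h\<bar>)" using \<nu>(1) assms by (simp add: abs_mult)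
    also have "\<dots> \<le> K * ((1 / \<nu>) * (3 * norm h))" using S'(2) T(2)[of h] \<nu>(1) K_pos by (intro mult_mono mult_left_mono) auto
    also have "\<dots> = 3 * K / \<nu> * norm h" by (simp only: divide_inverse mult_1_left mult_ac)
    finally show ?thesis .
  qed
  ultimately show ?thesis by (rule that)
next
  case False
  obtain T where "(sector a \<sigma> has_derivative T) (at u)" by (rule smooth_bdd_differentiable[OF smooth_bdd_sector])
  then show ?thesis using False that by blast
qed

text \<open>The first summand stems from \<open>cut\<close>, whose logarithmic profile trades the
  factor \<open>dev\<close> for \<kappa>; the second from a sector, with slope of order 1/\<nu>,
  times the radius \<open>s1\<close> of the support.\<close>

definition gate_slope :: real where "gate_slope = 8 * K * \<kappa> + 3 * K / \<nu> * s1"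

text \<open>The derivative may be large, but in \<open>F_main\<close> the gates multiply
  \<open>1 - rsq\<close> or an equalizer, both of order \<open>sqrt (dev u)\<close>. Only the
  derivative with this weight has to be small.\<close>

lemma gate_deriv:
  assumes "\<bar>\<sigma>\<bar> = 1"
  obtains T where "((\<lambda>u. cut u * sector 2 \<sigma> u) has_derivative T) (at u)"
    "\<And>h. \<bar>T h\<bar> * sqrt (dev u) \<le> gate_slope * norm h" "\<And>h. s1\<^sup>2 < dev u \<Longrightarrow> T h = 0"
proof -
  let ?d = "\<lambda>h. - 2 * (1 - rsq u) * (2 * inner (proj 2 u) h) + 2 * inner (u - proj 2 u) h"
  obtain T where T: "(sector 2 \<sigma> has_derivative T) (at u)" "\<And>h. 1 / 2 \<le> rsq u \<Longrightarrow> \<bar>T h\<bar> \<le> 3 * K / \<nu> * norm h"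
    by (rule sector_deriv[OF assms, of 2 u]) (rule that)
  have "(cut has_derivative (\<lambda>h. c' \<kappa> P (dev u) * ?d h)) (at u)"
    using has_derivative_compose[OF dev_deriv c'_deriv[OF P_pos dev_nonneg, unfolded has_field_derivative_def]]
    by (simp add: cut_def[abs_def])
  from has_derivative_mult[OF this T(1)]
  have "((\<lambda>u. cut u * sector 2 \<sigma> u) has_derivative (\<lambda>h. cut u * T h + c' \<kappa> P (dev u) * ?d h * sector 2 \<sigma> u)) (at u)" .
  moreover have zero: "cut u * T h + c' \<kappa> P (dev u) * ?d h * sector 2 \<sigma> u = 0" if "s1\<^sup>2 < dev u" for h
  proof -
    have "cut u = 0" using cut_nonzero[of u] that by auto
    moreover have "c' \<kappa> P (dev u) = 0" using c'_zero[OF P_pos \<kappa>(1), of "dev u"] P_s1 that by simp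
    ultimately show ?thesis by simp
  qed
  moreover have "\<bar>cut u * T h + c' \<kappa> P (dev u) * ?d h * sector 2 \<sigma> u\<bar> * sqrt (dev u) \<le> gate_slope * norm h" for h
  proof (cases "s1\<^sup>2 < dev u")
    case True
    then show ?thesis using zero[OF True, of h] K_pos \<kappa> s1 \<nu> by (simp add: gate_slope_def)
  next
    case False
    then have d: "dev u \<le> s1\<^sup>2" by simp
    let ?s = "sqrt (dev u)"
    have s: "0 \<le> ?s" "?s \<le> s1" "?s * ?s = dev u" using dev_nonneg[of u] dev_le_s1[OF d] by auto
    have "\<bar>cut u * T h\<bar> \<le> 1 * (3 * K / \<nu> * norm h)"
      unfolding abs_mult using cut_bounds[of u] T(2)[of h] rsq_bounds[OF d] by (intro mult_mono) auto
    then have 1: "\<bar>cut u * T h\<bar> * ?s \<le> (3 * K / \<nu> * norm h) * s1"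
      using s K_pos \<nu>(1) by (intro mult_mono) auto
    have "\<bar>?d h\<bar> * \<bar>sector 2 \<sigma> u\<bar> \<le> (8 * ?s * norm h) * 1"
      using sector_bounds[of 2 \<sigma> u] s by (intro mult_mono dev_deriv_bound[OF d]) auto
    then have "\<bar>c' \<kappa> P (dev u)\<bar> * (\<bar>?d h\<bar> * \<bar>sector 2 \<sigma> u\<bar>) * ?s \<le> \<bar>c' \<kappa> P (dev u)\<bar> * (8 * ?s * norm h) * ?s"
      using s by (intro mult_right_mono mult_left_mono) auto
    \<comment> \<open>One factor \<open>sqrt (dev u)\<close> comes from the gradient of
      \<open>dev\<close>, the other is the weight. Their product is exactly what the bound on
      \<open>c'\<close> absorbs.\<close>
    also have "\<dots> = 8 * (\<bar>c' \<kappa> P (dev u)\<bar> * dev u) * norm h" using s(3) by (simp add: algebra_simps)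
    also have "\<dots> \<le> 8 * (K * \<kappa>) * norm h"
    proof -
      have "\<bar>c' \<kappa> P (dev u)\<bar> * dev u \<le> \<bar>c' \<kappa> P (dev u)\<bar> * (P + dev u)" using P_pos by (intro mult_left_mono) auto
      also have "\<dots> \<le> K * \<kappa>" using P_pos dev_nonneg \<kappa> by (intro c'_bound) auto
      finally show ?thesis by (intro mult_right_mono mult_left_mono) auto
    qed
    finally have 2: "\<bar>c' \<kappa> P (dev u) * ?d h * sector 2 \<sigma> u\<bar> * ?s \<le> 8 * (K * \<kappa>) * norm h" by (simp add: abs_mult mult.assoc)
    have "\<bar>cut u * T h + c' \<kappa> P (dev u) * ?d h * sector 2 \<sigma> u\<bar> * ?s
       \<le> (\<bar>cut u * T h\<bar> + \<bar>c' \<kappa> P (dev u) * ?d h * sector 2 \<sigma> u\<bar>) * ?s"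
      using s by (intro mult_right_mono abs_triangle_ineq) auto
    also have "\<dots> \<le> (3 * K / \<nu> * norm h) * s1 + 8 * (K * \<kappa>) * norm h" using 1 2 by (simp only: distrib_right add_mono)
    finally show ?thesis by (simp add: gate_slope_def algebra_simps)
  qed
  ultimately show ?thesis by (intro that[of "\<lambda>h. cut u * T h + c' \<kappa> P (dev u) * ?d h * sector 2 \<sigma> u"]) auto
qed

text \<open>In the upper sector the sine exceeds 1 - 2 \<nu> and the radius differs from 1 by at
  most \<open>s1\<close>. So the second coordinate is within s1 + 4 \<nu> of 1, and the square of
  the first is at most 6 \<nu>.\<close>

lemma radial_close:
  assumes "cut u * sector 2 1 u \<noteq> 0" and \<tau>: "6 * \<nu> + (s1 + 4 * \<nu>)\<^sup>2 \<le> \<tau>\<^sup>2" "0 \<le> \<tau>"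
  shows "norm (proj 2 u - e 1) \<le> \<tau>"
proof -
  have d: "dev u \<le> s1\<^sup>2" using assms(1) cut_nonzero[of u] by auto
  note r = rsq_bounds[OF d]
  let ?r = "sqrt (rsq u)"
  let ?x = "inner u (e 0)" and ?y = "inner u (e 1)"
  have "0 < sector 2 1 u" using assms(1) sector_bounds(1)[of 2 1 u] by (cases "sector 2 1 u = 0") auto
  from sector_pos[OF this] have "1 - 2 * \<nu> < phase u" by simp
  also have "phase u = ?y / ?r" using r by (simp add: phase_eq powr_minus_half)
  finally have y: "(1 - 2 * \<nu>) * ?r \<le> ?y" using r by (simp add: field_simps)
  have "?r \<le> 3 / 2" using r by (intro real_le_lsqrt) (auto simp: power2_eq_square)
  then have rr: "?r * ?r = rsq u" "0 \<le> ?r" "?r \<le> 3 / 2" using r by auto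
  have y2: "?y \<le> ?r" by (rule real_le_rsqrt) (simp add: rsq_def)
  have "\<bar>1 - ?r\<bar> \<le> \<bar>1 - ?r\<bar> * (1 + ?r)" using rr mult_left_mono[of 1 "1 + ?r" "\<bar>1 - ?r\<bar>"] by simp
  also have "\<dots> = \<bar>(1 - ?r) * (1 + ?r)\<bar>" using rr by (simp add: abs_mult)
  also have "\<dots> = \<bar>1 - rsq u\<bar>" using rr(1) by (simp add: algebra_simps)
  also have "\<dots> \<le> s1" using abs_rsq_le_dev[of u] dev_le_s1[OF d] by linarith
  finally have r1: "\<bar>1 - ?r\<bar> \<le> s1" .
  have "2 * \<nu> * ?r \<le> 2 * \<nu> * (3 / 2)" using rr \<nu>(1) by (intro mult_left_mono) auto
  moreover have "?r - 2 * \<nu> * ?r \<le> ?y" using y by (simp only: left_diff_distrib mult_1_left)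
  ultimately have y1: "\<bar>?y - 1\<bar> \<le> s1 + 4 * \<nu>" using y2 r1 \<nu>(1) by linarith
  have "?x\<^sup>2 = rsq u - ?y\<^sup>2" by (simp add: rsq_def)
  also have "\<dots> \<le> rsq u - ((1 - 2 * \<nu>) * ?r)\<^sup>2"
    using y \<nu> rr by (intro diff_left_mono power_mono) auto
  also have "\<dots> = rsq u * (4 * \<nu> - 4 * \<nu>\<^sup>2)" using rr by (simp add: power_mult_distrib power2_eq_square algebra_simps)
  also have "\<dots> \<le> 3 / 2 * (4 * \<nu>)" using r \<nu> by (intro mult_mono) (auto simp: power2_eq_square)
  finally have x: "?x\<^sup>2 \<le> 6 * \<nu>" by simp
  have eq: "proj 2 u - e 1 = (\<Sum>n\<in>{0, 1}. (if n = 0 then ?x else ?y - 1) *\<^sub>R e n)"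
    by (simp add: proj_2 algebra_simps)
  have "(norm (proj 2 u - e 1))\<^sup>2 = ?x\<^sup>2 + (?y - 1)\<^sup>2"
    unfolding eq by (subst norm_sum_e) (simp_all add: L2_set_def)
  also have "\<dots> \<le> 6 * \<nu> + (s1 + 4 * \<nu>)\<^sup>2"
    using x y1 s1 \<nu> power_mono[OF y1, of 2] by simp
  also have "\<dots> \<le> \<tau>\<^sup>2" by fact
  finally show ?thesis using \<tau>(2) by (rule power2_le_imp_le)
qed

section \<open>The leading Lipschitz constant\<close>

text \<open>The diagonal part of the derivative of \<open>F_low + F_main m\<close>: cutoffs are
  frozen, and the rank-one map h -> <p, h> p with p = \<open>proj 2 u\<close> is replaced by its
  model with p = \<open>e 1\<close>.\<close>

definition low_mult :: "real \<Rightarrow> 'a \<Rightarrow> nat \<Rightarrow> real" where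
  "low_mult m u n = (if n = 0 then chi u * lam 0 else if n = 1 then chi u * lam 1 - cut u * sector 2 1 u * m
     else cut u * sector 2 1 u * on_chain (equalizer_coeff 0) n + cut u * sector 2 (- 1) u * on_chain (equalizer_coeff 1) n)"

text \<open>Mode 1 is decisive: an active gate subtracts at most \<open>lam 1 + G / 2\<close> from
  \<open>lam 1\<close>, leaving at least - G / 2. In higher modes the two equalizers never act
  together, so their coefficients do not add up.\<close>

lemma low_mult_bound:
  assumes m: "0 \<le> m" "m \<le> lam 1 + G / 2"
  shows "\<bar>low_mult m u n\<bar> \<le> max (lam 1) (G / 2)"
proof -
  define a where "a = cut u * sector 2 1 u"
  define b where "b = cut u * sector 2 (- 1) u"
  have a: "0 \<le> a" "a \<le> 1" and b: "0 \<le> b" "b \<le> 1"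
    using cut_bounds[of u] sector_bounds[of 2 1 u] sector_bounds[of 2 "- 1" u] by (auto simp: a_def b_def intro: mult_le_one)
  have ab: "a = 0 \<or> b = 0" using sectors_disjoint[of u] by (auto simp: a_def b_def)
  have lm: "low_mult m u n = (if n = 0 then chi u * lam 0 else if n = 1 then chi u * lam 1 - a * m
     else a * on_chain (equalizer_coeff 0) n + b * on_chain (equalizer_coeff 1) n)" for n
    by (simp add: low_mult_def a_def b_def)
  consider "n = 0" | "n = 1" | "n \<noteq> 0" "n \<noteq> 1" by blast
  then show ?thesis
  proof cases
    case 1
    have "chi u * lam 0 \<le> 1 * lam 1"
      using chi_bounds[of u] lam_pos[of 0] incseqD[OF lam_mono, of 0 1] by (intro mult_mono) auto
    then show ?thesis using 1 chi_bounds[of u] lam_pos[of 0] by (simp add: lm)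
  next
    case 2
    have up: "chi u * lam 1 \<le> 1 * lam 1" using chi_bounds[of u] lam_pos[of 1] by (intro mult_right_mono) auto
    have am: "0 \<le> a * m" "a * m \<le> 1 * m" using a m mult_right_mono[OF a(2) m(1)] by auto
    have "- (G / 2) \<le> chi u * lam 1 - a * m"
    proof (cases "a = 0")
      case True
      moreover have "0 \<le> chi u * lam 1" using chi_bounds[of u] lam_pos[of 1] by (intro mult_nonneg_nonneg) auto
      ultimately show ?thesis using G_pos by simp
    next
      case False
      \<comment> \<open>An active gate confines \<open>rsq u\<close> to at most 3/2, so
        \<open>m\<close> is subtracted from the full \<open>lam 1\<close>.\<close>
      then have "chi u = 1" using rsq_bounds[OF cut_nonzero, of u] by (intro chi_1) (auto simp: a_def)
      then show ?thesis using am m by simp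
    qed
    with up am have "chi u * lam 1 - a * m \<le> max (lam 1) (G / 2)" "- (chi u * lam 1 - a * m) \<le> max (lam 1) (G / 2)" by linarith+
    then show ?thesis using 2 by (simp add: lm abs_le_iff)
  next
    case 3
    have "\<bar>a * on_chain (equalizer_coeff 0) n\<bar> \<le> 1 * (G / 2)" "\<bar>b * on_chain (equalizer_coeff 1) n\<bar> \<le> 1 * (G / 2)"
      unfolding abs_mult[of a] abs_mult[of b] using a b
      by (intro mult_mono on_chain_equalizer_bound; simp)+
    with ab have "\<bar>a * on_chain (equalizer_coeff 0) n + b * on_chain (equalizer_coeff 1) n\<bar> \<le> G / 2"
      by auto
    then have "\<bar>a * on_chain (equalizer_coeff 0) n + b * on_chain (equalizer_coeff 1) n\<bar> \<le> max (lam 1) (G / 2)" by linarith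
    then show ?thesis using 3 by (simp only: lm if_False)
  qed
qed

lemma rank_one_close:
  fixes a b h :: 'a
  assumes "norm (a - b) \<le> \<tau>" "norm b = 1" "0 \<le> \<tau>" "\<tau> \<le> 1"
  shows "norm (inner a h *\<^sub>R a - inner b h *\<^sub>R b) \<le> 3 * \<tau> * norm h"
proof -
  have "inner a h *\<^sub>R a - inner b h *\<^sub>R b = inner a h *\<^sub>R (a - b) + inner (a - b) h *\<^sub>R b"
    by (simp add: inner_diff_left algebra_simps)
  then have "norm (inner a h *\<^sub>R a - inner b h *\<^sub>R b) \<le> \<bar>inner a h\<bar> * norm (a - b) + \<bar>inner (a - b) h\<bar>"
    using norm_triangle_ineq[of "inner a h *\<^sub>R (a - b)" "inner (a - b) h *\<^sub>R b"] assms(2) by simp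
  moreover have "norm a \<le> 2" using norm_triangle_ineq[of "a - b" b] assms by simp
  then have "\<bar>inner a h\<bar> \<le> 2 * norm h"
    using Cauchy_Schwarz_ineq2[of a h] mult_right_mono[of "norm a" 2 "norm h"] by simp
  then have "\<bar>inner a h\<bar> * norm (a - b) \<le> (2 * norm h) * \<tau>" using assms by (intro mult_mono) auto
  moreover have "\<bar>inner (a - b) h\<bar> \<le> \<tau> * norm h"
    using Cauchy_Schwarz_ineq2[of "a - b" h] mult_right_mono[OF assms(1) norm_ge_zero[of h]] by linarith
  ultimately show ?thesis by (simp add: algebra_simps)
qed

text \<open>In order of the summands: slope of \<open>chi\<close>; slope of the gates; replacement
  of the radial direction by \<open>e 1\<close>; the undifferentiated factor
  \<open>1 - rsq\<close>.\<close>

definition low_error :: "real \<Rightarrow> real \<Rightarrow> real" where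
  "low_error m \<tau> = 2 * lam 1 * K * \<kappa> + (m + G) * gate_slope + 3 * m * \<tau> + m * s1"

lemma F_low_main_lipschitz:
  assumes m: "0 \<le> m" "m \<le> lam 1 + G / 2"
    and \<tau>: "6 * \<nu> + (s1 + 4 * \<nu>)\<^sup>2 \<le> \<tau>\<^sup>2" "0 \<le> \<tau>" "\<tau> \<le> 1"
  shows "norm ((F_low u + F_main m u) - (F_low v + F_main m v)) \<le> (max (lam 1) (G / 2) + low_error m \<tau>) * norm (u - v)"
proof -
  let ?L = "max (lam 1) (G / 2) + low_error m \<tau>"
  have gs: "0 \<le> gate_slope" using K_pos \<kappa> \<nu> s1 by (simp add: gate_slope_def)
  have "\<exists>F'. ((\<lambda>u. F_low u + F_main m u) has_derivative F') (at u) \<and> (\<forall>h. norm (F' h) \<le> ?L * norm h)" for u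
  proof -
    let ?a = "cut u * sector 2 1 u" and ?b = "cut u * sector 2 (- 1) u" and ?p = "proj 2 u"
    let ?r = "\<lambda>h. 2 * inner ?p h"
    obtain S where S: "((\<lambda>u. cut u * sector 2 1 u) has_derivative S) (at u)"
      "\<And>h. \<bar>S h\<bar> * sqrt (dev u) \<le> gate_slope * norm h" "\<And>h. s1\<^sup>2 < dev u \<Longrightarrow> S h = 0"
      by (rule gate_deriv[of 1 u]) (auto intro: that)
    obtain T where T: "((\<lambda>u. cut u * sector 2 (- 1) u) has_derivative T) (at u)"
      "\<And>h. \<bar>T h\<bar> * sqrt (dev u) \<le> gate_slope * norm h" "\<And>h. s1\<^sup>2 < dev u \<Longrightarrow> T h = 0"
      by (rule gate_deriv[of "- 1" u]) (auto intro: that)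
    have chi': "(chi has_derivative (\<lambda>h. c' \<kappa> 2 (rsq u) * ?r h)) (at u)"
      using has_derivative_compose[OF rsq_deriv c'_deriv[of 2, OF _ rsq_nonneg, unfolded has_field_derivative_def]]
      by (simp add: chi_def[abs_def])
    have blA: "bounded_linear low_A"
      unfolding low_A_def by (intro bounded_linear_add bounded_linear_scaleR_const bounded_linear_const_mult bounded_linear_inner_left)
    define a where "a = cut u * sector 2 1 u"
    define b where "b = cut u * sector 2 (- 1) u"
    \<comment> \<open>\<open>X0\<close> is the diagonal part. \<open>X1\<close>, \<open>X2\<close>
      and \<open>X5\<close> contain the derivatives of cutoffs, \<open>X3\<close> compares the
      radial rank-one map with its model in direction \<open>e 1\<close>, and \<open>X4\<close>
      keeps the small factor \<open>1 - rsq u\<close>.\<close>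
    define X1 where "X1 h = (c' \<kappa> 2 (rsq u) * ?r h) *\<^sub>R low_A u" for h
    define X2 where "X2 h = (S h * (m / 2 * (1 - rsq u))) *\<^sub>R ?p" for h
    define X3 where "X3 h = - ((a * m) *\<^sub>R (inner ?p h *\<^sub>R ?p - inner (e 1) h *\<^sub>R e 1))" for h
    define X4 where "X4 h = (a * (m / 2 * (1 - rsq u))) *\<^sub>R proj 2 h" for h
    define X5 where "X5 h = S h *\<^sub>R equalizer 0 u + T h *\<^sub>R equalizer 1 u" for h
    define X0 where "X0 h = chi u *\<^sub>R low_A h - (a * m * inner h (e 1)) *\<^sub>R e 1 + (a *\<^sub>R equalizer 0 h + b *\<^sub>R equalizer 1 h)" for h
    have "((\<lambda>u. F_low u + F_main m u) has_derivative (\<lambda>h. (chi u *\<^sub>R low_A h + (c' \<kappa> 2 (rsq u) * ?r h) *\<^sub>R low_A u)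
       + (((?a * (m / 2 * (1 - rsq u))) *\<^sub>R proj 2 h + (?a * (m / 2 * (0 - ?r h)) + S h * (m / 2 * (1 - rsq u))) *\<^sub>R ?p)
       + (?a *\<^sub>R equalizer 0 h + S h *\<^sub>R equalizer 0 u) + (?b *\<^sub>R equalizer 1 h + T h *\<^sub>R equalizer 1 u)))) (at u)"
      unfolding F_low_def F_main_def
      by (intro has_derivative_add has_derivative_scaleR has_derivative_mult S(1) T(1) chi' has_derivative_mult_right
          has_derivative_diff has_derivative_const rsq_deriv bounded_linear_imp_has_derivative blA
          bounded_linear_proj bounded_linear_equalizer)
    moreover have "(chi u *\<^sub>R low_A h + (c' \<kappa> 2 (rsq u) * ?r h) *\<^sub>R low_A u)
       + (((?a * (m / 2 * (1 - rsq u))) *\<^sub>R proj 2 h + (?a * (m / 2 * (0 - ?r h)) + S h * (m / 2 * (1 - rsq u))) *\<^sub>R ?p)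
       + (?a *\<^sub>R equalizer 0 h + S h *\<^sub>R equalizer 0 u) + (?b *\<^sub>R equalizer 1 h + T h *\<^sub>R equalizer 1 u))
       = X0 h + (X1 h + X2 h + X3 h + X4 h + X5 h)" for h
      by (simp add: X0_def X1_def X2_def X3_def X4_def X5_def a_def b_def algebra_simps inner_commute)
    ultimately have der: "((\<lambda>u. F_low u + F_main m u) has_derivative (\<lambda>h. X0 h + (X1 h + X2 h + X3 h + X4 h + X5 h))) (at u)"
      by simp
    have "norm (X0 h + (X1 h + X2 h + X3 h + X4 h + X5 h)) \<le> ?L * norm h" for h
    proof -
      have a: "0 \<le> a" "a \<le> 1" using cut_bounds[of u] sector_bounds[of 2 1 u] by (auto simp: a_def intro: mult_le_one)
      have 0: "norm (X0 h) \<le> max (lam 1) (G / 2) * norm h"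
      proof (rule norm_le_coord)
        fix n
        have low: "on_chain (equalizer_coeff j) n = 0" if "n < 2" for j
          using on_chain_low[of n "equalizer_coeff j"] that by (simp add: equalizer_coeff_def)
        have "inner (X0 h) (e n) = low_mult m u n * inner h (e n)"
          using low by (auto simp: a_def b_def X0_def low_A_def low_mult_def inner_add_left inner_diff_left equalizer_coord inner_e algebra_simps less_2_cases_iff)
        then show "\<bar>inner (X0 h) (e n)\<bar> \<le> max (lam 1) (G / 2) * \<bar>inner h (e n)\<bar>"
          using low_mult_bound[OF m] by (simp add: abs_mult mult_right_mono)
      qed (use lam_pos[of 1] in auto)
      have 1: "norm (X1 h) \<le> 2 * lam 1 * K * \<kappa> * norm h"
      proof -
        have "norm (low_A u) \<le> lam 1 * norm ?p"
        proof (rule norm_le_coord)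
          fix n :: nat
          consider "n = 0" | "n = 1" | "\<not> n < 2" using less_2_cases[of n] by auto
          then show "\<bar>inner (low_A u) (e n)\<bar> \<le> lam 1 * \<bar>inner ?p (e n)\<bar>"
            using lam_pos[of 0] lam_pos[of 1] incseqD[OF lam_mono, of 0 1]
            by cases (auto simp: low_A_def inner_add_left inner_e inner_proj_e abs_mult intro!: mult_right_mono)
        qed (use lam_pos[of 1] in auto)
        then have lA: "norm (low_A u) \<le> lam 1 * sqrt (rsq u)" by (simp add: rsq_eq)
        have "norm (X1 h) = \<bar>c' \<kappa> 2 (rsq u)\<bar> * (\<bar>?r h\<bar> * norm (low_A u))" by (simp add: X1_def abs_mult)
        also have "\<dots> \<le> \<bar>c' \<kappa> 2 (rsq u)\<bar> * ((2 * sqrt (rsq u) * norm h) * (lam 1 * sqrt (rsq u)))"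
          by (intro mult_left_mono mult_mono rsq_deriv_bound lA) (auto simp: rsq_nonneg)
        also have "\<dots> = 2 * lam 1 * (\<bar>c' \<kappa> 2 (rsq u)\<bar> * (sqrt (rsq u) * sqrt (rsq u))) * norm h" by (simp only: mult_ac)
        also have "sqrt (rsq u) * sqrt (rsq u) = rsq u" using rsq_nonneg by simp
        also have "2 * lam 1 * (\<bar>c' \<kappa> 2 (rsq u)\<bar> * rsq u) * norm h \<le> 2 * lam 1 * (K * \<kappa>) * norm h"
        proof -
          have "\<bar>c' \<kappa> 2 (rsq u)\<bar> * rsq u \<le> \<bar>c' \<kappa> 2 (rsq u)\<bar> * (2 + rsq u)" by (intro mult_left_mono) auto
          also have "\<dots> \<le> K * \<kappa>" using rsq_nonneg \<kappa> by (intro c'_bound) auto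
          finally show ?thesis using lam_pos[of 1] by (intro mult_right_mono mult_left_mono) auto
        qed
        finally show ?thesis by (simp add: mult.assoc)
      qed
      have 2: "norm (X2 h) \<le> m * gate_slope * norm h"
      proof (cases "s1\<^sup>2 < dev u")
        case True
        then show ?thesis using S(3) gs m by (simp add: X2_def)
      next
        case False
        then have d: "dev u \<le> s1\<^sup>2" by simp
        have "norm ?p \<le> 2" using norm_if_dev_le[OF d] norm_proj_le[of 2 u] by linarith
        then have "(\<bar>S h\<bar> * \<bar>1 - rsq u\<bar>) * norm ?p \<le> (\<bar>S h\<bar> * sqrt (dev u)) * 2"
          by (intro mult_mono mult_left_mono abs_rsq_le_dev) (auto simp: dev_nonneg)
        also have "\<dots> \<le> (gate_slope * norm h) * 2" by (intro mult_right_mono S(2)) auto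
        finally have "m / 2 * ((\<bar>S h\<bar> * \<bar>1 - rsq u\<bar>) * norm ?p) \<le> m / 2 * ((gate_slope * norm h) * 2)"
          using m by (intro mult_left_mono) auto
        moreover have "norm (X2 h) = m / 2 * ((\<bar>S h\<bar> * \<bar>1 - rsq u\<bar>) * norm ?p)"
          using m by (simp add: X2_def abs_mult)
        ultimately show ?thesis by simp
      qed
      have 3: "norm (X3 h) \<le> 3 * m * \<tau> * norm h"
      proof (cases "a = 0")
        case True
        then show ?thesis using m \<tau> by (simp add: X3_def)
      next
        case False
        have "norm (inner ?p h *\<^sub>R ?p - inner (e 1) h *\<^sub>R e 1) \<le> 3 * \<tau> * norm h"
          by (rule rank_one_close[OF radial_close[OF False[unfolded a_def] \<tau>(1,2)] norm_e \<tau>(2,3)])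
        then have "(a * m) * norm (inner ?p h *\<^sub>R ?p - inner (e 1) h *\<^sub>R e 1) \<le> (1 * m) * (3 * \<tau> * norm h)"
          using a m by (intro mult_mono) auto
        then show ?thesis unfolding X3_def norm_minus_cancel norm_scaleR using a m by (simp add: abs_mult mult_ac)
      qed
      have 4: "norm (X4 h) \<le> m * s1 * norm h"
      proof (cases "a = 0")
        case True
        then show ?thesis using m s1 by (simp add: X4_def)
      next
        case False
        then have d: "dev u \<le> s1\<^sup>2" using cut_nonzero[of u] by (auto simp: a_def)
        have "a * (m / 2 * \<bar>1 - rsq u\<bar>) * norm (proj 2 h) \<le> 1 * (m * s1) * norm h"
          using a m s1 abs_rsq_le_dev[of u] dev_le_s1[OF d] by (intro mult_mono norm_proj_le) auto
        then show ?thesis using a m by (simp add: X4_def abs_mult)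
      qed
      have 5: "norm (X5 h) \<le> G * gate_slope * norm h"
      proof -
        have *: "norm (s *\<^sub>R equalizer j u) \<le> G / 2 * (gate_slope * norm h)" if "\<bar>s\<bar> * sqrt (dev u) \<le> gate_slope * norm h" for s j
        proof -
          have "norm (s *\<^sub>R equalizer j u) \<le> \<bar>s\<bar> * (G / 2 * sqrt (dev u))"
            unfolding norm_scaleR using tail_le_dev[of u] G_pos
            by (intro mult_left_mono order_trans[OF norm_equalizer_le]) auto
          also have "\<dots> = G / 2 * (\<bar>s\<bar> * sqrt (dev u))" by simp
          also have "\<dots> \<le> G / 2 * (gate_slope * norm h)" using that G_pos by (intro mult_left_mono) auto
          finally show ?thesis .
        qed
        have "norm (X5 h) \<le> G / 2 * (gate_slope * norm h) + G / 2 * (gate_slope * norm h)"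
          unfolding X5_def by (intro norm_triangle_mono * S(2) T(2))
        then show ?thesis by (simp add: mult_ac)
      qed
      have "norm (X1 h + X2 h + X3 h + X4 h + X5 h) \<le> 2 * lam 1 * K * \<kappa> * norm h + m * gate_slope * norm h
         + 3 * m * \<tau> * norm h + m * s1 * norm h + G * gate_slope * norm h"
        by (intro norm_triangle_mono 1 2 3 4 5)
      then have "norm (X0 h + (X1 h + X2 h + X3 h + X4 h + X5 h)) \<le> max (lam 1) (G / 2) * norm h + (2 * lam 1 * K * \<kappa> * norm h + m * gate_slope * norm h
         + 3 * m * \<tau> * norm h + m * s1 * norm h + G * gate_slope * norm h)"
        by (rule norm_triangle_mono[OF 0])
      then show ?thesis by (simp add: low_error_def algebra_simps)
    qed
    with der show ?thesis by blast
  qed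
  then have "\<forall>u. \<exists>F'. ((\<lambda>u. F_low u + F_main m u) has_derivative F') (at u) \<and> (\<forall>h. norm (F' h) \<le> ?L * norm h)" by (rule allI)
  from choice[OF this] obtain F' where F': "\<forall>u. ((\<lambda>u. F_low u + F_main m u) has_derivative F' u) (at u) \<and> (\<forall>h. norm (F' u h) \<le> ?L * norm h)"
    by (rule exE)
  show ?thesis
  proof (rule differentiable_bound[of UNIV "\<lambda>u. F_low u + F_main m u" F' ?L u v])
    show "onorm (F' x) \<le> ?L" for x
    proof (rule onorm_bound)
      show "0 \<le> ?L" using gs m \<tau> s1 K_pos \<kappa> lam_pos[of 1] G_pos by (simp add: low_error_def add_nonneg_nonneg le_max_iff_disj)
    qed (use F' in simp)
  qed (use F' in auto)
qed

section \<open>Dynamics on the clock\<close>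

text \<open>The logarithmic rate r' / r of the clock radius as long as
  \<open>chi u = 1\<close>.\<close>

definition radial :: "real \<Rightarrow> real \<Rightarrow> real \<Rightarrow> 'a \<Rightarrow> real" where
  "radial m \<epsilon> b u = cut u * sector 2 1 u * (m / 2 * (1 - rsq u)) + \<epsilon> * (chi u * (1 - rsq u))
     + b * (cut u * sector 1 1 u * (rsq u * inner u (e (N 1))))"

lemma zero_notin_chain: "0 \<notin> range N"
proof
  assume "0 \<in> range N"
  then obtain k where "N k = 0" by (metis imageE)
  then show False using N_ge_2[of k] N_0 by (cases k) auto
qed

lemma rotation_low: "j \<le> 1 \<Longrightarrow> n < 2 \<Longrightarrow> inner (rotation j u) (e n) = 0"
  using rotation_coord_other[OF _ zero_notin_chain, of j u] rotation_coord_N[of j u 0]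
  by (auto simp: less_2_cases_iff N_0 rotation_coeff_def)

lemma equalizer_low: "n < 2 \<Longrightarrow> inner (equalizer j u) (e n) = 0"
  using on_chain_low[of n "equalizer_coeff j"] by (simp add: equalizer_coord equalizer_coeff_def)

lemma e_N_low: "n < 2 \<Longrightarrow> 1 \<le> i \<Longrightarrow> inner (e (N i)) (e n) = 0"
  using N_ge_2[of i] by (simp add: inner_e)

lemma nonlin_coord_0:
  "inner (nonlin m \<omega> \<epsilon> b u) (e 0) = chi u * (lam 0 * inner u (e 0) - \<omega> * inner u (e 1)) + radial m \<epsilon> b u * inner u (e 0)"
  using N_ge_2[of 1]
  by (simp add: nonlin_def F_low_def F_main_def F_spin_def F_rad_def F_coup_def radial_def low_A_def spin_def
      inner_add_left inner_diff_left inner_proj_e inner_e rotation_low equalizer_low e_N_low[unfolded One_nat_def] algebra_simps)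

lemma nonlin_coord_1:
  "inner (nonlin m \<omega> \<epsilon> b u) (e 1) = chi u * (lam 1 * inner u (e 1) + \<omega> * inner u (e 0)) + radial m \<epsilon> b u * inner u (e 1)"
  using N_ge_2[of 1]
  by (simp add: nonlin_def F_low_def F_main_def F_spin_def F_rad_def F_coup_def radial_def low_A_def spin_def
      inner_add_left inner_diff_left inner_proj_e inner_e rotation_low equalizer_low e_N_low[unfolded One_nat_def] algebra_simps)

lemma nonlin_coord_N:
  assumes i: "1 \<le> i"
  shows "inner (nonlin m \<omega> \<epsilon> b u) (e (N i)) =
    (cut u * sector 2 1 u * equalizer_coeff 0 i + cut u * sector 2 (- 1) u * equalizer_coeff 1 i) * inner u (e (N i))
    + b * (cut u * sector 1 1 u * (rotation_coeff 0 i * inner u (e (N (partner 0 i))) + (if i = 1 then eta u else 0))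
       + cut u * sector 1 (- 1) u * (rotation_coeff 1 i * inner u (e (N (partner 1 i)))))"
proof -
  have *: "\<not> N i < 2" "N i \<noteq> 0" "N i \<noteq> 1" using N_ge_2[OF i] by auto
  show ?thesis
    using * by (simp add: nonlin_def F_low_def F_main_def F_spin_def F_rad_def F_coup_def low_A_def spin_def
      inner_add_left inner_diff_left inner_proj_e inner_e rotation_coord_N equalizer_coord algebra_simps)
qed

lemma nonlin_coord_other:
  assumes n: "2 \<le> n" "n \<notin> range N"
  shows "inner (nonlin m \<omega> \<epsilon> b u) (e n) = 0"
proof -
  have *: "\<not> n < 2" "n \<noteq> 0" "n \<noteq> 1" "N 1 \<noteq> n" using n by auto
  show ?thesis
    using * n(2) by (simp add: nonlin_def F_low_def F_main_def F_spin_def F_rad_def F_coup_def low_A_def spin_def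
      inner_add_left inner_diff_left inner_proj_e inner_e rotation_coord_other equalizer_coord on_chain_def)
qed

section \<open>Solutions with two occupied chain modes\<close>

text \<open>Polar coordinates in the clock plane plus two neighbouring chain modes. During one half
  turn the solutions of interest have this form, which leaves three scalar equations.\<close>

definition state :: "real \<Rightarrow> real \<Rightarrow> nat \<Rightarrow> real \<Rightarrow> real \<Rightarrow> 'a" where
  "state r \<theta> k p p' = (r * cos \<theta>) *\<^sub>R e 0 + (r * sin \<theta>) *\<^sub>R e 1 + p *\<^sub>R e (N k) + p' *\<^sub>R e (N (Suc k))"

context
  fixes r \<theta> p p' :: real and k :: nat
  assumes k: "1 \<le> k"
begin

lemma state_e0: "inner (state r \<theta> k p p') (e 0) = r * cos \<theta>"
  using N_ge_2[OF k] N_ge_2[of "Suc k"] by (simp add: state_def inner_add_left inner_e)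

lemma state_e1: "inner (state r \<theta> k p p') (e 1) = r * sin \<theta>"
  using N_ge_2[OF k] N_ge_2[of "Suc k"] by (simp add: state_def inner_add_left inner_e)

lemma state_N: "1 \<le> i \<Longrightarrow> inner (state r \<theta> k p p') (e (N i)) = (if i = k then p else if i = Suc k then p' else 0)"
  using N_ge_2[of i] by (auto simp: state_def inner_add_left inner_e)

lemma state_other: "2 \<le> n \<Longrightarrow> n \<notin> range N \<Longrightarrow> inner (state r \<theta> k p p') (e n) = 0"
  by (auto simp: state_def inner_add_left inner_e)

lemma rsq_state: "rsq (state r \<theta> k p p') = r\<^sup>2"
  unfolding rsq_def state_e0 state_e1 by (simp add: power_mult_distrib distrib_left[symmetric])

lemma state_decomp: "state r \<theta> k p p' = (\<Sum>n\<in>{0, 1, N k, N (Suc k)}.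
   (if n = 0 then r * cos \<theta> else if n = 1 then r * sin \<theta> else if n = N k then p else p') *\<^sub>R e n)"
  using N_ge_2[OF k] N_ge_2[of "Suc k"] by (simp add: state_def add.assoc)

lemma inner_state_self: "inner (state r \<theta> k p p') (state r \<theta> k p p') = r\<^sup>2 + p\<^sup>2 + p'\<^sup>2"
proof -
  have "inner (state r \<theta> k p p') (state r \<theta> k p p') = (norm (state r \<theta> k p p'))\<^sup>2" by (simp add: power2_norm_eq_inner)
  also have "\<dots> = (r * cos \<theta>)\<^sup>2 + (r * sin \<theta>)\<^sup>2 + p\<^sup>2 + p'\<^sup>2"
    unfolding state_decomp using N_ge_2[OF k] N_ge_2[of "Suc k"]
    by (subst norm_sum_e) (auto simp: L2_set_def sum_nonneg)
  also have "\<dots> = r\<^sup>2 + p\<^sup>2 + p'\<^sup>2" by (simp add: power_mult_distrib distrib_left[symmetric])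
  finally show ?thesis .
qed

lemma dev_state: "dev (state r \<theta> k p p') = (1 - r\<^sup>2)\<^sup>2 + (p\<^sup>2 + p'\<^sup>2)"
  by (simp add: dev_def rsq_state inner_state_self)

lemma norm_state: "norm (state r \<theta> k p p') = sqrt (r\<^sup>2 + p\<^sup>2 + p'\<^sup>2)"
  by (simp add: norm_eq_sqrt_inner inner_state_self)

lemma phase_state: "1 / 2 \<le> r \<Longrightarrow> phase (state r \<theta> k p p') = sin \<theta>"
proof -
  assume r: "1 / 2 \<le> r"
  then have "(1 / 2)\<^sup>2 \<le> r\<^sup>2" by (intro power_mono) auto
  then have "1 / 4 \<le> rsq (state r \<theta> k p p')" by (simp add: rsq_state power2_eq_square)
  then show ?thesis using r by (simp add: phase_eq rsq_state state_e1[unfolded One_nat_def] powr_minus_half)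
qed

lemma sector_state: "1 / 2 \<le> r \<Longrightarrow> sector a \<sigma> (state r \<theta> k p p') = smooth_step ((1 / \<nu>) * (\<sigma> * sin \<theta> - 1) + a)"
  by (simp add: sector_def phase_state)

lemma eta_state: "1 / 2 \<le> r \<Longrightarrow> eta (state r \<theta> k p p') = (1 / r\<^sup>2 - 1) / 2"
proof -
  assume r: "1 / 2 \<le> r"
  then have "(1 / 2)\<^sup>2 \<le> r\<^sup>2" by (intro power_mono) auto
  then have "1 / 4 \<le> rsq (state r \<theta> k p p')" by (simp add: rsq_state power2_eq_square)
  then show ?thesis by (simp add: eta_def psi_eq rsq_state)
qed

lemma sector_state_inactive: "1 / 2 \<le> r \<Longrightarrow> \<sigma> * sin \<theta> \<le> 0 \<Longrightarrow> a \<le> 2 \<Longrightarrow> sector a \<sigma> (state r \<theta> k p p') = 0"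
proof -
  assume r: "1 / 2 \<le> r" and s: "\<sigma> * sin \<theta> \<le> 0" and a: "a \<le> 2"
  have "8 \<le> 1 / \<nu>" using \<nu> by (simp add: field_simps)
  moreover have "(1 / \<nu>) * (\<sigma> * sin \<theta> - 1) \<le> (1 / \<nu>) * (- 1)" using s \<nu> by (intro mult_left_mono) auto
  ultimately have "(1 / \<nu>) * (\<sigma> * sin \<theta> - 1) + a \<le> 0" using a by simp
  then show ?thesis using r by (simp add: sector_state smooth_step_eq_0)
qed

end

text \<open>The bound on \<open>r\<close> gives \<open>chi = 1\<close>, so that \<open>A\<close> is
  cancelled in the clock plane and the angle advances at speed \<omega> exactly. What remains are
  the equations for the radius and the two chain modes, and the absence of forcing in all other
  modes.\<close>

lemma coord_solution_state:
  fixes r p p' :: "real \<Rightarrow> real"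
  assumes k: "1 \<le> k"
    and r: "\<And>t. t \<in> I \<Longrightarrow> (r has_real_derivative r t * radial m \<epsilon> b (state (r t) (\<theta>0 + \<omega> * t) k (p t) (p' t))) (at t within I)"
    and r2: "\<And>t. t \<in> I \<Longrightarrow> (r t)\<^sup>2 \<le> 2"
    and p: "\<And>t. t \<in> I \<Longrightarrow> (p has_real_derivative
       inner (nonlin m \<omega> \<epsilon> b (state (r t) (\<theta>0 + \<omega> * t) k (p t) (p' t))) (e (N k)) - mu k * p t) (at t within I)"
    and p': "\<And>t. t \<in> I \<Longrightarrow> (p' has_real_derivative
       inner (nonlin m \<omega> \<epsilon> b (state (r t) (\<theta>0 + \<omega> * t) k (p t) (p' t))) (e (N (Suc k))) - mu (Suc k) * p' t) (at t within I)"
    and others: "\<And>t i. t \<in> I \<Longrightarrow> 1 \<le> i \<Longrightarrow> i \<noteq> k \<Longrightarrow> i \<noteq> Suc k \<Longrightarrow>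
       inner (nonlin m \<omega> \<epsilon> b (state (r t) (\<theta>0 + \<omega> * t) k (p t) (p' t))) (e (N i)) = 0"
  shows "coord_solution (nonlin m \<omega> \<epsilon> b) I (\<lambda>t. state (r t) (\<theta>0 + \<omega> * t) k (p t) (p' t))"
  unfolding coord_solution_def
proof (intro conjI allI ballI)
  let ?u = "\<lambda>t. state (r t) (\<theta>0 + \<omega> * t) k (p t) (p' t)"
  have "continuous_on I r" by (rule DERIV_continuous_on, erule r)
  moreover have "continuous_on I p" by (rule DERIV_continuous_on, erule p)
  moreover have "continuous_on I p'" by (rule DERIV_continuous_on, erule p')
  ultimately show "continuous_on I ?u" unfolding state_def by (intro continuous_intros)
  fix n t assume t: "t \<in> I"
  have chi: "chi (?u t) = 1" using r2[OF t] by (intro chi_1) (simp add: rsq_state[OF k])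
  consider "n = 0" | "n = 1" | i where "1 \<le> i" "n = N i" | "2 \<le> n" "n \<notin> range N"
  proof -
    have "n = 0 \<or> n = 1 \<or> (\<exists>i\<ge>1. n = N i) \<or> 2 \<le> n \<and> n \<notin> range N"
    proof (cases "n \<in> range N")
      case True
      then obtain i where i: "n = N i" by blast
      then show ?thesis using N_0 by (cases i) auto
    qed auto
    then show thesis using that by blast
  qed
  then show "((\<lambda>s. inner (?u s) (e n)) has_real_derivative inner (nonlin m \<omega> \<epsilon> b (?u t)) (e n) - lam n * inner (?u t) (e n)) (at t within I)"
  proof cases
    case 1
    show ?thesis
      unfolding 1 nonlin_coord_0 chi state_e0[OF k] state_e1[OF k] using r[OF t]
      by (auto intro!: derivative_eq_intros simp: algebra_simps)
  next
    case 2
    show ?thesis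
      unfolding 2 nonlin_coord_1 chi state_e0[OF k] state_e1[OF k] using r[OF t]
      by (auto intro!: derivative_eq_intros simp: algebra_simps)
  next
    case 3
    consider "i = k" | "i = Suc k" | "i \<noteq> k" "i \<noteq> Suc k" by blast
    then show ?thesis
    proof cases
      case 1
      then show ?thesis using p[OF t] 3 by (simp add: state_N[OF k, unfolded One_nat_def] mu_def)
    next
      case 2
      then show ?thesis using p'[OF t] 3 by (simp add: state_N[OF k, unfolded One_nat_def] mu_def)
    next
      case i: 3
      then show ?thesis using others[OF t 3(1) i] 3 by (simp add: state_N[OF k, unfolded One_nat_def])
    qed
  next
    case 4
    then show ?thesis by (simp add: state_other[OF k] nonlin_coord_other)
  qed
qed

definition gate :: "real \<Rightarrow> real \<Rightarrow> real" where
  "gate a s = smooth_step ((1 / \<nu>) * (sin s - 1) + a)"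

lemma partner_off:
  assumes "j \<le> 1" "even (k + j)" "i \<noteq> k" "i \<noteq> Suc k"
  shows "partner j i \<noteq> k \<and> partner j i \<noteq> Suc k"
proof -
  have "partner j k = Suc k" "partner j (Suc k) = k" using assms(2) by (auto simp: partner_def)
  then show ?thesis using injD[OF partner_inj[OF assms(1)]] assms(3,4) by metis
qed

text \<open>An active rotation never reads chain index 0, whose basis vector
  \<open>e (N 0) = e 1\<close> belongs to the clock plane.\<close>

lemma partner_pos:
  assumes "j \<le> 1" "1 \<le> i" "\<not> i + j < 2"
  shows "1 \<le> partner j i"
proof (cases "even (i + j)")
  case False
  have "2 \<le> i" using False assms by presburger
  then show ?thesis using False by (simp add: partner_def)
qed (simp add: partner_def)

text \<open>The parity \<open>j\<close> of \<open>k\<close> determines the sector passed in half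
  turn \<open>k\<close> and thereby the pairing that contains (k, k + 1). Smallness keeps
  \<open>cut = 1\<close>, and on the unit circle \<eta> = 0, so the equations for \<open>X\<close>
  and \<open>Y\<close> are linear.\<close>

lemma stage_solution:
  assumes k: "1 \<le> k" and j: "j \<le> 1" "even (k + j)" and \<sigma>: "\<sigma> = (if j = 0 then 1 else - 1)"
    and pos: "\<And>t. t \<in> I \<Longrightarrow> 0 \<le> sin (\<omega> * t)" and \<theta>: "\<And>t. sin (\<theta>0 + \<omega> * t) = \<sigma> * sin (\<omega> * t)"
    and X: "\<And>t. t \<in> I \<Longrightarrow> (X has_real_derivative
        - ((1 - gate 2 (\<omega> * t)) * mu k + gate 2 (\<omega> * t) * ((mu k + mu (Suc k)) / 2)) * X t - b * gate 1 (\<omega> * t) * Y t) (at t within I)"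
    and Y: "\<And>t. t \<in> I \<Longrightarrow> (Y has_real_derivative
        - ((1 - gate 2 (\<omega> * t)) * mu (Suc k) + gate 2 (\<omega> * t) * ((mu k + mu (Suc k)) / 2)) * Y t + b * gate 1 (\<omega> * t) * X t) (at t within I)"
    and small: "\<And>t. t \<in> I \<Longrightarrow> (X t)\<^sup>2 + (Y t)\<^sup>2 \<le> P"
  shows "coord_solution (nonlin m \<omega> \<epsilon> b) I (\<lambda>t. state 1 (\<theta>0 + \<omega> * t) k (X t) (Y t))"
proof (rule coord_solution_state[OF k])
  fix t assume t: "t \<in> I"
  let ?u = "state 1 (\<theta>0 + \<omega> * t) k (X t) (Y t)"
  have cut: "cut ?u = 1" using small[OF t] by (intro cut_1) (simp add: dev_state[OF k])
  have \<sigma>2: "\<sigma> * \<sigma> = 1" using \<sigma> by simp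
  have act: "sector a \<sigma> ?u = gate a (\<omega> * t)" for a
    using \<sigma>2 by (simp add: sector_state[OF k] \<theta> gate_def mult.assoc[symmetric])
  have inact: "sector a (- \<sigma>) ?u = 0" if "a \<le> 2" for a
    by (rule sector_state_inactive[OF k _ _ that]) (use \<sigma>2 pos[OF t] in \<open>auto simp: \<theta> mult.assoc[symmetric]\<close>)
  have rsq: "rsq ?u = 1" and eta: "eta ?u = 0" by (simp_all add: rsq_state[OF k] eta_state[OF k])
  \<comment> \<open>The radial reaction of \<open>F_coup\<close> must not push the solution off the
    circle. It acts in the upper sector only, where \<open>k\<close> is even; then k \<ge> 2 and the
    mode \<open>N 1\<close> is empty.\<close>
  have w1: "sector 1 1 ?u * inner ?u (e (N 1)) = 0"
  proof (cases "j = 0")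
    case True
    then have "k \<noteq> 1" using j(2) by auto
    then show ?thesis using state_N[OF k, of 1 1 "\<theta>0 + \<omega> * t" "X t" "Y t"] k by simp
  next
    case False
    then show ?thesis using inact[of 1] \<sigma> by simp
  qed
  then have "radial m \<epsilon> b ?u = 0" by (simp add: radial_def rsq mult.assoc)
  then show "((\<lambda>t. 1) has_real_derivative 1 * radial m \<epsilon> b ?u) (at t within I)" by simp
  show "1\<^sup>2 \<le> (2::real)" by simp
  have F: "inner (nonlin m \<omega> \<epsilon> b ?u) (e (N i)) = gate 2 (\<omega> * t) * equalizer_coeff j i * inner ?u (e (N i))
      + b * gate 1 (\<omega> * t) * (rotation_coeff j i * inner ?u (e (N (partner j i))))" if "1 \<le> i" for i
  proof (cases "j = 0")
    case True
    then show ?thesis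
      using act[of 1] act[of 2] inact[of 1] inact[of 2] \<sigma> unfolding nonlin_coord_N[OF that] cut eta by simp
  next
    case False
    then have "j = 1" using j(1) by simp
    then show ?thesis
      using act[of 1] act[of 2] inact[of 1] inact[of 2] \<sigma> unfolding nonlin_coord_N[OF that] cut eta by simp
  qed
  have kj: "2 \<le> k + j" using k j(2) by (cases "k + j = 1") auto
  have sX: "inner ?u (e (N k)) = X t" and sY: "inner ?u (e (N (Suc k))) = Y t"
    using state_N[OF k, of k] state_N[OF k, of "Suc k"] k by auto
  have pk: "partner j k = Suc k" "partner j (Suc k) = k" using j(2) by (auto simp: partner_def)
  have ck: "equalizer_coeff j k = - (mu (Suc k) - mu k) / 2" "rotation_coeff j k = - 1"
    using k j(2) kj by (auto simp: equalizer_coeff_def rotation_coeff_def)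
  have "inner (nonlin m \<omega> \<epsilon> b ?u) (e (N k)) - mu k * X t =
     - ((1 - gate 2 (\<omega> * t)) * mu k + gate 2 (\<omega> * t) * ((mu k + mu (Suc k)) / 2)) * X t - b * gate 1 (\<omega> * t) * Y t"
    unfolding F[OF k] pk sX sY ck by (simp add: field_simps)
  then show "(X has_real_derivative inner (nonlin m \<omega> \<epsilon> b ?u) (e (N k)) - mu k * X t) (at t within I)"
    using X[OF t] by simp
  have ck': "equalizer_coeff j (Suc k) = (mu (Suc k) - mu k) / 2" "rotation_coeff j (Suc k) = 1"
    using k j(2) kj by (auto simp: equalizer_coeff_def rotation_coeff_def)
  have Sk: "1 \<le> Suc k" by simp
  have "inner (nonlin m \<omega> \<epsilon> b ?u) (e (N (Suc k))) - mu (Suc k) * Y t =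
     - ((1 - gate 2 (\<omega> * t)) * mu (Suc k) + gate 2 (\<omega> * t) * ((mu k + mu (Suc k)) / 2)) * Y t + b * gate 1 (\<omega> * t) * X t"
    unfolding F[OF Sk] pk sX sY ck' by (simp add: field_simps)
  then show "(Y has_real_derivative inner (nonlin m \<omega> \<epsilon> b ?u) (e (N (Suc k))) - mu (Suc k) * Y t) (at t within I)"
    using Y[OF t] by simp
  fix i assume i: "1 \<le> i" "i \<noteq> k" "i \<noteq> Suc k"
  have "rotation_coeff j i * inner ?u (e (N (partner j i))) = 0"
  proof (cases "i + j < 2")
    case False
    have "1 \<le> partner j i" by (rule partner_pos[OF j(1) i(1) False])
    then show ?thesis using partner_off[OF j i(2,3)] state_N[OF k, of "partner j i" 1 "\<theta>0 + \<omega> * t" "X t" "Y t"] by simp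
  qed (simp add: rotation_coeff_def)
  moreover have "inner ?u (e (N i)) = 0" using state_N[OF k i(1)] i by simp
  ultimately show "inner (nonlin m \<omega> \<epsilon> b ?u) (e (N i)) = 0" unfolding F[OF i(1)] by simp
qed

text \<open>The map x -> 1 / sqrt(1 + 2 x) inverts the definition of \<eta>; thus a linear equation
  for \<eta> yields the logarithmic rate of the radius.\<close>

lemma radius_deriv:
  assumes "(X has_real_derivative X') (at t within I)" "0 \<le> X t"
  shows "((\<lambda>t. 1 / sqrt (1 + 2 * X t)) has_real_derivative 1 / sqrt (1 + 2 * X t) * (- (X' / (1 + 2 * X t)))) (at t within I)"
proof -
  have pos: "0 < 1 + 2 * X t" using assms(2) by simp
  let ?s = "sqrt (1 + 2 * X t)"
  have s: "0 < ?s" "?s * ?s = 1 + 2 * X t" using pos by auto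
  have "((\<lambda>t. 1 / sqrt (1 + 2 * X t)) has_real_derivative - (X' / ?s) / (?s * ?s)) (at t within I)"
    using pos s(1) assms(1) by (auto intro!: derivative_eq_intros simp: divide_simps)
  also have "- (X' / ?s) / (?s * ?s) = 1 / ?s * (- (X' / (1 + 2 * X t)))" unfolding s(2) by simp
  finally show ?thesis .
qed

lemma radius_bounds:
  assumes "0 \<le> x" "x \<le> 1 / 2"
  shows "1 / 2 \<le> 1 / sqrt (1 + 2 * x)" "(1 / sqrt (1 + 2 * x))\<^sup>2 = 1 / (1 + 2 * x)" "(1 / sqrt (1 + 2 * x))\<^sup>2 \<le> 1"
proof -
  have "sqrt (1 + 2 * x) \<le> 2" using assms by (intro real_le_lsqrt) auto
  then show "1 / 2 \<le> 1 / sqrt (1 + 2 * x)" using assms by (simp add: field_simps)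
  show eq: "(1 / sqrt (1 + 2 * x))\<^sup>2 = 1 / (1 + 2 * x)" using assms by (simp add: power_divide)
  show "(1 / sqrt (1 + 2 * x))\<^sup>2 \<le> 1" unfolding eq using assms by simp
qed

lemma dev_state_radius:
  assumes "0 \<le> x" "1 \<le> k"
  shows "dev (state (1 / sqrt (1 + 2 * x)) \<theta> k p p') = (2 * x / (1 + 2 * x))\<^sup>2 + (p\<^sup>2 + p'\<^sup>2)"
proof -
  have "1 - 1 / (1 + 2 * x) = 2 * x / (1 + 2 * x)" using assms(1) by (simp add: field_simps)
  then show ?thesis using assms by (simp add: dev_state power_divide)
qed

text \<open>Here \<open>X\<close> is \<eta>, and \<open>m\<close> completes its rate 2 \<epsilon> to
  the mean of \<open>mu 0\<close> and \<open>mu 1\<close>. The factor 4 in the smallness condition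
  comes from 1 - r^2 \<le> 2 X, whence \<open>dev\<close> is at most 4 X^2 + Y^2.\<close>

lemma first_stage_solution:
  assumes pos: "\<And>t. t \<in> I \<Longrightarrow> 0 \<le> sin (\<omega> * t)"
    and X: "\<And>t. t \<in> I \<Longrightarrow> (X has_real_derivative
        - ((1 - gate 2 (\<omega> * t)) * (2 * \<epsilon>) + gate 2 (\<omega> * t) * ((mu 0 + mu 1) / 2)) * X t - b * gate 1 (\<omega> * t) * Y t) (at t within I)"
    and Y: "\<And>t. t \<in> I \<Longrightarrow> (Y has_real_derivative
        - ((1 - gate 2 (\<omega> * t)) * mu 1 + gate 2 (\<omega> * t) * ((mu 0 + mu 1) / 2)) * Y t + b * gate 1 (\<omega> * t) * X t) (at t within I)"
    and small: "\<And>t. t \<in> I \<Longrightarrow> 0 \<le> X t \<and> 4 * ((X t)\<^sup>2 + (Y t)\<^sup>2) \<le> P"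
    and m: "m = (mu 0 + mu 1) / 2 - 2 * \<epsilon>"
  shows "coord_solution (nonlin m \<omega> \<epsilon> b) I (\<lambda>t. state (1 / sqrt (1 + 2 * X t)) (0 + \<omega> * t) 1 (Y t) 0)"
proof (rule coord_solution_state)
  fix t assume t: "t \<in> I"
  let ?r = "1 / sqrt (1 + 2 * X t)"
  define u where "u = state ?r (0 + \<omega> * t) 1 (Y t) 0"
  have P4: "P \<le> 1 / 4" using P_le by (simp add: power2_eq_square)
  have x: "0 \<le> X t" using small[OF t] by simp
  have "(X t)\<^sup>2 \<le> (1 / 2)\<^sup>2" using small[OF t] P4 by (simp add: power2_eq_square) (use zero_le_square[of "Y t"] zero_le_square[of "X t"] in linarith)
  then have x2: "X t \<le> 1 / 2" by (rule power2_le_imp_le) simp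
  note rb = radius_bounds[OF x x2]
  have q: "rsq u = 1 / (1 + 2 * X t)" by (simp only: u_def rsq_state[OF order_refl] rb(2))
  have pos1: "0 < 1 + 2 * X t" using x by simp
  define dq where "dq = (2 * X t / (1 + 2 * X t))\<^sup>2"
  have "dq \<le> (2 * X t)\<^sup>2" unfolding dq_def using x by (intro power_mono) (auto simp: field_simps)
  also have "\<dots> = 4 * (X t)\<^sup>2" by (simp add: power_mult_distrib)
  finally have dq: "dq \<le> 4 * (X t)\<^sup>2" .
  have "dev u = dq + (Y t)\<^sup>2"
    unfolding u_def dq_def by (simp only: dev_state_radius[OF x order_refl] power_zero_numeral add_0_right)
  also have "\<dots> \<le> 4 * ((X t)\<^sup>2 + (Y t)\<^sup>2)"
    unfolding distrib_left by (rule add_mono[OF dq]) simp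
  finally have "dev u \<le> P" using small[OF t] by (meson order_trans)
  then have cut: "cut u = 1" by (rule cut_1)
  have chi: "chi u = 1" using rb(2,3) q by (intro chi_1) linarith
  have act: "sector a 1 u = gate a (\<omega> * t)" for a
    unfolding u_def using sector_state[OF order_refl rb(1), of a 1] by (simp add: gate_def)
  have inact: "sector a (- 1) u = 0" if "a \<le> 2" for a
    unfolding u_def by (rule sector_state_inactive[OF order_refl rb(1) _ that]) (use pos[OF t] in simp)
  have eta: "eta u = X t"
    unfolding u_def eta_state[OF order_refl rb(1)] rb(2) using pos1 by simp
  have sY: "inner u (e (N 1)) = Y t" unfolding u_def using state_N[of 1 1] by simp
  have radial: "radial m \<epsilon> b u = ((2 * \<epsilon> + gate 2 (\<omega> * t) * m) * X t + b * gate 1 (\<omega> * t) * Y t) / (1 + 2 * X t)"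
  proof -
    have q': "1 - rsq u = 2 * X t / (1 + 2 * X t)" unfolding q using pos1 by (simp add: field_simps)
    show ?thesis unfolding radial_def cut act chi sY q' unfolding q by (simp add: add_divide_distrib algebra_simps)
  qed
  have "- ((1 - gate 2 (\<omega> * t)) * (2 * \<epsilon>) + gate 2 (\<omega> * t) * ((mu 0 + mu 1) / 2)) * X t - b * gate 1 (\<omega> * t) * Y t
    = - ((2 * \<epsilon> + gate 2 (\<omega> * t) * m) * X t + b * gate 1 (\<omega> * t) * Y t)"
    by (simp add: m algebra_simps)
  with radius_deriv[OF X[OF t] x]
  have "((\<lambda>t. 1 / sqrt (1 + 2 * X t)) has_real_derivative ?r * radial m \<epsilon> b u) (at t within I)"
    unfolding radial by (simp only: minus_divide_left minus_minus)
  then show "((\<lambda>t. 1 / sqrt (1 + 2 * X t)) has_real_derivative ?r * radial m \<epsilon> b (state ?r (0 + \<omega> * t) 1 (Y t) 0)) (at t within I)"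
    unfolding u_def .
  show "?r\<^sup>2 \<le> 2" using rb(3) by linarith
  have F: "inner (nonlin m \<omega> \<epsilon> b u) (e (N i)) = gate 2 (\<omega> * t) * equalizer_coeff 0 i * inner u (e (N i))
      + b * gate 1 (\<omega> * t) * (rotation_coeff 0 i * inner u (e (N (partner 0 i))) + (if i = 1 then X t else 0))" if "1 \<le> i" for i
    unfolding nonlin_coord_N[OF that] cut act eta using inact[of 1] inact[of 2] by simp
  have ck: "equalizer_coeff 0 1 = (mu 1 - mu 0) / 2" "rotation_coeff 0 1 = 0"
    by (auto simp: equalizer_coeff_def rotation_coeff_def)
  have "inner (nonlin m \<omega> \<epsilon> b u) (e (N 1)) - mu 1 * Y t =
     - ((1 - gate 2 (\<omega> * t)) * mu 1 + gate 2 (\<omega> * t) * ((mu 0 + mu 1) / 2)) * Y t + b * gate 1 (\<omega> * t) * X t"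
    unfolding F[OF order_refl] sY ck by (simp add: field_simps)
  then show "(Y has_real_derivative inner (nonlin m \<omega> \<epsilon> b (state ?r (0 + \<omega> * t) 1 (Y t) 0)) (e (N 1)) - mu 1 * Y t) (at t within I)"
    unfolding u_def[symmetric] using Y[OF t] by simp
  have off: "inner (nonlin m \<omega> \<epsilon> b u) (e (N i)) = 0" if i: "2 \<le> i" for i
  proof -
    have i1: "1 \<le> i" using i by simp
    have "partner 0 i \<noteq> 0 \<and> partner 0 i \<noteq> Suc 0" using partner_off[of 0 0 i] i by simp
    then have "inner u (e (N (partner 0 i))) = 0" unfolding u_def using state_N[of 1 "partner 0 i" ?r "0 + \<omega> * t" "Y t" 0] by simp
    moreover have "inner u (e (N i)) = 0" unfolding u_def using state_N[of 1 i ?r "0 + \<omega> * t" "Y t" 0] i by simp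
    ultimately show ?thesis unfolding F[OF i1] using i by simp
  qed
  show "((\<lambda>t. 0) has_real_derivative inner (nonlin m \<omega> \<epsilon> b (state ?r (0 + \<omega> * t) 1 (Y t) 0)) (e (N (Suc 1))) - mu (Suc 1) * 0) (at t within I)"
    unfolding u_def[symmetric] using off[of "Suc 1"] by simp
  show "inner (nonlin m \<omega> \<epsilon> b (state ?r (0 + \<omega> * t) 1 (Y t) 0)) (e (N i)) = 0" if "1 \<le> i" "i \<noteq> 1" "i \<noteq> Suc 1" for i
    unfolding u_def[symmetric] using off[of i] that by simp
qed simp

text \<open>Backwards in time \<eta> grows exponentially, yet the radius only shrinks. Either
  \<open>cut\<close> vanishes, or \<eta> \<le> 1/2, which by assumption restricts \<open>t\<close>
  to the last half turn, where sin(\<omega> t) \<le> 0 and the upper sector is off. The lower sector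
  meets only empty modes.\<close>

lemma past_solution:
  assumes \<omega>: "0 < \<omega>" and \<epsilon>: "0 < \<epsilon>" and \<rho>: "0 < \<rho>" "1 < 2 * (\<rho> * exp (2 * \<epsilon> * (pi / \<omega>)))"
  shows "coord_solution (nonlin m \<omega> \<epsilon> b) {..0} (\<lambda>t. state (1 / sqrt (1 + 2 * (\<rho> * exp (- 2 * \<epsilon> * t)))) (0 + \<omega> * t) 1 0 0)"
proof (rule coord_solution_state)
  fix t :: real assume t: "t \<in> {..0}"
  define X where "X t = \<rho> * exp (- 2 * \<epsilon> * t)" for t
  let ?r = "1 / sqrt (1 + 2 * X t)"
  define u where "u = state ?r (0 + \<omega> * t) 1 0 0"
  have x: "0 < X t" using \<rho>(1) by (simp add: X_def)
  have r2: "?r\<^sup>2 = 1 / (1 + 2 * X t)" using x by (simp add: power_divide)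
  have q: "rsq u = 1 / (1 + 2 * X t)" by (simp only: u_def rsq_state[OF order_refl] r2)
  have q1: "rsq u \<le> 1" unfolding q using x by simp
  have chi: "chi u = 1" using q1 by (intro chi_1) linarith
  have off: "cut u * sector a 1 u = 0" if "a \<le> 2" for a
  proof (cases "cut u = 0")
    case False
    from cut_nonzero[OF False] have d: "dev u \<le> s1\<^sup>2" .
    have "X t \<le> 1 / 2"
      using rsq_bounds[OF d] unfolding q using x by (simp add: field_simps)
    then have r: "1 / 2 \<le> ?r" using x by (intro radius_bounds) auto
    have "- (pi / \<omega>) \<le> t"
    proof (rule ccontr)
      assume "\<not> - (pi / \<omega>) \<le> t"
      then have "2 * \<epsilon> * (pi / \<omega>) \<le> - 2 * \<epsilon> * t" using \<epsilon> mult_left_mono[of "pi / \<omega>" "- t" "2 * \<epsilon>"] by simp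
      then have "\<rho> * exp (2 * \<epsilon> * (pi / \<omega>)) \<le> X t" unfolding X_def using \<rho>(1) by (intro mult_left_mono) auto
      with \<rho>(2) \<open>X t \<le> 1 / 2\<close> show False by linarith
    qed
    then have "- pi \<le> \<omega> * t" "\<omega> * t \<le> 0" using \<omega> t by (auto simp: field_simps mult_nonneg_nonpos)
    then have "sin (\<omega> * t) \<le> 0" using sin_ge_zero[of "- (\<omega> * t)"] by simp
    then have "sector a 1 u = 0" unfolding u_def by (intro sector_state_inactive[OF order_refl r _ that]) simp
    then show ?thesis by simp
  qed simp
  have off1: "cut u * sector 1 1 u = 0" by (rule off) simp
  have "radial m \<epsilon> b u = \<epsilon> * (1 - rsq u)" unfolding radial_def chi off[OF order_refl] off1 by simp
  also have "\<dots> = - ((- 2 * \<epsilon> * X t) / (1 + 2 * X t))" unfolding q using x by (simp add: field_simps)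
  finally have radial: "radial m \<epsilon> b u = - ((- 2 * \<epsilon> * X t) / (1 + 2 * X t))" .
  have "(X has_real_derivative - 2 * \<epsilon> * X t) (at t within {..0})"
    unfolding X_def[abs_def] by (auto intro!: derivative_eq_intros)
  from radius_deriv[OF this] x
  have "((\<lambda>t. 1 / sqrt (1 + 2 * X t)) has_real_derivative ?r * radial m \<epsilon> b u) (at t within {..0})"
    unfolding radial by simp
  then show "((\<lambda>t. 1 / sqrt (1 + 2 * (\<rho> * exp (- 2 * \<epsilon> * t)))) has_real_derivative
      1 / sqrt (1 + 2 * (\<rho> * exp (- 2 * \<epsilon> * t))) * radial m \<epsilon> b (state (1 / sqrt (1 + 2 * (\<rho> * exp (- 2 * \<epsilon> * t)))) (0 + \<omega> * t) 1 0 0)) (at t within {..0})"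
    by (simp only: u_def X_def)
  show "(1 / sqrt (1 + 2 * (\<rho> * exp (- 2 * \<epsilon> * t))))\<^sup>2 \<le> 2"
    using q1 unfolding q r2[symmetric] unfolding X_def by linarith
  have F: "inner (nonlin m \<omega> \<epsilon> b u) (e (N i)) = 0" if "1 \<le> i" for i
  proof -
    have z: "inner u (e (N i)) = 0" if "1 \<le> i" for i unfolding u_def using state_N[of 1 i ?r "0 + \<omega> * t" 0 0] that by simp
    have "rotation_coeff j i * inner u (e (N (partner j i))) = 0" if j: "j \<le> 1" for j
    proof (cases "i + j < 2")
      case False
      then show ?thesis using z partner_pos[OF j \<open>1 \<le> i\<close>] by simp
    qed (simp add: rotation_coeff_def)
    then have pr: "rotation_coeff 0 i * inner u (e (N (partner 0 i))) = 0" "rotation_coeff 1 i * inner u (e (N (partner 1 i))) = 0"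
      by blast+
    show ?thesis
      unfolding nonlin_coord_N[OF that] z[OF that] off1 pr by simp
  qed
  show "((\<lambda>t. 0) has_real_derivative inner (nonlin m \<omega> \<epsilon> b (state (1 / sqrt (1 + 2 * (\<rho> * exp (- 2 * \<epsilon> * t)))) (0 + \<omega> * t) 1 0 0)) (e (N 1)) - mu 1 * 0) (at t within {..0})"
    using F[of 1] by (simp add: u_def X_def)
  show "((\<lambda>t. 0) has_real_derivative inner (nonlin m \<omega> \<epsilon> b (state (1 / sqrt (1 + 2 * (\<rho> * exp (- 2 * \<epsilon> * t)))) (0 + \<omega> * t) 1 0 0)) (e (N (Suc 1))) - mu (Suc 1) * 0) (at t within {..0})"
    using F[of "Suc 1"] by (simp add: u_def X_def)
  show "inner (nonlin m \<omega> \<epsilon> b (state (1 / sqrt (1 + 2 * (\<rho> * exp (- 2 * \<epsilon> * t)))) (0 + \<omega> * t) 1 0 0)) (e (N i)) = 0"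
    if "1 \<le> i" "i \<noteq> 1" "i \<noteq> Suc 1" for i
    using F[of i] that by (simp add: u_def X_def)
qed simp

lemma periodic_solution:
  "coord_solution (nonlin m \<omega> \<epsilon> b) I (\<lambda>t. state 1 (0 + \<omega> * t) 1 0 0)"
proof (rule coord_solution_state)
  fix t assume t: "t \<in> I"
  define u where "u = state 1 (0 + \<omega> * t) 1 0 0"
  have rsq: "rsq u = 1" and eta: "eta u = 0" unfolding u_def using rsq_state[of 1 1] eta_state[of 1 1] by simp_all
  have z: "inner u (e (N i)) = 0" if "1 \<le> i" for i unfolding u_def using state_N[of 1 i 1 "0 + \<omega> * t" 0 0] that by simp
  have "radial m \<epsilon> b u = 0" using z[OF order_refl] unfolding radial_def rsq by (simp only: diff_self mult_zero_right add_0_right)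
  then show "((\<lambda>t. 1) has_real_derivative 1 * radial m \<epsilon> b (state 1 (0 + \<omega> * t) 1 0 0)) (at t within I)"
    unfolding u_def[symmetric] by simp
  have F: "inner (nonlin m \<omega> \<epsilon> b u) (e (N i)) = 0" if "1 \<le> i" for i
  proof -
    have "rotation_coeff j i * inner u (e (N (partner j i))) = 0" if j: "j \<le> 1" for j
    proof (cases "i + j < 2")
      case False
      then show ?thesis using z partner_pos[OF j \<open>1 \<le> i\<close>] by simp
    qed (simp add: rotation_coeff_def)
    then have "rotation_coeff 0 i * inner u (e (N (partner 0 i))) = 0" "rotation_coeff 1 i * inner u (e (N (partner 1 i))) = 0"
      by blast+
    then show ?thesis
      unfolding nonlin_coord_N[OF that] z[OF that] eta by (simp only: if_cancel add_0_right mult_zero_right)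
  qed
  show "((\<lambda>t. 0) has_real_derivative inner (nonlin m \<omega> \<epsilon> b (state 1 (0 + \<omega> * t) 1 0 0)) (e (N 1)) - mu 1 * 0) (at t within I)"
    unfolding u_def[symmetric] using F[of 1] by simp
  show "((\<lambda>t. 0) has_real_derivative inner (nonlin m \<omega> \<epsilon> b (state 1 (0 + \<omega> * t) 1 0 0)) (e (N (Suc 1))) - mu (Suc 1) * 0) (at t within I)"
    unfolding u_def[symmetric] using F[of "Suc 1"] by simp
  show "inner (nonlin m \<omega> \<epsilon> b (state 1 (0 + \<omega> * t) 1 0 0)) (e (N i)) = 0" if "1 \<le> i" for i
    unfolding u_def[symmetric] using F[OF that] .
qed simp_all

section \<open>Transfer of energy between neighbouring modes\<close>

text \<open>The accumulated rotation up to the angle \<open>s\<close>, not yet normalized;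
  \<open>turn pi\<close> is the total of a half turn.\<close>

definition turn :: "real \<Rightarrow> real" where "turn s = integral {0..s} (gate 1)"

lemma continuous_on_gate: "continuous_on S (gate a)"
  unfolding gate_def[abs_def] by (intro continuous_intros)

lemma gate_bounds: "0 \<le> gate a s" "gate a s \<le> 1"
  by (simp_all add: gate_def smooth_step_ge_0 smooth_step_le_1)

lemma gate_half: "gate 2 (pi / 2) = 1"
  by (simp add: gate_def smooth_step_eq_1)

lemma gate_1_zero: "sin s \<le> 1 - \<nu> \<Longrightarrow> gate 1 s = 0"
  using \<nu>(1) by (simp add: gate_def smooth_step_eq_0 field_simps)

lemma gate_2_not_1: "gate 2 s \<noteq> 1 \<Longrightarrow> sin s < 1 - \<nu>"
  using smooth_step_eq_1[of "(1 / \<nu>) * (sin s - 1) + 2"] \<nu>(1) unfolding gate_def by (force simp: field_simps)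

lemma turn_deriv: "s \<in> {0..pi} \<Longrightarrow> (turn has_real_derivative gate 1 s) (at s within {0..pi})"
  unfolding turn_def[abs_def] by (rule integral_has_real_derivative[OF continuous_on_gate])

lemma gate_integrable: "gate a integrable_on {x..y}"
  by (rule integrable_continuous_real[OF continuous_on_gate])

lemma turn_pi_pos: "0 < turn pi"
proof -
  have "0 \<le> turn pi" unfolding turn_def by (rule integral_nonneg[OF gate_integrable gate_bounds(1)])
  moreover have "turn pi \<noteq> 0"
  proof
    assume "turn pi = 0"
    then have "gate 1 (pi / 2) = 0"
      unfolding turn_def
      by (subst (asm) integral_eq_0_iff[OF continuous_on_gate]) (auto simp: gate_bounds dest!: bspec[of _ _ "pi / 2"])
    moreover have "0 < gate 1 (pi / 2)" by (simp add: gate_def smooth_step_pos)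
    ultimately show False by simp
  qed
  ultimately show ?thesis by simp
qed

lemma turn_0 [simp]: "turn 0 = 0"
  by (simp add: turn_def)

lemma turn_split: "0 \<le> s \<Longrightarrow> s \<le> pi \<Longrightarrow> turn s + integral {s..pi} (gate 1) = turn pi"
  unfolding turn_def by (rule Henstock_Kurzweil_Integration.integral_combine[OF _ _ gate_integrable])

lemma turn_bounds: "0 \<le> s \<Longrightarrow> s \<le> pi \<Longrightarrow> 0 \<le> turn s \<and> turn s \<le> turn pi"
  using turn_split[of s] integral_nonneg[OF gate_integrable gate_bounds(1), of s pi 1]
    integral_nonneg[OF gate_integrable gate_bounds(1), of 0 s 1] by (auto simp: turn_def)

text \<open>If the wide gate is not yet fully open at \<open>s\<close>, then sin s < 1 - \<nu>, and
  by monotonicity of the sine the narrow gate has been shut up to \<open>s\<close>.\<close>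

lemma turn_early:
  assumes "0 \<le> s" "s \<le> pi / 2" "gate 2 s \<noteq> 1"
  shows "turn s = 0"
proof -
  have "gate 1 x = 0" if "x \<in> {0..s}" for x
    using sin_monotone_2pi_le[of x s] that assms gate_2_not_1[of s] pi_gt_zero by (intro gate_1_zero) auto
  then have "integral {0..s} (gate 1) = integral {0..s} (\<lambda>_. 0)" by (rule integral_cong)
  then show ?thesis by (simp add: turn_def)
qed

lemma turn_late:
  assumes "pi / 2 \<le> s" "s \<le> pi" "gate 2 s \<noteq> 1"
  shows "turn s = turn pi"
proof -
  have "gate 1 x = 0" if "x \<in> {s..pi}" for x
    using sin_monotone_2pi_le[of "pi - x" "pi - s"] that assms gate_2_not_1[of s] by (intro gate_1_zero) auto
  then have "integral {s..pi} (gate 1) = integral {s..pi} (\<lambda>_. 0)" by (rule integral_cong)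
  then show ?thesis using turn_split[of s] assms pi_gt_zero by simp
qed

text \<open>The solution is explicit in polar form, \<rho> (cos \<Phi>, sin \<Phi>). \<Phi> moves
  only while the wide gate sets both rates to \<open>m\<close>; before that Y = 0 and afterwards X =
  0, so a single rate governs \<rho> at all times. The constant in \<open>b\<close> makes the total
  angle \<pi>/2.\<close>

lemma transfer_exists:
  assumes \<omega>: "0 < \<omega>" and b: "b = \<omega> * (pi / (2 * turn pi))"
    and lo: "lo \<le> \<mu>" "lo \<le> \<mu>'" "lo \<le> m" and \<rho>0: "0 \<le> \<rho>0"
  obtains X Y where
    "\<And>t. t \<in> {0..pi / \<omega>} \<Longrightarrow> (X has_real_derivative
        - ((1 - gate 2 (\<omega> * t)) * \<mu> + gate 2 (\<omega> * t) * m) * X t - b * gate 1 (\<omega> * t) * Y t) (at t within {0..pi / \<omega>})"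
    "\<And>t. t \<in> {0..pi / \<omega>} \<Longrightarrow> (Y has_real_derivative
        - ((1 - gate 2 (\<omega> * t)) * \<mu>' + gate 2 (\<omega> * t) * m) * Y t + b * gate 1 (\<omega> * t) * X t) (at t within {0..pi / \<omega>})"
    "X 0 = \<rho>0" "Y 0 = 0" "X (pi / \<omega>) = 0"
    "\<And>t. t \<in> {0..pi / \<omega>} \<Longrightarrow> 0 \<le> X t \<and> 0 \<le> Y t \<and> (X t)\<^sup>2 + (Y t)\<^sup>2 \<le> (\<rho>0 * exp (- lo * t))\<^sup>2"
proof -
  define T where "T = pi / \<omega>"
  have T: "0 < T" "\<omega> * T = pi" using \<omega> pi_gt_zero by (simp_all add: T_def)
  have s: "0 \<le> \<omega> * t" "\<omega> * t \<le> pi" if "t \<in> {0..T}" for t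
    using that \<omega> T(2) mult_left_mono[of t T \<omega>] by auto
  define \<beta> where "\<beta> = pi / (2 * turn pi)"
  define \<Phi> where "\<Phi> t = \<beta> * turn (\<omega> * t)" for t
  have \<beta>: "0 < \<beta>" "\<beta> * turn pi = pi / 2" using turn_pi_pos by (simp_all add: \<beta>_def)
  have \<Phi>_bounds: "0 \<le> \<Phi> t" "\<Phi> t \<le> pi / 2" if "t \<in> {0..T}" for t
  proof -
    note tb = turn_bounds[OF s[OF that]]
    show "0 \<le> \<Phi> t" using tb \<beta>(1) by (simp add: \<Phi>_def)
    have "\<beta> * turn (\<omega> * t) \<le> \<beta> * turn pi" using tb \<beta>(1) by (intro mult_left_mono) auto
    then show "\<Phi> t \<le> pi / 2" by (simp only: \<Phi>_def \<beta>(2))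
  qed
  have \<Phi>_deriv: "(\<Phi> has_real_derivative b * gate 1 (\<omega> * t)) (at t within {0..T})" if t: "t \<in> {0..T}" for t
  proof -
    have "(turn has_real_derivative gate 1 (\<omega> * t)) (at (\<omega> * t) within (\<lambda>t. \<omega> * t) ` {0..T})"
      by (rule has_field_derivative_subset[OF turn_deriv]) (use s t in auto)
    moreover have "((\<lambda>t. \<omega> * t) has_real_derivative \<omega>) (at t within {0..T})" by (auto intro!: derivative_eq_intros)
    ultimately have "((turn \<circ> (\<lambda>t. \<omega> * t)) has_real_derivative gate 1 (\<omega> * t) * \<omega>) (at t within {0..T})"
      by (rule DERIV_image_chain)
    from DERIV_cmult[OF this, of \<beta>] show ?thesis
      unfolding \<Phi>_def[abs_def] o_def b \<beta>_def by (simp add: mult_ac)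
  qed
  \<comment> \<open>The rate of the occupied mode: the first one up to the midpoint, the second one
    after it. Both formulas give \<open>m\<close> at the midpoint, where \<open>gate 2\<close> is
    1.\<close>
  define r where "r t = (if \<omega> * t \<le> pi / 2 then (1 - gate 2 (\<omega> * t)) * \<mu> + gate 2 (\<omega> * t) * m
     else (1 - gate 2 (\<omega> * t)) * \<mu>' + gate 2 (\<omega> * t) * m)" for t
  have cg: "continuous_on S (\<lambda>t. gate a (\<omega> * t))" for S a
    by (rule continuous_on_compose2[OF continuous_on_gate[of UNIV]]) (auto intro!: continuous_intros)
  have r_cont: "continuous_on {0..T} r"
    unfolding r_def
  proof (rule continuous_on_cases_le)
    fix t assume "\<omega> * t = pi / 2"
    then have "gate 2 (\<omega> * t) = 1" by (simp only: gate_half)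
    then show "(1 - gate 2 (\<omega> * t)) * \<mu> + gate 2 (\<omega> * t) * m = (1 - gate 2 (\<omega> * t)) * \<mu>' + gate 2 (\<omega> * t) * m" by simp
  qed (intro continuous_intros cg)+
  have conv: "lo \<le> (1 - g) * x + g * m" if "0 \<le> g" "g \<le> 1" "lo \<le> x" for g x
  proof -
    have "(1 - g) * lo + g * lo \<le> (1 - g) * x + g * m" using that lo by (intro add_mono mult_left_mono) auto
    then show ?thesis by (simp add: algebra_simps)
  qed
  have r_lo: "lo \<le> r t" for t
    unfolding r_def using conv[OF gate_bounds lo(1)] conv[OF gate_bounds lo(2)] by auto
  define R where "R t = integral {0..t} r" for t
  have R_deriv: "(R has_real_derivative r t) (at t within {0..T})" if "t \<in> {0..T}" for t
    unfolding R_def[abs_def] by (rule integral_has_real_derivative[OF r_cont that])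
  have R_lo: "lo * t \<le> R t" if "t \<in> {0..T}" for t
  proof -
    have "integral {0..t} (\<lambda>_. lo) \<le> integral {0..t} r"
      by (intro integral_le integrable_const_ivl integrable_continuous_real continuous_on_subset[OF r_cont] r_lo) (use that in auto)
    then show ?thesis using that by (simp add: R_def mult.commute)
  qed
  define \<rho> where "\<rho> t = \<rho>0 * exp (- R t)" for t
  have \<rho>: "0 \<le> \<rho> t" for t using \<rho>0 by (simp add: \<rho>_def)
  have \<rho>_le: "\<rho> t \<le> \<rho>0 * exp (- lo * t)" if "t \<in> {0..T}" for t
    using R_lo[OF that] \<rho>0 by (simp add: \<rho>_def mult_left_mono)
  have \<rho>_deriv: "(\<rho> has_real_derivative - r t * \<rho> t) (at t within {0..T})" if "t \<in> {0..T}" for t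
    unfolding \<rho>_def[abs_def] using R_deriv[OF that] by (auto intro!: derivative_eq_intros)
  have X_eq: "- r t * \<rho> t * cos (\<Phi> t) = - ((1 - gate 2 (\<omega> * t)) * \<mu> + gate 2 (\<omega> * t) * m) * (\<rho> t * cos (\<Phi> t))" if "t \<in> {0..T}" for t
  proof (cases "\<omega> * t \<le> pi / 2 \<or> gate 2 (\<omega> * t) = 1")
    case True
    then have "r t = (1 - gate 2 (\<omega> * t)) * \<mu> + gate 2 (\<omega> * t) * m" by (auto simp: r_def)
    then show ?thesis by simp
  next
    case False
    then have "turn (\<omega> * t) = turn pi" using s[OF that] by (intro turn_late) auto
    then have "cos (\<Phi> t) = 0" by (simp only: \<Phi>_def \<beta> cos_pi_half)
    then show ?thesis by simp
  qed
  have Y_eq: "- r t * \<rho> t * sin (\<Phi> t) = - ((1 - gate 2 (\<omega> * t)) * \<mu>' + gate 2 (\<omega> * t) * m) * (\<rho> t * sin (\<Phi> t))" if "t \<in> {0..T}" for t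
  proof (cases "pi / 2 < \<omega> * t \<or> gate 2 (\<omega> * t) = 1")
    case True
    then have "r t = (1 - gate 2 (\<omega> * t)) * \<mu>' + gate 2 (\<omega> * t) * m" by (auto simp: r_def)
    then show ?thesis by simp
  next
    case False
    then have "turn (\<omega> * t) = 0" using s[OF that] by (intro turn_early) auto
    then show ?thesis by (simp add: \<Phi>_def)
  qed
  show ?thesis
  proof (rule that[of "\<lambda>t. \<rho> t * cos (\<Phi> t)" "\<lambda>t. \<rho> t * sin (\<Phi> t)"], unfold T_def[symmetric])
    fix t assume t: "t \<in> {0..T}"
    have "((\<lambda>t. \<rho> t * cos (\<Phi> t)) has_real_derivative - r t * \<rho> t * cos (\<Phi> t) - b * gate 1 (\<omega> * t) * (\<rho> t * sin (\<Phi> t))) (at t within {0..T})"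
      using \<rho>_deriv[OF t] \<Phi>_deriv[OF t] by (auto intro!: derivative_eq_intros simp: algebra_simps)
    then show "((\<lambda>t. \<rho> t * cos (\<Phi> t)) has_real_derivative - ((1 - gate 2 (\<omega> * t)) * \<mu> + gate 2 (\<omega> * t) * m) * (\<rho> t * cos (\<Phi> t))
        - b * gate 1 (\<omega> * t) * (\<rho> t * sin (\<Phi> t))) (at t within {0..T})"
      unfolding X_eq[OF t] .
    have "((\<lambda>t. \<rho> t * sin (\<Phi> t)) has_real_derivative - r t * \<rho> t * sin (\<Phi> t) + b * gate 1 (\<omega> * t) * (\<rho> t * cos (\<Phi> t))) (at t within {0..T})"
      using \<rho>_deriv[OF t] \<Phi>_deriv[OF t] by (auto intro!: derivative_eq_intros simp: algebra_simps)
    then show "((\<lambda>t. \<rho> t * sin (\<Phi> t)) has_real_derivative - ((1 - gate 2 (\<omega> * t)) * \<mu>' + gate 2 (\<omega> * t) * m) * (\<rho> t * sin (\<Phi> t))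
        + b * gate 1 (\<omega> * t) * (\<rho> t * cos (\<Phi> t))) (at t within {0..T})"
      unfolding Y_eq[OF t] .
    have "(\<rho> t * cos (\<Phi> t))\<^sup>2 + (\<rho> t * sin (\<Phi> t))\<^sup>2 = (\<rho> t)\<^sup>2"
      by (simp add: power_mult_distrib distrib_left[symmetric])
    also have "\<dots> \<le> (\<rho>0 * exp (- lo * t))\<^sup>2" by (rule power_mono[OF \<rho>_le[OF t] \<rho>])
    finally show "0 \<le> \<rho> t * cos (\<Phi> t) \<and> 0 \<le> \<rho> t * sin (\<Phi> t) \<and> (\<rho> t * cos (\<Phi> t))\<^sup>2 + (\<rho> t * sin (\<Phi> t))\<^sup>2 \<le> (\<rho>0 * exp (- lo * t))\<^sup>2"
      using \<Phi>_bounds[OF t] \<rho>[of t] by (auto intro!: mult_nonneg_nonneg cos_ge_zero sin_ge_zero)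
  qed (simp_all add: \<Phi>_def \<rho>_def R_def T \<beta>)
qed

section \<open>Assembling the accumulating trajectory\<close>

lemma coord_solution_cong:
  assumes U: "coord_solution F I U" and eq: "\<And>t. t \<in> I \<Longrightarrow> V t = U t"
  shows "coord_solution F I V"
  unfolding coord_solution_def
proof (intro conjI allI ballI)
  have "continuous_on I U" using U unfolding coord_solution_def by blast
  then show "continuous_on I V" using eq by (simp cong: continuous_on_cong)
next
  fix n t assume t: "t \<in> I"
  have "((\<lambda>s. inner (U s) (e n)) has_real_derivative inner (F (U t)) (e n) - lam n * inner (U t) (e n)) (at t within I)"
    using U t unfolding coord_solution_def by blast
  then show "((\<lambda>s. inner (V s) (e n)) has_real_derivative inner (F (V t)) (e n) - lam n * inner (V t) (e n)) (at t within I)"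
    unfolding eq[OF t] by (rule has_field_derivative_transform_within[OF _ zero_less_one t]) (simp add: eq)
qed

lemma coord_solution_glue:
  assumes "coord_solution F {..0} u" "coord_solution F {0..} u"
  shows "coord_solution F UNIV u"
  unfolding coord_solution_def
proof (intro conjI allI ballI)
  have U: "(UNIV :: real set) = {..0} \<union> {0..}" by auto
  show "continuous_on UNIV u"
    unfolding U using assms by (intro continuous_on_closed_Un) (auto simp: coord_solution_def)
  fix n t
  let ?d = "inner (F (u t)) (e n) - lam n * inner (u t) (e n)"
  have l: "((\<lambda>s. inner (u s) (e n)) has_real_derivative ?d) (at t within {..0})" if "t \<le> 0"
    using assms(1) that by (simp add: coord_solution_def)
  have r: "((\<lambda>s. inner (u s) (e n)) has_real_derivative ?d) (at t within {0..})" if "0 \<le> t"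
    using assms(2) that by (simp add: coord_solution_def)
  consider "t < 0" | "0 < t" | "t = 0" by linarith
  then show "((\<lambda>s. inner (u s) (e n)) has_real_derivative ?d) (at t within UNIV)"
  proof cases
    case 1
    then show ?thesis using l at_within_interior[of t "{..0}"] by simp
  next
    case 2
    then show ?thesis using r at_within_interior[of t "{0..}"] by simp
  next
    case 3
    then have "t \<le> 0" "0 \<le> t" by simp_all
    from filterlim_sup[OF l[OF this(1), unfolded has_field_derivative_iff] r[OF this(2), unfolded has_field_derivative_iff]]
    have "((\<lambda>s. inner (u s) (e n)) has_real_derivative ?d) (at t within {..0} \<union> {0..})"
      unfolding has_field_derivative_iff unfolding at_within_union .
    then show ?thesis unfolding U[symmetric] .
  qed
qed

lemma state_shift: "state r \<theta> k 0 p = state r \<theta> (Suc k) p 0"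
  by (simp add: state_def)

lemma sin_stage: "sin (real k * pi + x) = (if even k then 1 else - 1) * sin x"
  by (simp add: sin_add cos_npi sin_npi)

text \<open>The explicit transfer starts at the same point as \<open>U\<close> and therefore
  coincides with it by uniqueness. All rates involved are at least \<open>mu k\<close>, and the
  stage ends with mode \<open>k\<close> empty.\<close>

lemma stage_step:
  assumes S: "semilinear e D A lam (nonlin m \<omega> \<epsilon> b) L CF" and \<omega>: "0 < \<omega>" and b: "b = \<omega> * (pi / (2 * turn pi))"
    and k: "1 \<le> k" and U: "coord_solution (nonlin m \<omega> \<epsilon> b) {0..} U"
    and start: "U (real k * (pi / \<omega>)) = state 1 (real k * pi) k \<rho> 0" and \<rho>: "0 \<le> \<rho>" "\<rho>\<^sup>2 \<le> P"
  obtains X Y where "\<And>t. t \<in> {0..pi / \<omega>} \<Longrightarrow> U (real k * (pi / \<omega>) + t) = state 1 (real k * pi + \<omega> * t) k (X t) (Y t)"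
    "\<And>t. t \<in> {0..pi / \<omega>} \<Longrightarrow> (X t)\<^sup>2 + (Y t)\<^sup>2 \<le> (\<rho> * exp (- mu k * t))\<^sup>2"
    "X (pi / \<omega>) = 0" "0 \<le> Y (pi / \<omega>)"
proof -
  interpret S: semilinear e D A lam "nonlin m \<omega> \<epsilon> b" L CF by (rule S)
  define T where "T = pi / \<omega>"
  have T: "0 < T" "\<omega> * T = pi" using \<omega> pi_gt_zero by (simp_all add: T_def)
  have s: "0 \<le> \<omega> * t" "\<omega> * t \<le> pi" if "t \<in> {0..T}" for t
    using that \<omega> T(2) mult_left_mono[of t T \<omega>] by auto
  define j where "j = k mod 2"
  define \<sigma> :: real where "\<sigma> = (if j = 0 then 1 else - 1)"
  have j: "j \<le> 1" "even (k + j)" unfolding j_def by presburger+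
  have \<sigma>: "sin (real k * pi + x) = \<sigma> * sin x" for x
    unfolding sin_stage \<sigma>_def j_def by (auto simp: even_iff_mod_2_eq_zero)
  have le: "mu k \<le> mu (Suc k)" using mu_Suc(1)[of k] gap_pos by linarith
  obtain X Y where XY: "\<And>t. t \<in> {0..T} \<Longrightarrow> (X has_real_derivative
        - ((1 - gate 2 (\<omega> * t)) * mu k + gate 2 (\<omega> * t) * ((mu k + mu (Suc k)) / 2)) * X t - b * gate 1 (\<omega> * t) * Y t) (at t within {0..T})"
    "\<And>t. t \<in> {0..T} \<Longrightarrow> (Y has_real_derivative
        - ((1 - gate 2 (\<omega> * t)) * mu (Suc k) + gate 2 (\<omega> * t) * ((mu k + mu (Suc k)) / 2)) * Y t + b * gate 1 (\<omega> * t) * X t) (at t within {0..T})"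
    "X 0 = \<rho>" "Y 0 = 0" "X T = 0"
    "\<And>t. t \<in> {0..T} \<Longrightarrow> 0 \<le> X t \<and> 0 \<le> Y t \<and> (X t)\<^sup>2 + (Y t)\<^sup>2 \<le> (\<rho> * exp (- mu k * t))\<^sup>2"
    by (rule transfer_exists[OF \<omega> b, of "mu k" "mu k" "mu (Suc k)" "(mu k + mu (Suc k)) / 2" \<rho>, folded T_def])
      (use le \<rho>(1) in \<open>auto intro: that\<close>)
  have small: "(X t)\<^sup>2 + (Y t)\<^sup>2 \<le> P" if t: "t \<in> {0..T}" for t
  proof -
    have "\<rho> * exp (- mu k * t) \<le> \<rho> * 1" using \<rho>(1) mu_pos[of k] t by (intro mult_left_mono) auto
    then have "(\<rho> * exp (- mu k * t))\<^sup>2 \<le> \<rho>\<^sup>2" using \<rho>(1) by (intro power_mono) auto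
    with XY(6)[OF t] \<rho>(2) show ?thesis by linarith
  qed
  have w: "coord_solution (nonlin m \<omega> \<epsilon> b) {0..T} (\<lambda>t. state 1 (real k * pi + \<omega> * t) k (X t) (Y t))"
    by (rule stage_solution[OF k j \<sigma>_def _ \<sigma> XY(1,2) small]) (use s in \<open>auto intro: sin_ge_zero\<close>)
  have v: "coord_solution (nonlin m \<omega> \<epsilon> b) {0..T} (\<lambda>t. U (real k * T + t))"
    by (rule coord_solution_shift[OF U]) (use T(1) in auto)
  have "U (real k * T + t) = state 1 (real k * pi + \<omega> * t) k (X t) (Y t)" if "t \<in> {0..T}" for t
    by (rule S.coord_solution_unique[OF v w that]) (simp add: start[folded T_def] XY)
  with XY(5,6) T(1) show ?thesis unfolding T_def[symmetric] by (intro that[of X Y]) (auto simp: T_def)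
qed

text \<open>\<open>V\<close> follows the explicit past up to time 0 and a forward solution
  afterwards. In half turn 0 the radial variable is emptied into mode 1, from then on mode
  \<open>k\<close> into mode k + 1; the rates available grow linearly with \<open>k\<close>.\<close>

lemma fast_solution:
  assumes S: "semilinear e D A lam (nonlin m \<omega> \<epsilon> b) L CF" and \<omega>: "0 < \<omega>" and b: "b = \<omega> * (pi / (2 * turn pi))"
    and \<epsilon>: "0 < \<epsilon>" and m: "m = (mu 0 + mu 1) / 2 - 2 * \<epsilon>"
    and far: "1 < 2 * (sqrt P / 2 * exp (2 * \<epsilon> * (pi / \<omega>)))"
  obtains V C \<kappa>' where "coord_solution (nonlin m \<omega> \<epsilon> b) UNIV V" "\<And>t. norm (V t) \<le> 2" "V 0 \<noteq> state 1 (0 + \<omega> * 0) 1 0 0"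
    "0 < C" "0 < \<kappa>'" "\<And>t. 0 \<le> t \<Longrightarrow> norm (state 1 (0 + \<omega> * t) 1 0 0 - V t) \<le> C * exp (- \<kappa>' * t\<^sup>2)"
proof -
  interpret S: semilinear e D A lam "nonlin m \<omega> \<epsilon> b" L CF by (rule S)
  let ?F = "nonlin m \<omega> \<epsilon> b"
  define T where "T = pi / \<omega>"
  have T: "0 < T" "\<omega> * T = pi" using \<omega> pi_gt_zero by (simp_all add: T_def)
  have s: "0 \<le> \<omega> * t" "\<omega> * t \<le> pi" if "t \<in> {0..T}" for t
    using that \<omega> T(2) mult_left_mono[of t T \<omega>] by auto
  \<comment> \<open>The first stage asks for 4 (X^2 + Y^2) \<le> P, hence half of
    \<open>sqrt P\<close>.\<close>
  define \<rho>0 where "\<rho>0 = sqrt P / 2"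
  have \<rho>0: "0 < \<rho>0" "4 * \<rho>0\<^sup>2 = P" using P_pos by (simp_all add: \<rho>0_def power_divide)
  note P4 = P_le
  define past where "past t = state (1 / sqrt (1 + 2 * (\<rho>0 * exp (- 2 * \<epsilon> * t)))) (0 + \<omega> * t) 1 0 0" for t
  have past: "coord_solution ?F {..0} past"
    unfolding past_def[abs_def] by (rule past_solution[OF \<omega> \<epsilon> \<rho>0(1)]) (use far in \<open>simp add: \<rho>0_def\<close>)
  obtain U where U: "coord_solution ?F {0..} U" "U 0 = past 0" by (rule S.coord_solution_exists)
  define V where "V t = (if t \<le> 0 then past t else U t)" for t
  have V_pos: "V t = U t" if "0 \<le> t" for t using that U(2) by (cases "t = 0") (auto simp: V_def)
  have VU: "coord_solution ?F UNIV V"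
  proof (rule coord_solution_glue)
    show "coord_solution ?F {..0} V" by (rule coord_solution_cong[OF past]) (simp add: V_def)
    show "coord_solution ?F {0..} V" by (rule coord_solution_cong[OF U(1)]) (simp add: V_pos)
  qed
  obtain X Y where XY: "\<And>t. t \<in> {0..T} \<Longrightarrow> (X has_real_derivative
        - ((1 - gate 2 (\<omega> * t)) * (2 * \<epsilon>) + gate 2 (\<omega> * t) * ((mu 0 + mu 1) / 2)) * X t - b * gate 1 (\<omega> * t) * Y t) (at t within {0..T})"
    "\<And>t. t \<in> {0..T} \<Longrightarrow> (Y has_real_derivative
        - ((1 - gate 2 (\<omega> * t)) * mu 1 + gate 2 (\<omega> * t) * ((mu 0 + mu 1) / 2)) * Y t + b * gate 1 (\<omega> * t) * X t) (at t within {0..T})"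
    "X 0 = \<rho>0" "Y 0 = 0" "X T = 0"
    "\<And>t. t \<in> {0..T} \<Longrightarrow> 0 \<le> X t \<and> 0 \<le> Y t \<and> (X t)\<^sup>2 + (Y t)\<^sup>2 \<le> (\<rho>0 * exp (- 0 * t))\<^sup>2"
    \<comment> \<open>The lower rate is set to 0: in the first half turn it is enough that the
      amplitude does not increase.\<close>
    by (rule transfer_exists[OF \<omega> b, of 0 "2 * \<epsilon>" "mu 1" "(mu 0 + mu 1) / 2" \<rho>0, folded T_def])
      (use \<epsilon> mu_pos[of 0] mu_pos[of 1] \<rho>0(1) in \<open>auto intro: that\<close>)
  have XY_sq: "(X t)\<^sup>2 + (Y t)\<^sup>2 \<le> \<rho>0\<^sup>2" if "t \<in> {0..T}" for t using XY(6)[OF that] by simp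
  have first: "coord_solution ?F {0..T} (\<lambda>t. state (1 / sqrt (1 + 2 * X t)) (0 + \<omega> * t) 1 (Y t) 0)"
  proof (rule first_stage_solution[OF _ XY(1,2) _ m])
    show "0 \<le> sin (\<omega> * t)" if "t \<in> {0..T}" for t using s[OF that] by (intro sin_ge_zero)
    show "0 \<le> X t \<and> 4 * ((X t)\<^sup>2 + (Y t)\<^sup>2) \<le> P" if "t \<in> {0..T}" for t
      using XY(6)[OF that] XY_sq[OF that] \<rho>0(2) by simp
  qed
  have U1: "U t = state (1 / sqrt (1 + 2 * X t)) (0 + \<omega> * t) 1 (Y t) 0" if t: "t \<in> {0..T}" for t
  proof (rule S.coord_solution_unique[OF coord_solution_subset[OF U(1)] first t])
    show "U 0 = state (1 / sqrt (1 + 2 * X 0)) (0 + \<omega> * 0) 1 (Y 0) 0" by (simp add: U(2) past_def XY)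
  qed auto
  \<comment> \<open>The product of the factors exp(- gap T i) over i < k, since half turn
    \<open>i\<close> has length \<open>T\<close> and rate at least \<open>i * gap\<close>; the sum
    of the \<open>i\<close> is k (k - 1) / 2.\<close>
  define E where "E k = \<rho>0 * exp (- (gap * T * (real k * (real k - 1) / 2)))" for k :: nat
  have E_pos: "0 < E k" for k using \<rho>0(1) by (simp add: E_def)
  have E_le: "E k \<le> \<rho>0" for k
  proof -
    have "0 \<le> real k * (real k - 1)" by (cases k) auto
    then have "0 \<le> gap * T * (real k * (real k - 1) / 2)" using gap_pos T(1) by simp
    then show ?thesis using \<rho>0(1) unfolding E_def by (intro mult_left_le) auto
  qed
  have E_sq: "x\<^sup>2 \<le> P" if "0 \<le> x" "x \<le> E k" for x k
  proof -
    have "x\<^sup>2 \<le> \<rho>0\<^sup>2" using that E_le[of k] by (intro power_mono) auto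
    then show ?thesis using \<rho>0(2) zero_le_power2[of \<rho>0] by linarith
  qed
  have E_Suc: "E k * exp (- (real k * gap) * T) = E (Suc k)" for k
  proof -
    have "- (gap * T * (real k * (real k - 1) / 2)) + - (real k * gap) * T = - (gap * T * (real (Suc k) * (real (Suc k) - 1) / 2))"
      by (simp add: field_simps)
    then show ?thesis unfolding E_def by (simp only: mult.assoc exp_add[symmetric])
  qed
  \<comment> \<open>At the end of half turn \<open>k\<close> only mode \<open>Suc k\<close> differs
    from the periodic orbit. The base case is the radial stage, the induction step a transfer along
    the chain.\<close>
  have iter: "\<exists>\<rho>. 0 \<le> \<rho> \<and> \<rho> \<le> E (Suc k) \<and> U (real (Suc k) * T) = state 1 (real (Suc k) * pi) (Suc k) \<rho> 0" for k
  proof (induction k)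
    case 0
    have TT: "T \<in> {0..T}" using T(1) by simp
    have "(Y T)\<^sup>2 \<le> \<rho>0\<^sup>2" using XY_sq[OF TT] XY(5) by simp
    then have "Y T \<le> \<rho>0" using \<rho>0(1) by (intro power2_le_imp_le[of "Y T"]) auto
    then show ?case using U1[OF TT] XY(5) XY(6)[OF TT] T(2) by (intro exI[of _ "Y T"]) (simp add: E_def)
  next
    case (Suc k)
    let ?k = "Suc k"
    obtain \<rho> where \<rho>: "0 \<le> \<rho>" "\<rho> \<le> E ?k" "U (real ?k * T) = state 1 (real ?k * pi) ?k \<rho> 0" using Suc.IH by blast
    have k1: "1 \<le> ?k" by simp
    obtain X Y where st: "\<And>t. t \<in> {0..T} \<Longrightarrow> U (real ?k * T + t) = state 1 (real ?k * pi + \<omega> * t) ?k (X t) (Y t)"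
      "\<And>t. t \<in> {0..T} \<Longrightarrow> (X t)\<^sup>2 + (Y t)\<^sup>2 \<le> (\<rho> * exp (- mu ?k * t))\<^sup>2" "X T = 0" "0 \<le> Y T"
      by (rule stage_step[OF S \<omega> b k1 U(1), folded T_def, OF \<rho>(3,1) E_sq[OF \<rho>(1,2)]]) (rule that)
    have TT: "T \<in> {0..T}" using T(1) by simp
    have "(Y T)\<^sup>2 \<le> (\<rho> * exp (- mu ?k * T))\<^sup>2" using st(2)[OF TT] st(3) by simp
    then have "Y T \<le> \<rho> * exp (- mu ?k * T)" using \<rho>(1) by (intro power2_le_imp_le[of "Y T"]) auto
    also have "\<dots> \<le> E ?k * exp (- (real ?k * gap) * T)"
    proof (rule mult_mono[OF \<rho>(2)])
      have "real ?k * gap * T \<le> mu ?k * T" using mu_ge[of ?k] T(1) by (intro mult_right_mono) auto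
      then show "exp (- mu ?k * T) \<le> exp (- (real ?k * gap) * T)" by simp
    qed (use E_pos[of ?k] in auto)
    also have "\<dots> = E (Suc ?k)" by (rule E_Suc)
    finally have YE: "Y T \<le> E (Suc ?k)" .
    have "real (Suc ?k) * T = real ?k * T + T" "real (Suc ?k) * pi = real ?k * pi + \<omega> * T"
      using T(2) by (simp_all add: algebra_simps)
    then have "U (real (Suc ?k) * T) = state 1 (real (Suc ?k) * pi) ?k 0 (Y T)"
      using st(1)[OF TT] st(3) by simp
    then show ?case using st(4) YE by (intro exI[of _ "Y T"]) (simp add: state_shift)
  qed
  have later: "\<exists>X Y. U (real k * T + t) = state 1 (\<omega> * (real k * T + t)) k X Y \<and> X\<^sup>2 + Y\<^sup>2 \<le> (E k)\<^sup>2"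
    if k: "1 \<le> k" and t: "t \<in> {0..T}" for k t
  proof -
    obtain k' where k': "k = Suc k'" using k by (cases k) auto
    obtain \<rho> where \<rho>: "0 \<le> \<rho>" "\<rho> \<le> E k" "U (real k * T) = state 1 (real k * pi) k \<rho> 0" using iter[of k'] k' by blast
    obtain X Y where st: "\<And>t. t \<in> {0..T} \<Longrightarrow> U (real k * T + t) = state 1 (real k * pi + \<omega> * t) k (X t) (Y t)"
      "\<And>t. t \<in> {0..T} \<Longrightarrow> (X t)\<^sup>2 + (Y t)\<^sup>2 \<le> (\<rho> * exp (- mu k * t))\<^sup>2"
      by (rule stage_step[OF S \<omega> b k U(1), folded T_def, OF \<rho>(3,1) E_sq[OF \<rho>(1,2)]]) (rule that)
    have "\<rho> * exp (- mu k * t) \<le> E k * 1" using \<rho>(1,2) mu_pos[of k] t E_pos[of k] by (intro mult_mono) auto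
    then have "(\<rho> * exp (- mu k * t))\<^sup>2 \<le> (E k)\<^sup>2" using \<rho>(1) by (intro power_mono) auto
    moreover have "real k * pi + \<omega> * t = \<omega> * (real k * T + t)" using T(2) by (simp add: algebra_simps)
    ultimately show ?thesis using st(1,2)[OF t] by (intro exI[of _ "X t"] exI[of _ "Y t"]) auto
  qed
  have split: "\<exists>k r. 1 \<le> k \<and> r \<in> {0..T} \<and> t = real k * T + r" if "T \<le> t" for t
  proof -
    define k where "k = nat \<lfloor>t / T\<rfloor>"
    have "1 \<le> t / T" using that T(1) by simp
    then have k: "1 \<le> k" "real k \<le> t / T" "t / T < real k + 1" unfolding k_def by linarith+
    then have "real k * T \<le> t" "t \<le> real k * T + T" using T(1) by (simp_all add: field_simps)
    with k(1) show ?thesis by (intro exI[of _ k] exI[of _ "t - real k * T"]) auto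
  qed
  have V_bound: "norm (V t) \<le> 2" for t
  proof -
    consider "t \<le> 0" | "t \<in> {0..T}" | "T \<le> t" by fastforce
    then show ?thesis
    proof cases
      case 1
      then have "norm (V t) = 1 / sqrt (1 + 2 * (\<rho>0 * exp (- 2 * \<epsilon> * t)))"
        using \<rho>0(1) by (simp add: V_def past_def norm_state del: One_nat_def)
      also have "\<dots> \<le> 1"
      proof -
        have "1 \<le> sqrt (1 + 2 * (\<rho>0 * exp (- 2 * \<epsilon> * t)))"
          using \<rho>0(1) by (intro real_le_rsqrt) simp
        then show ?thesis by (subst divide_le_eq_1) linarith
      qed
      finally show ?thesis by simp
    next
      case 2
      have x: "0 \<le> X t" using XY(6)[OF 2] by simp
      have "norm (V t) = sqrt ((1 / sqrt (1 + 2 * X t))\<^sup>2 + (Y t)\<^sup>2)"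
        using V_pos[of t] U1[OF 2] 2 by (simp add: norm_state del: One_nat_def)
      also have "\<dots> \<le> 2"
      proof (rule real_le_lsqrt)
        have "(1 / sqrt (1 + 2 * X t))\<^sup>2 \<le> 1" using x by (simp add: power_divide)
        moreover have "(Y t)\<^sup>2 \<le> P" using XY_sq[OF 2] \<rho>0(2) zero_le_power2[of "X t"] zero_le_power2[of \<rho>0] by linarith
        ultimately show "(1 / sqrt (1 + 2 * X t))\<^sup>2 + (Y t)\<^sup>2 \<le> 2\<^sup>2" using P4 by (simp add: power2_eq_square)
      qed simp
      finally show ?thesis .
    next
      case 3
      obtain k r where kr: "1 \<le> k" "r \<in> {0..T}" "t = real k * T + r" using split[OF 3] by blast
      obtain X' Y' where XY': "U t = state 1 (\<omega> * t) k X' Y'" "X'\<^sup>2 + Y'\<^sup>2 \<le> (E k)\<^sup>2" using later[OF kr(1,2)] kr(3) by blast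
      have "norm (V t) = sqrt (1 + X'\<^sup>2 + Y'\<^sup>2)"
        using V_pos[of t] 3 T(1) XY'(1) by (simp add: norm_state[OF kr(1)])
      also have "\<dots> \<le> 2"
        using XY'(2) E_sq[of "E k" k] E_pos[of k] P4 by (intro real_le_lsqrt) (auto simp: power2_eq_square)
      finally show ?thesis .
    qed
  qed
  \<comment> \<open>The exponent gap T k^2 / 2 with k about t / T would allow any rate below gap /
    (2 T); half of that absorbs the terms of lower order. The second summand of \<open>C\<close>
    covers the first half turn, where the norms 1 and 2 give the factor 3.\<close>
  define \<kappa>' where "\<kappa>' = gap / (4 * T)"
  define C where "C = \<rho>0 * exp (5 * gap * T / 4) + 3 * exp (gap * T / 4)"
  have \<kappa>': "0 < \<kappa>'" using gap_pos T(1) by (simp add: \<kappa>'_def)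
  have C: "0 < C" using \<rho>0(1) by (simp add: C_def add_pos_pos)
  have decay: "norm (state 1 (0 + \<omega> * t) 1 0 0 - V t) \<le> C * exp (- \<kappa>' * t\<^sup>2)" if t: "0 \<le> t" for t
  proof (cases "T \<le> t")
    case True
    obtain k r where kr: "1 \<le> k" "r \<in> {0..T}" "t = real k * T + r" using split[OF True] by blast
    obtain X' Y' where XY': "U t = state 1 (\<omega> * t) k X' Y'" "X'\<^sup>2 + Y'\<^sup>2 \<le> (E k)\<^sup>2" using later[OF kr(1,2)] kr(3) by blast
    have "V t - state 1 (0 + \<omega> * t) 1 0 0 = state 0 0 k X' Y'"
      using V_pos[OF t] XY'(1) by (simp add: state_def)
    then have "norm (state 1 (0 + \<omega> * t) 1 0 0 - V t) = sqrt (X'\<^sup>2 + Y'\<^sup>2)"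
      by (simp add: norm_minus_commute norm_state[OF kr(1)])
    also have "\<dots> \<le> E k" using XY'(2) E_pos[of k] by (intro real_le_lsqrt) auto
    also have "\<dots> \<le> \<rho>0 * exp (5 * gap * T / 4 - \<kappa>' * t\<^sup>2)"
    proof -
      \<comment> \<open>Time in units of half turns, so x - 1 \<le> k. For x > 2 the difference of
        (x - 1)(x - 2) and x^2 / 2 - 5 / 2 is (x - 3)^2 / 2; for x \<le> 2 the quantity x^2 / 2 - 5
        / 2 is negative. Multiplication by gap T / 2 produces the constant 5 gap T / 4.\<close>
      define x where "x = t / T"
      have tx: "t = x * T" using T(1) by (simp add: x_def)
      have kx: "x - 1 \<le> real k" "1 \<le> x" using kr T(1) True by (auto simp: x_def field_simps)
      have "x\<^sup>2 / 2 - 5 / 2 \<le> real k * (real k - 1)"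
      proof (cases "x \<le> 2")
        case True
        have "x\<^sup>2 \<le> 2\<^sup>2" using kx True by (intro power_mono) auto
        moreover have "0 \<le> real k * (real k - 1)" using kr(1) by (intro mult_nonneg_nonneg) auto
        ultimately show ?thesis by simp
      next
        case False
        have "(x - 1) * (x - 2) \<le> real k * (real k - 1)" using kx False by (intro mult_mono) auto
        moreover have "0 \<le> (x - 3)\<^sup>2" by simp
        ultimately show ?thesis by (simp add: power2_eq_square algebra_simps)
      qed
      then have "gap * T / 2 * (x\<^sup>2 / 2 - 5 / 2) \<le> gap * T / 2 * (real k * (real k - 1))"
        using gap_pos T(1) by (intro mult_left_mono) auto
      moreover have "\<kappa>' * t\<^sup>2 = gap * T / 2 * (x\<^sup>2 / 2)"
        using T(1) unfolding \<kappa>'_def tx by (simp add: power2_eq_square field_simps)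
      moreover have "gap * T / 2 * (x\<^sup>2 / 2 - 5 / 2) = gap * T / 2 * (x\<^sup>2 / 2) - 5 * gap * T / 4"
        "gap * T / 2 * (real k * (real k - 1)) = gap * T * (real k * (real k - 1) / 2)"
        by (simp_all add: right_diff_distrib)
      ultimately have "- (gap * T * (real k * (real k - 1) / 2)) \<le> 5 * gap * T / 4 - \<kappa>' * t\<^sup>2"
        by linarith
      then show ?thesis unfolding E_def using \<rho>0(1) by (intro mult_left_mono) auto
    qed
    also have "\<dots> = \<rho>0 * exp (5 * gap * T / 4) * exp (- \<kappa>' * t\<^sup>2)" by (simp only: mult.assoc exp_add[symmetric]) simp
    also have "\<dots> \<le> C * exp (- \<kappa>' * t\<^sup>2)" by (intro mult_right_mono) (auto simp: C_def)
    finally show ?thesis .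
  next
    case False
    have "\<kappa>' * t\<^sup>2 \<le> \<kappa>' * T\<^sup>2" using False t \<kappa>' by (intro mult_left_mono power_mono) auto
    also have "\<dots> = gap * T / 4" using T(1) by (simp add: \<kappa>'_def power2_eq_square)
    finally have e1: "1 \<le> exp (gap * T / 4) * exp (- \<kappa>' * t\<^sup>2)" by (simp add: exp_add[symmetric])
    have "norm (state 1 (0 + \<omega> * t) 1 0 0) = 1" by (simp add: norm_state del: One_nat_def)
    then have "norm (state 1 (0 + \<omega> * t) 1 0 0 - V t) \<le> 1 + 2"
      using V_bound[of t] norm_triangle_ineq4[of "state 1 (0 + \<omega> * t) 1 0 0" "V t"] by linarith
    also have "\<dots> \<le> 3 * (exp (gap * T / 4) * exp (- \<kappa>' * t\<^sup>2))" using e1 by simp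
    also have "\<dots> \<le> C * exp (- \<kappa>' * t\<^sup>2)" using \<rho>0(1) by (simp add: C_def distrib_right)
    finally show ?thesis .
  qed
  have "V 0 \<noteq> state 1 (0 + \<omega> * 0) 1 0 0"
  proof
    assume "V 0 = state 1 (0 + \<omega> * 0) 1 0 0"
    then have "rsq (past 0) = rsq (state 1 (0 + \<omega> * 0) 1 0 0)" by (simp add: V_def)
    then have "(1 / sqrt (1 + 2 * \<rho>0))\<^sup>2 = 1" by (simp add: past_def rsq_state del: One_nat_def)
    then show False using \<rho>0(1) by (simp add: power_divide)
  qed
  with VU V_bound C \<kappa>' decay show ?thesis by (intro that)
qed

section \<open>Relaxation rate and speed of the clock\<close>

lemma low_error_mono:
  assumes "m \<le> m'" "0 \<le> \<tau>"
  shows "low_error m \<tau> \<le> low_error m' \<tau>"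
proof -
  have "0 \<le> gate_slope" using K_pos \<kappa> \<nu> s1 by (simp add: gate_slope_def)
  then show ?thesis unfolding low_error_def using assms s1(1)
    by (intro add_mono mult_right_mono mult_left_mono order_refl) auto
qed

text \<open>A slow clock leaves \<eta>, followed backwards from sqrt P / 2, enough time to exceed
  1/2 within one half turn; 1 + x \<le> exp x makes this quantitative.\<close>

lemma far_if_slow:
  assumes "0 < \<epsilon>" "0 < \<omega>" "\<omega> \<le> 2 * \<epsilon> * pi * sqrt P"
  shows "1 < 2 * (sqrt P / 2 * exp (2 * \<epsilon> * (pi / \<omega>)))"
proof -
  have P: "0 < sqrt P" using P_pos by simp
  have "1 \<le> sqrt P * (2 * \<epsilon> * (pi / \<omega>))" using assms by (simp add: field_simps)
  also have "\<dots> < sqrt P * exp (2 * \<epsilon> * (pi / \<omega>))"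
    using P exp_ge_add_one_self[of "2 * \<epsilon> * (pi / \<omega>)"] by (intro mult_strict_left_mono) linarith+
  finally show ?thesis by simp
qed

text \<open>The leading part leaves a margin \<Delta> below \<open>L\<close>. The Lipschitz
  constants of spin, relaxation and coupling depend only on the geometry fixed before, so half of
  \<Delta> is given to \<epsilon> and half to \<omega>, the coupling being proportional to
  \<omega>.\<close>

lemma accumulating_nonlinearity:
  assumes \<tau>: "6 * \<nu> + (s1 + 4 * \<nu>)\<^sup>2 \<le> \<tau>\<^sup>2" "0 \<le> \<tau>" "\<tau> \<le> 1"
    and L: "max (lam 1) (G / 2) + low_error ((mu 0 + mu 1) / 2) \<tau> < L"
  shows "\<exists>F :: 'a \<Rightarrow> 'a. smooth_map F \<and> (\<forall>u v. norm (F u - F v) \<le> L * norm (u - v)) \<and>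
           wellposed D A F \<and>
           (\<exists>\<A>. global_attractor (semigroup D A F) \<A> \<and>
              (\<exists>u v. trajectory_on D A F \<A> u \<and> trajectory_on D A F \<A> v \<and> u \<noteq> v \<and>
                 (\<exists>C>0. \<exists>\<kappa>>0. \<forall>t\<ge>0. norm (u t - v t) \<le> C * exp (- \<kappa> * t\<^sup>2))))"
proof -
  define m0 where "m0 = (mu 0 + mu 1) / 2"
  define \<Delta> where "\<Delta> = L - (max (lam 1) (G / 2) + low_error m0 \<tau>)"
  define q where "q = pi / (2 * turn pi)"
  have m0: "0 < m0" "m0 \<le> lam 1 + G / 2"
    using mu_pos[of 0] mu_pos[of 1] mu_Suc(2)[of 0] mu_0 by (simp_all add: m0_def)
  have \<Delta>: "0 < \<Delta>" using L by (simp add: \<Delta>_def m0_def)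
  have q: "0 < q" using turn_pi_pos by (simp add: q_def)
  obtain B3 where B3: "0 \<le> B3" "\<And>u v. norm (F_spin u - F_spin v) \<le> B3 * norm (u - v)"
    by (rule F_spin_lipschitz) (rule that, assumption+)
  obtain B4 where B4: "0 \<le> B4" "\<And>u v. norm (F_rad u - F_rad v) \<le> B4 * norm (u - v)"
    by (rule F_rad_lipschitz) (rule that, assumption+)
  obtain B5 where B5: "0 \<le> B5" "\<And>u v. norm (F_coup u - F_coup v) \<le> B5 * norm (u - v)"
    by (rule F_coup_lipschitz) (rule that, assumption+)
  have small: "\<exists>x>0. x \<le> y \<and> x * a \<le> \<Delta> / 2" if "0 \<le> a" "0 < y" for a y
  proof (intro exI conjI)
    show "0 < min y (\<Delta> / (2 * (a + 1)))" using that \<Delta> by simp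
    have "min y (\<Delta> / (2 * (a + 1))) * a \<le> \<Delta> / (2 * (a + 1)) * (a + 1)"
      using that \<Delta> by (intro mult_mono) auto
    also have "\<dots> = \<Delta> / 2" using that by (simp add: field_simps)
    finally show "min y (\<Delta> / (2 * (a + 1))) * a \<le> \<Delta> / 2" .
  qed simp
  \<comment> \<open>\<epsilon> precedes \<omega>, because the admissible speed of the clock depends
    on \<epsilon>; \<epsilon> \<le> m0 / 2 keeps \<open>m\<close> nonnegative.\<close>
  obtain \<epsilon> where \<epsilon>: "0 < \<epsilon>" "\<epsilon> \<le> m0 / 2" "\<epsilon> * B4 \<le> \<Delta> / 2" using small[OF B4(1), of "m0 / 2"] m0(1) by auto
  have y: "0 < 2 * \<epsilon> * pi * sqrt P" using \<epsilon>(1) P_pos by simp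
  have a: "0 \<le> B3 + q * B5" using B3(1) B5(1) q by simp
  obtain \<omega> where \<omega>: "0 < \<omega>" "\<omega> \<le> 2 * \<epsilon> * pi * sqrt P" "\<omega> * (B3 + q * B5) \<le> \<Delta> / 2" using small[OF a y] by blast
  define b where "b = \<omega> * q"
  define m where "m = m0 - 2 * \<epsilon>"
  have b: "0 < b" using \<omega>(1) q by (simp add: b_def)
  have m: "0 \<le> m" "m \<le> lam 1 + G / 2" "m \<le> m0" using \<epsilon>(1,2) m0(2) by (simp_all add: m_def)
  have lip: "norm (nonlin m \<omega> \<epsilon> b u - nonlin m \<omega> \<epsilon> b v) \<le> L * norm (u - v)" for u v
  proof -
    let ?n = "norm (u - v)"
    have "nonlin m \<omega> \<epsilon> b u - nonlin m \<omega> \<epsilon> b v = ((F_low u + F_main m u) - (F_low v + F_main m v)) +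
        (\<omega> *\<^sub>R (F_spin u - F_spin v) + \<epsilon> *\<^sub>R (F_rad u - F_rad v) + b *\<^sub>R (F_coup u - F_coup v))"
      by (simp add: nonlin_def algebra_simps)
    also have "norm \<dots> \<le> (max (lam 1) (G / 2) + low_error m \<tau>) * ?n + (\<omega> * (B3 * ?n) + \<epsilon> * (B4 * ?n) + b * (B5 * ?n))"
    proof (intro norm_triangle_le add_mono F_low_main_lipschitz m \<tau>)
      show "norm (\<omega> *\<^sub>R (F_spin u - F_spin v)) \<le> \<omega> * (B3 * ?n)"
        using B3(2)[of u v] \<omega>(1) by (simp add: mult_left_mono)
      show "norm (\<epsilon> *\<^sub>R (F_rad u - F_rad v)) \<le> \<epsilon> * (B4 * ?n)"
        using B4(2)[of u v] \<epsilon>(1) by (simp add: mult_left_mono)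
      show "norm (b *\<^sub>R (F_coup u - F_coup v)) \<le> b * (B5 * ?n)"
        using B5(2)[of u v] b by (simp add: mult_left_mono)
    qed
    also have "\<dots> = (max (lam 1) (G / 2) + low_error m \<tau> + (\<omega> * (B3 + q * B5) + \<epsilon> * B4)) * ?n"
      by (simp add: b_def algebra_simps)
    also have "\<dots> \<le> L * ?n"
      using low_error_mono[OF m(3) \<tau>(2)] \<omega>(3) \<epsilon>(3) by (intro mult_right_mono) (auto simp: \<Delta>_def)
    finally show ?thesis .
  qed
  obtain CF where CF: "\<And>u. norm (nonlin m \<omega> \<epsilon> b u) \<le> CF" by (rule nonlin_bounded) (rule that)
  have "0 \<le> low_error m0 \<tau>"
    using K_pos \<kappa> \<nu> s1 m0(1) G_pos \<tau>(2) lam_pos[of 1] by (simp add: low_error_def gate_slope_def)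
  then have "0 < L" using L lam_pos[of 1] by (simp add: m0_def)
  then have S: "semilinear e D A lam (nonlin m \<omega> \<epsilon> b) L CF"
    by unfold_locales (use lip CF in auto)
  interpret S: semilinear e D A lam "nonlin m \<omega> \<epsilon> b" L CF by (rule S)
  let ?u = "\<lambda>t. state 1 (0 + \<omega> * t) 1 0 0"
  obtain V C \<kappa>' where V: "coord_solution (nonlin m \<omega> \<epsilon> b) UNIV V" "\<And>t. norm (V t) \<le> 2" "V 0 \<noteq> ?u 0"
    "0 < C" "0 < \<kappa>'" "\<And>t. 0 \<le> t \<Longrightarrow> norm (?u t - V t) \<le> C * exp (- \<kappa>' * t\<^sup>2)"
    by (rule fast_solution[OF S \<omega>(1) b_def[unfolded q_def] \<epsilon>(1) m_def[unfolded m0_def] far_if_slow[OF \<epsilon>(1) \<omega>(1,2)]]) (rule that)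
  have tr: "trajectory_on D A (nonlin m \<omega> \<epsilon> b) S.attractor w"
    if "coord_solution (nonlin m \<omega> \<epsilon> b) UNIV w" "\<And>t. norm (w t) \<le> B" for w B
    unfolding trajectory_on_def using S.bounded_solution_in_attractor[OF that] that(1) S.is_solution_iff[of UNIV] by simp
  have u: "trajectory_on D A (nonlin m \<omega> \<epsilon> b) S.attractor ?u"
  proof (rule tr[OF periodic_solution, of 1])
    show "norm (?u t) \<le> 1" for t by (simp add: norm_state del: One_nat_def)
  qed
  have v: "trajectory_on D A (nonlin m \<omega> \<epsilon> b) S.attractor V" by (rule tr[OF V(1,2)])
  have "?u \<noteq> V" using V(3) by metis
  then show ?thesis
    using smooth_map_if_smooth_bdd[OF smooth_bdd_nonlin] lip S.wellposed S.global_attractor_attractor u v V(4-6)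
    by (intro exI[of _ "nonlin m \<omega> \<epsilon> b"] conjI allI exI[of _ S.attractor] exI[of _ ?u] exI[of _ V] exI[of _ C] exI[of _ \<kappa>']) auto
qed

end

section \<open>Choice of parameters\<close>

text \<open>The terms with \<tau>, \<kappa> and \<open>s\<close> get a quarter of \<Delta> each.
  Here \<open>s\<close> comes after \<nu>, since it has to beat the sector slope 3 K /
  \<nu>.\<close>

lemma small_parameters:
  fixes \<Delta> K m G l :: real
  assumes "0 < \<Delta>" "0 < K" "0 \<le> m" "0 \<le> G" "0 \<le> l"
  obtains \<tau> \<nu> \<kappa> s where "0 \<le> \<tau>" "\<tau> \<le> 1" "0 < \<nu>" "\<nu> \<le> 1 / 8" "0 < \<kappa>" "\<kappa> \<le> 1" "0 < s" "s \<le> 1 / 2"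
    "6 * \<nu> + (s + 4 * \<nu>)\<^sup>2 \<le> \<tau>\<^sup>2"
    "2 * l * K * \<kappa> + (m + G) * (8 * K * \<kappa> + 3 * K / \<nu> * s) + 3 * m * \<tau> + m * s < \<Delta>"
proof -
  have small: "\<exists>x>0. x \<le> y \<and> a * x \<le> \<Delta> / 4" if "0 \<le> a" "0 < y" for a y
  proof (intro exI conjI)
    show "0 < min y (\<Delta> / (4 * (a + 1)))" using that assms(1) by simp
    have "a * min y (\<Delta> / (4 * (a + 1))) \<le> (a + 1) * (\<Delta> / (4 * (a + 1)))"
      using that assms(1) by (intro mult_mono) auto
    also have "\<dots> = \<Delta> / 4" using that by (simp add: field_simps)
    finally show "a * min y (\<Delta> / (4 * (a + 1))) \<le> \<Delta> / 4" .
  qed simp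
  obtain \<tau> where \<tau>: "0 < \<tau>" "\<tau> \<le> 1" "3 * m * \<tau> \<le> \<Delta> / 4" using small[of "3 * m" 1] assms(3) by auto
  \<comment> \<open>With s \<le> \<nu> \<le> 1/32 the sum 6 \<nu> + (s + 4 \<nu>)^2 is at most 6
    \<nu> + 25 \<nu>^2, hence below 32 \<nu> = \<tau>^2.\<close>
  define \<nu> where "\<nu> = \<tau>\<^sup>2 / 32"
  have \<nu>: "0 < \<nu>" "\<nu> \<le> 1 / 32" using \<tau> power_le_one[of \<tau> 2] by (simp_all add: \<nu>_def)
  obtain \<kappa> where \<kappa>: "0 < \<kappa>" "\<kappa> \<le> 1" "(2 * l * K + (m + G) * (8 * K)) * \<kappa> \<le> \<Delta> / 4"
    using small[of "2 * l * K + (m + G) * (8 * K)" 1] assms by auto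
  obtain s where s: "0 < s" "s \<le> \<nu>" "((m + G) * (3 * K / \<nu>) + m) * s \<le> \<Delta> / 4"
    using small[of "(m + G) * (3 * K / \<nu>) + m" \<nu>] assms \<nu> by auto
  have "(s + 4 * \<nu>)\<^sup>2 \<le> (5 * \<nu>)\<^sup>2" using s \<nu> by (intro power_mono) auto
  also have "\<dots> = 25 * \<nu> * \<nu>" by (simp add: power2_eq_square)
  also have "\<dots> \<le> 25 * \<nu> * (1 / 32)" using \<nu> by (intro mult_left_mono) auto
  finally have "6 * \<nu> + (s + 4 * \<nu>)\<^sup>2 \<le> 32 * \<nu>" using \<nu>(1) by linarith
  then have "6 * \<nu> + (s + 4 * \<nu>)\<^sup>2 \<le> \<tau>\<^sup>2" by (simp add: \<nu>_def)
  moreover have "2 * l * K * \<kappa> + (m + G) * (8 * K * \<kappa> + 3 * K / \<nu> * s) + 3 * m * \<tau> + m * s =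
      (2 * l * K + (m + G) * (8 * K)) * \<kappa> + ((m + G) * (3 * K / \<nu>) + m) * s + 3 * m * \<tau>"
    by (simp add: algebra_simps)
  ultimately show ?thesis using \<tau> \<nu> \<kappa> s assms(1) by (intro that[of \<tau> \<nu> \<kappa> s]) auto
qed

text \<open>For bounded eigenvalues the vectors \<open>lam n *\<^sub>R e n\<close> form a bounded
  set which the inverse of \<open>A\<close> maps onto the orthonormal basis. Distinct basis vectors
  have distance sqrt 2, so no subsequence converges.\<close>

lemma eigenvalues_unbounded:
  assumes e: "orthonormal_basis e" and inv: "compact_inverse D A"
    and Ae: "\<And>n. e n \<in> D \<and> A (e n) = lam n *\<^sub>R e n" and lam: "0 < lam 0" "incseq lam"
  shows "filterlim lam at_top sequentially"
proof (rule ccontr)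
  assume "\<not> filterlim lam at_top sequentially"
  then obtain Z where "\<not> (\<forall>\<^sub>F n in sequentially. Z \<le> lam n)" unfolding filterlim_at_top by blast
  then have Z: "lam n \<le> Z" for n
    unfolding eventually_sequentially using incseqD[OF lam(2)] by (meson linear order_trans)
  have pos: "0 < lam n" for n using lam(1) incseqD[OF lam(2), of 0 n] by simp
  have ip: "inner (e n) (e k) = (if n = k then 1 else 0)" for n k using e by (simp add: orthonormal_basis_def)
  let ?B = "range (\<lambda>n. lam n *\<^sub>R e n)"
  have "bounded ?B" by (rule boundedI[of _ Z]) (auto simp: norm_eq_sqrt_inner ip Z less_imp_le[OF pos])
  then have comp: "compact (closure (the_inv_into D A ` ?B))" using inv by (simp add: compact_inverse_def)
  have "the_inv_into D A (lam n *\<^sub>R e n) = e n" for n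
    using the_inv_into_f_f[of A D "e n"] inv Ae[of n] by (simp add: compact_inverse_def bij_betw_def)
  then have "e n \<in> closure (the_inv_into D A ` ?B)" for n
    by (intro subsetD[OF closure_subset]) (metis imageI rangeI)
  then obtain l r where r: "strict_mono r" "(e \<circ> r) \<longlonglongrightarrow> l"
    using comp unfolding compact_def by metis
  then have "Cauchy (e \<circ> r)" using LIMSEQ_imp_Cauchy by blast
  from metric_CauchyD[OF this zero_less_one] obtain M
    where M: "\<forall>m\<ge>M. \<forall>n\<ge>M. dist ((e \<circ> r) m) ((e \<circ> r) n) < 1" by blast
  then have "dist (e (r M)) (e (r (Suc M))) < 1" by simp
  moreover have "r M \<noteq> r (Suc M)" using strict_mono_less[OF r(1), of M "Suc M"] by simp
  then have "inner (e (r M) - e (r (Suc M))) (e (r M) - e (r (Suc M))) = 2"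
    by (simp add: inner_diff_left inner_diff_right ip)
  ultimately show False by (simp add: dist_norm norm_eq_sqrt_inner)
qed

theorem theorem2p1:
  fixes D :: "'a::{real_inner,complete_space} set"
    and A :: "'a \<Rightarrow> 'a"
    and e :: "nat \<Rightarrow> 'a"
    and lam :: "nat \<Rightarrow> real"
    and L :: real
  assumes "self_adjoint D A"
    and "positive_op D A"
    and "compact_inverse D A"
    and "orthonormal_basis e"
    and "\<forall>n. e n \<in> D \<and> A (e n) = lam n *\<^sub>R e n"
    and "0 < lam 0"
    and "incseq lam"
    and "bdd_above (range (\<lambda>n. lam (Suc n) - lam n))"
    and "L > (SUP n. lam (Suc n) - lam n) / 2"
    and "L > lam 1"
  shows "\<exists>F :: 'a \<Rightarrow> 'a. smooth_map F \<and> (\<forall>u v. norm (F u - F v) \<le> L * norm (u - v)) \<and>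
           wellposed D A F \<and>
           (\<exists>\<A>. global_attractor (semigroup D A F) \<A> \<and>
              (\<exists>u v. trajectory_on D A F \<A> u \<and> trajectory_on D A F \<A> v \<and> u \<noteq> v \<and>
                 (\<exists>C>0. \<exists>\<kappa>>0. \<forall>t\<ge>0. norm (u t - v t) \<le> C * exp (- \<kappa> * t\<^sup>2))))"
proof -
  interpret spectral_op e D A lam
  proof
    show "inner (A u) v = inner u (A v)" if "u \<in> D" "v \<in> D" for u v
      using assms(1) that by (simp add: self_adjoint_def)
    show "filterlim lam at_top sequentially"
      using eigenvalues_unbounded[OF assms(4,3) _ assms(6,7)] assms(5) by blast
  qed (use assms in auto)
  define L0 where "L0 = (SUP n. lam (Suc n) - lam n)"
  \<comment> \<open>L0 + c = L + L0 / 2 is below 2 L by the assumption on \<open>L\<close>. The same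
    \<open>c\<close> serves as the minimal gap and as the excess over \<open>L0\<close>.\<close>
  define c where "c = (2 * L - L0) / 2"
  have c: "0 < c" "L0 + c < 2 * L" using assms(9) by (simp_all add: c_def L0_def field_simps)
  have L0: "lam (Suc n) - lam n \<le> L0" for n unfolding L0_def using assms(8) by (intro cSUP_upper) auto
  obtain N where N: "strict_mono N" "N 0 = Suc 0" "\<And>k. c \<le> lam (N (Suc k)) - lam (N k)"
      "\<And>k. lam (N (Suc k)) - lam (N k) \<le> L0 + c"
    by (rule chain_exists[OF lam_mono lam_lim L0 c(1)]) (rule that)
  interpret eigen_chain e D A lam N c "L0 + c" by unfold_locales (use N c in auto)
  define \<Delta> where "\<Delta> = L - max (lam 1) ((L0 + c) / 2)"
  have \<Delta>: "0 < \<Delta>" using assms(10) c(2) by (simp add: \<Delta>_def)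
  obtain K c' where K: "K > 0"
    "\<And>\<kappa> P p. 0 < P \<Longrightarrow> 0 \<le> p \<Longrightarrow> (log_cutoff \<kappa> P has_real_derivative c' \<kappa> P p) (at p)"
    "\<And>\<kappa> P p. 0 < P \<Longrightarrow> 0 \<le> p \<Longrightarrow> 0 < \<kappa> \<Longrightarrow> \<bar>c' \<kappa> P p\<bar> * (P + p) \<le> K * \<kappa>"
    "\<And>\<kappa> P p. 0 < P \<Longrightarrow> 0 < \<kappa> \<Longrightarrow> P * exp (2 / \<kappa>) \<le> p \<Longrightarrow> c' \<kappa> P p = 0"
    "\<And>x. \<exists>D. (smooth_step has_real_derivative D) (at x) \<and> \<bar>D\<bar> \<le> K"
    by (rule log_cutoff_derivative) (rule that)
  have nonneg: "0 \<le> (mu 0 + mu 1) / 2" "0 \<le> L0 + c" "0 \<le> lam 1"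
    using mu_pos[of 0] mu_pos[of 1] G_pos lam_pos[of 1] by simp_all
  obtain \<tau> \<nu> \<kappa> s where p: "0 \<le> \<tau>" "\<tau> \<le> 1" "0 < \<nu>" "\<nu> \<le> 1 / 8" "0 < \<kappa>" "\<kappa> \<le> 1" "0 < s" "s \<le> 1 / 2"
    "6 * \<nu> + (s + 4 * \<nu>)\<^sup>2 \<le> \<tau>\<^sup>2"
    "2 * lam 1 * K * \<kappa> + ((mu 0 + mu 1) / 2 + (L0 + c)) * (8 * K * \<kappa> + 3 * K / \<nu> * s) + 3 * ((mu 0 + mu 1) / 2) * \<tau>
      + (mu 0 + mu 1) / 2 * s < \<Delta>"
    by (rule small_parameters[OF \<Delta> K(1) nonneg]) (rule that)
  interpret clock e D A lam N c "L0 + c" \<nu> \<kappa> "s\<^sup>2 * exp (- (2 / \<kappa>))" s K c'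
  proof
    show "s\<^sup>2 * exp (- (2 / \<kappa>)) * exp (2 / \<kappa>) \<le> s\<^sup>2" by (simp add: mult.assoc exp_add[symmetric])
    show "0 < s\<^sup>2 * exp (- (2 / \<kappa>))" using p(7) by simp
  qed (use p(3-8) K in auto)
  show ?thesis
  proof (rule accumulating_nonlinearity[OF p(9,1,2)])
    show "max (lam 1) ((L0 + c) / 2) + low_error ((mu 0 + mu 1) / 2) \<tau> < L"
      using p(10) unfolding low_error_def gate_slope_def \<Delta>_def by linarith
  qed
qed

end
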